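(* Let $G\in\{\mathbb Z^2,\mathbb H\}$ and let $\lambda>\lambda_c(\mathcal T_G)$. Then, under the measure $\mathbb P^{G}_\lambda$ (the law of the limit walk of parameter $\lambda$ on the self-avoiding tree $\mathcal T_G$), the limit walk almost surely visits the line $\mathbb Z\times\{0\}$ infinitely many times.
   Context: $\mathbb H=\{(x,y)\in\mathbb Z^2: y\ge 0\}$, with nearest-neighbour edges. For $G\in\{\mathbb Z^2,\mathbb H\}$, the self-avoiding tree $\mathcal T_G$ is the tree whose vertices are the finite self-avoiding nearest-neighbour walks in $G$ starting at the origin $(0,0)$, two being adjacent when one is a one-step extension of the other; its root $o$ is the walk of length $0$. A ray (infinite simple path from the root) of $\mathcal T_G$ is identified with an infinite self-avoiding walk in $G$ started at the origin. For $\lambda>0$, $RW_\lambda$ is the Markov chain on the vertices of $\mathcal T_G$ started at $o$ which, at a vertex $x\ne o$ with $k$ children, jumps to the parent of $x$ with probability $1/(1+k\lambda)$ and to each child with probability $\lambda/(1+k\lambda)$; from $o$ it jumps to a uniformly chosen child. $\lambda_c(\mathcal T_G)$ is the critical value: $RW_\lambda$ is recurrent for $\lambda<\lambda_c$ and transient for $\lambda>\lambda_c$. For $\lambda>\lambda_c(\mathcal T_G)$, the chain $(X_n)$ is transient, and the limit walk $\omega^\infty_\lambda$ is the random ray defined by: $\omega_\lambda^\infty(k)=\nu$ iff $\nu$ is a vertex at distance $k$ from the root and there is $n_0$ such that for all $n>n_0$, $X_n$ belongs to the subtree of descendants of $\nu$ (including $\nu$). Viewed as an infinite self-avoiding walk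 in $G$, its law is denoted $\mathbb P^G_\lambda$. *)

theory Defs
  imports "HOL-Probability.Probability"
begin

section \<open>Markov chains on a discrete state space\<close>

definition chain_kernel :: "'a \<Rightarrow> ('a \<Rightarrow> 'a pmf) \<Rightarrow> nat \<Rightarrow> (nat \<Rightarrow> 'a) \<Rightarrow> 'a measure" where
  "chain_kernel s K n X = measure_pmf (case n of 0 \<Rightarrow> return_pmf s | Suc m \<Rightarrow> K (X m))"

text \<open>
  The law, on the space of trajectories, of the Markov chain started at \<open>s\<close> with
  transition probabilities \<open>K\<close>. It is the projective limit provided by the theorem of
  Ionescu-Tulcea; its finite-dimensional distributions are computed in
  \<open>markov_chain_law_cylinder\<close> below.
\<close>

definition markov_chain_law :: "'a \<Rightarrow> ('a \<Rightarrow> 'a pmf) \<Rightarrow> (nat \<Rightarrow> 'a) measure" where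
  "markov_chain_law s K =
     projective_family.lim UNIV
       (Ionescu_Tulcea.CI (chain_kernel s K) (\<lambda>_. count_space UNIV)) (\<lambda>_. count_space UNIV)"

lemma Ionescu_Tulcea_chain_kernel:
  "Ionescu_Tulcea (chain_kernel s K) (\<lambda>_. count_space UNIV)"
proof (rule Ionescu_Tulcea.intro)
  fix i
  show "chain_kernel s K i \<in> PiM {0..<i} (\<lambda>_. count_space UNIV) \<rightarrow>\<^sub>M
          subprob_algebra (count_space UNIV)"
  proof (cases i)
    case 0
    then show ?thesis
      by (auto simp: chain_kernel_def[abs_def] measure_pmf_in_subprob_algebra)
  next
    case (Suc m)
    have "(\<lambda>X. X m) \<in> PiM {0..<i} (\<lambda>_. count_space UNIV) \<rightarrow>\<^sub>M count_space UNIV"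
      using Suc by (intro measurable_component_singleton) auto
    moreover have "(\<lambda>x. measure_pmf (K x)) \<in> count_space UNIV \<rightarrow>\<^sub>M
                     subprob_algebra (count_space UNIV)"
      by (auto simp: measure_pmf_in_subprob_algebra)
    ultimately have "(\<lambda>X. measure_pmf (K (X m))) \<in> PiM {0..<i} (\<lambda>_. count_space UNIV) \<rightarrow>\<^sub>M
                     subprob_algebra (count_space UNIV)"
      by (rule measurable_compose)
    then show ?thesis
      using Suc by (simp add: chain_kernel_def[abs_def])
  qed
next
  fix i X
  show "prob_space (chain_kernel s K i X)"
    by (simp add: chain_kernel_def measure_pmf.prob_space_axioms)
qed

lemma sets_markov_chain_law [measurable_cong]:
  "sets (markov_chain_law s K) = sets (PiM UNIV (\<lambda>_. count_space UNIV))"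
proof -
  interpret Ionescu_Tulcea "chain_kernel s K" "\<lambda>_. count_space UNIV"
    by (rule Ionescu_Tulcea_chain_kernel)
  show ?thesis
    unfolding markov_chain_law_def by (rule PF.sets_lim)
qed

lemma space_markov_chain_law [simp]: "space (markov_chain_law s K) = UNIV"
  using sets_eq_imp_space_eq[OF sets_markov_chain_law[of s K]] by (simp add: space_PiM)

lemma prob_space_markov_chain_law: "prob_space (markov_chain_law s K)"
proof -
  interpret Ionescu_Tulcea "chain_kernel s K" "\<lambda>_. count_space UNIV"
    by (rule Ionescu_Tulcea_chain_kernel)
  show ?thesis
  proof (rule prob_spaceI)
    have "emeasure PF.lim (PF.emb UNIV {} {\<lambda>_. undefined}) = emeasure (CI {}) {\<lambda>_. undefined}"
      by (rule lim) (auto simp: PiM_empty)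
    moreover have "PF.emb UNIV {} {\<lambda>_. undefined} = (UNIV :: (nat \<Rightarrow> 'a) set)"
      by (auto simp: prod_emb_def space_PiM restrict_def)
    moreover have "emeasure (CI {}) {\<lambda>_. undefined} = 1"
    proof -
      interpret CE: prob_space "CI {}" by (rule PF.prob_space_P) auto
      have "space (CI {}) = {\<lambda>_. undefined}"
        by (subst PF.space_P) (auto simp: space_PiM)
      then show ?thesis using CE.emeasure_space_1 by simp
    qed
    ultimately have "emeasure PF.lim UNIV = 1" by simp
    then show "emeasure (markov_chain_law s K) (space (markov_chain_law s K)) = 1"
      by (simp add: markov_chain_law_def[symmetric])
  qed
qed

lemma chain_C_cylinder:
  fixes x :: "nat \<Rightarrow> 'a"
  shows "emeasure (Ionescu_Tulcea.C (chain_kernel s K) (\<lambda>_. count_space UNIV) 0 (Suc n) (\<lambda>_. undefined))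
       (PiE {0..<Suc n} (\<lambda>i. {x i})) =
     (if x 0 = s then ennreal (\<Prod>i<n. pmf (K (x i)) (x (Suc i))) else 0)"
proof -
  interpret Ionescu_Tulcea "chain_kernel s K" "\<lambda>_. count_space UNIV"
    by (rule Ionescu_Tulcea_chain_kernel)
  let ?A = "\<lambda>n. PiE {0..<n} (\<lambda>i. {x i})"
  let ?M = "\<lambda>n. PiM {0..<n} (\<lambda>_. count_space UNIV :: 'a measure)"
  have A [measurable]: "?A n \<in> sets (?M n)" for n
    by (intro sets_PiM_I_finite) auto
  have u [simp]: "(\<lambda>_. undefined) \<in> space (?M 0)"
    by (auto simp: space_PiM)
  have step: "emeasure (C 0 (Suc n) (\<lambda>_. undefined)) (?A (Suc n)) =
      emeasure (C 0 n (\<lambda>_. undefined)) (?A n) *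
      emeasure (chain_kernel s K n x) {x n}" for n
  proof -
    have e: "emeasure (eP n X) (?A (Suc n)) =
        indicator (?A n) X * emeasure (chain_kernel s K n x) {x n}"
      if X: "X \<in> space (?M n)" for X
    proof -
      have "emeasure (eP n X) (?A (Suc n)) =
          emeasure (chain_kernel s K n X) ((\<lambda>y. fun_upd X n y) -` ?A (Suc n) \<inter> space (count_space UNIV))"
        using X by (intro emeasure_eP) auto
      also have "(\<lambda>y. fun_upd X n y) -` ?A (Suc n) \<inter> space (count_space UNIV) =
          (if X \<in> ?A n then {x n} else {})"
        using X by (auto simp: PiE_iff space_PiM extensional_def less_Suc_eq split: if_splits)
      also have "emeasure (chain_kernel s K n X) \<dots> =
          indicator (?A n) X * emeasure (chain_kernel s K n x) {x n}"
      proof (cases "X \<in> ?A n")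
        case True
        then have "chain_kernel s K n X = chain_kernel s K n x"
          by (cases n) (auto simp: chain_kernel_def PiE_iff)
        with True show ?thesis by simp
      qed auto
      finally show ?thesis .
    qed
    have "emeasure (C 0 (Suc n) (\<lambda>_. undefined)) (?A (Suc n)) =
        (\<integral>\<^sup>+X. emeasure (eP n X) (?A (Suc n)) \<partial>C 0 n (\<lambda>_. undefined))"
    proof -
      have "eP n \<in> C 0 n (\<lambda>_. undefined) \<rightarrow>\<^sub>M subprob_algebra (?M (Suc n))"
      proof -
        have "sets (C 0 n (\<lambda>_. undefined)) = sets (?M n)"
          using sets_C[OF u, of n] by simp
        then show ?thesis
          using measurable_eP[of n] measurable_cong_sets by blast
      qed
      moreover have "space (C 0 n (\<lambda>_. undefined)) \<noteq> {}"
        by (simp add: prob_space.not_empty prob_space_C)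
      ultimately show ?thesis
        using emeasure_bind[OF _ _ A[of "Suc n"]] by simp
    qed
    also have "\<dots> = (\<integral>\<^sup>+X. emeasure (chain_kernel s K n x) {x n} * indicator (?A n) X \<partial>C 0 n (\<lambda>_. undefined))"
      by (intro nn_integral_cong) (auto simp: space_C e mult.commute)
    also have "\<dots> = emeasure (chain_kernel s K n x) {x n} * emeasure (C 0 n (\<lambda>_. undefined)) (?A n)"
      by (intro nn_integral_cmult_indicator) (simp add: sets_C)
    finally show ?thesis by (simp add: mult.commute)
  qed
  show ?thesis
  proof (induction n)
    case 0
    have "emeasure (C 0 0 (\<lambda>_. undefined)) (?A 0) = 1"
      using A[of 0] by (simp add: indicator_def)
    then show ?case
      unfolding step[of 0] by (auto simp: chain_kernel_def)
  next
    case (Suc n)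
    have "emeasure (chain_kernel s K (Suc n) x) {x (Suc n)} = ennreal (pmf (K (x n)) (x (Suc n)))"
      by (simp add: chain_kernel_def emeasure_pmf_single)
    then show ?case
      unfolding step[of "Suc n"] Suc.IH by (simp add: ennreal_mult prod_nonneg)
  qed
qed

lemma markov_chain_law_cylinder:
  "emeasure (markov_chain_law s K) {X. \<forall>i\<le>n. X i = x i} =
     (if x 0 = s then ennreal (\<Prod>i<n. pmf (K (x i)) (x (Suc i))) else 0)"
proof -
  interpret Ionescu_Tulcea "chain_kernel s K" "\<lambda>_. count_space UNIV"
    by (rule Ionescu_Tulcea_chain_kernel)
  let ?A = "PiE {0..<Suc n} (\<lambda>i. {x i})"
  have A: "?A \<in> sets (PiM {0..<Suc n} (\<lambda>_. count_space UNIV))"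
    by (intro sets_PiM_I_finite) auto
  have eq: "{X. \<forall>i\<le>n. X i = x i} = PF.emb UNIV {0..<Suc n} ?A"
    by (auto simp: prod_emb_def space_PiM PiE_iff less_Suc_eq_le)
  have "emeasure (markov_chain_law s K) {X. \<forall>i\<le>n. X i = x i} = emeasure (CI {0..<Suc n}) ?A"
    unfolding eq markov_chain_law_def by (intro lim A) auto
  also have "\<dots> = emeasure (C 0 (Suc n) (\<lambda>_. undefined)) (PF.emb {0..<Suc n} {0..<Suc n} ?A)"
    by (intro emeasure_CI A) auto
  also have "PF.emb {0..<Suc n} {0..<Suc n} ?A = ?A"
    by (auto simp: prod_emb_def space_PiM PiE_iff extensional_def fun_eq_iff restrict_def)
  finally show ?thesis
    by (simp only: chain_C_cylinder)
qed


section \<open>Self-avoiding trees\<close>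

type_synonym site = "int \<times> int"

definition nbr :: "site \<Rightarrow> site \<Rightarrow> bool" where
  "nbr p q \<longleftrightarrow> \<bar>fst p - fst q\<bar> + \<bar>snd p - snd q\<bar> = 1"

definition half_plane :: "site set" where
  "half_plane = {(x, y). y \<ge> 0}"

text \<open>
  A walk is the list of the sites it visits, so that a walk of length \<open>n\<close> is a list with
  \<open>n + 1\<close> entries.
\<close>

definition saws :: "site set \<Rightarrow> site list set" where
  "saws G = {w. w \<noteq> [] \<and> hd w = (0, 0) \<and> distinct w \<and> set w \<subseteq> G \<and> successively nbr w}"

definition root :: "site list" where
  "root = [(0, 0)]"

definition children :: "site set \<Rightarrow> site list \<Rightarrow> site list set" where
  "children G x = {y \<in> saws G. \<exists>v. y = x @ [v]}"

definition parent :: "site list \<Rightarrow> site list" where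
  "parent x = butlast x"

definition subtree :: "site set \<Rightarrow> site list \<Rightarrow> site list set" where
  "subtree G x = {y \<in> saws G. \<exists>zs. y = x @ zs}"

lemma finite_children: "finite (children G x)"
proof (rule finite_subset)
  let ?a = "fst (last x)" and ?b = "snd (last x)"
  show "children G x \<subseteq> (\<lambda>v. x @ [v]) ` (insert (0,0) ({?a - 1..?a + 1} \<times> {?b - 1..?b + 1}))"
  proof
    fix y assume "y \<in> children G x"
    then obtain v where y: "y = x @ [v]" "hd y = (0,0)" "successively nbr y"
      by (auto simp: children_def saws_def)
    have "v \<in> insert (0,0) ({?a - 1..?a + 1} \<times> {?b - 1..?b + 1})"
    proof (cases "x = []")
      case True
      then show ?thesis using y by auto
    next
      case False
      then have "nbr (last x) v"
        using y by (simp add: successively_append_iff)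
      then show ?thesis by (cases v) (auto simp: nbr_def)
    qed
    then show "y \<in> (\<lambda>v. x @ [v]) ` (insert (0,0) ({?a - 1..?a + 1} \<times> {?b - 1..?b + 1}))"
      using y(1) by blast
  qed
qed auto

lemma parent_notin_children: "parent x \<notin> children G x"
proof
  assume "parent x \<in> children G x"
  then obtain v where "butlast x = x @ [v]" by (auto simp: children_def parent_def)
  then have "length (butlast x) = length (x @ [v])" by (rule arg_cong)
  then show False by simp
qed


section \<open>The biased random walk\<close>

definition step_prob :: "site set \<Rightarrow> real \<Rightarrow> site list \<Rightarrow> site list \<Rightarrow> real" where
  "step_prob G lam x y =
     (if y = parent x then 1 / (1 + real (card (children G x)) * lam)
      else if y \<in> children G x then lam / (1 + real (card (children G x)) * lam)
      else 0)"

definition RW_step :: "site set \<Rightarrow> real \<Rightarrow> site list \<Rightarrow> site list pmf" where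
  "RW_step G lam x =
     (if x = root then pmf_of_set (children G x) else embed_pmf (step_prob G lam x))"

lemma pmf_RW_step:
  assumes "lam > 0" "x \<noteq> root"
  shows "pmf (RW_step G lam x) y = step_prob G lam x y"
proof -
  let ?k = "real (card (children G x))"
  have pos: "1 + ?k * lam > 0"
    using assms by (intro add_pos_nonneg) auto
  have nn: "0 \<le> step_prob G lam x y" for y
    using pos assms by (auto simp: step_prob_def)
  have "(\<integral>\<^sup>+y. ennreal (step_prob G lam x y) \<partial>count_space UNIV) =
      (\<Sum>y\<in>insert (parent x) (children G x). ennreal (step_prob G lam x y))"
    using finite_children[of G x]
    by (intro nn_integral_count_space') (auto simp: step_prob_def)
  also have "\<dots> = ennreal (\<Sum>y\<in>insert (parent x) (children G x). step_prob G lam x y)"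
    using nn by simp
  also have "(\<Sum>y\<in>insert (parent x) (children G x). step_prob G lam x y) =
      1 / (1 + ?k * lam) + (\<Sum>y\<in>children G x. step_prob G lam x y)"
    using finite_children[of G x] parent_notin_children[of x G] by (simp add: step_prob_def)
  also have "(\<Sum>y\<in>children G x. step_prob G lam x y) = (\<Sum>y\<in>children G x. lam / (1 + ?k * lam))"
    using parent_notin_children[of x G] by (intro sum.cong) (auto simp: step_prob_def)
  also have "1 / (1 + ?k * lam) + \<dots> = 1"
    using pos by (simp add: add_divide_distrib[symmetric])
  finally have "(\<integral>\<^sup>+y. ennreal (step_prob G lam x y) \<partial>count_space UNIV) = 1" by simp
  then show ?thesis
    using assms(2) nn by (simp add: RW_step_def pmf_embed_pmf)
qed

definition RW :: "site set \<Rightarrow> real \<Rightarrow> (nat \<Rightarrow> site list) measure" where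
  "RW G lam = markov_chain_law root (RW_step G lam)"

definition RW_recurrent :: "site set \<Rightarrow> real \<Rightarrow> bool" where
  "RW_recurrent G lam \<longleftrightarrow> (AE X in RW G lam. \<exists>n>0. X n = root)"

definition RW_transient :: "site set \<Rightarrow> real \<Rightarrow> bool" where
  "RW_transient G lam \<longleftrightarrow> \<not> RW_recurrent G lam"

text \<open>
  The supremum is taken in the extended nonnegative reals, so it is \<open>0\<close> if there is no
  recurrent parameter and \<open>\<infinity>\<close> if the recurrent parameters are unbounded. Any threshold
  between recurrence and transience equals \<open>lambda_c\<close>: see \<open>lambda_c_eqI\<close>.
\<close>

definition lambda_c :: "site set \<Rightarrow> ennreal" where
  "lambda_c G = Sup {ennreal lam | lam. lam > 0 \<and> RW_recurrent G lam}"

lemma RW_transient_if_gt_lambda_c: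
  assumes "ennreal lam > lambda_c G"
  shows "lam > 0" "RW_transient G lam"
proof -
  show pos: "lam > 0"
    using assms by (metis ennreal_eq_0_iff not_less not_less_zero)
  show "RW_transient G lam"
  proof (rule ccontr)
    assume "\<not> RW_transient G lam"
    then have "ennreal lam \<in> {ennreal lam | lam. lam > 0 \<and> RW_recurrent G lam}"
      using pos by (auto simp: RW_transient_def)
    then have "ennreal lam \<le> lambda_c G"
      unfolding lambda_c_def by (rule Sup_upper)
    then show False using assms by simp
  qed
qed

lemma lambda_c_eqI:
  assumes "c \<ge> 0"
    and rec: "\<And>lam. 0 < lam \<Longrightarrow> lam < c \<Longrightarrow> RW_recurrent G lam"
    and trans: "\<And>lam. lam > c \<Longrightarrow> RW_transient G lam"
  shows "lambda_c G = ennreal c"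
proof (rule antisym)
  show "lambda_c G \<le> ennreal c"
    unfolding lambda_c_def
  proof (rule Sup_least)
    fix z assume "z \<in> {ennreal lam | lam. lam > 0 \<and> RW_recurrent G lam}"
    then obtain lam where "z = ennreal lam" "RW_recurrent G lam" by auto
    then show "z \<le> ennreal c"
      using trans[of lam] by (metis RW_transient_def ennreal_leI not_less)
  qed
  show "ennreal c \<le> lambda_c G"
  proof (rule dense_le)
    fix z assume z: "z < ennreal c"
    show "z \<le> lambda_c G"
    proof (cases "z = 0")
      case False
      from z obtain r where r: "z = ennreal r" "0 \<le> r"
        by (cases z) auto
      with False z assms(1) have "0 < r" "r < c"
        by (auto simp: ennreal_less_iff)
      then have "RW_recurrent G r" by (rule rec)
      with \<open>0 < r\<close> r(1) show ?thesis
        unfolding lambda_c_def by (intro Sup_upper) auto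
    qed simp
  qed
qed


section \<open>The limit walk\<close>

text \<open>
  For a trajectory that is not eventually in one subtree of level \<open>k\<close>, the value of
  \<open>limit_walk\<close> at \<open>k\<close> is unspecified; for a transient walk this has probability \<open>0\<close>.
\<close>

definition limit_walk :: "site set \<Rightarrow> (nat \<Rightarrow> site list) \<Rightarrow> nat \<Rightarrow> site list" where
  "limit_walk G X k = (THE x. x \<in> saws G \<and> length x = Suc k \<and>
     (\<exists>n0. \<forall>n>n0. X n \<in> subtree G x))"

text \<open>
  A ray of the tree is an increasing sequence of walks; the \<open>k\<close>-th site of the infinite
  walk it represents is the endpoint of its \<open>k\<close>-th vertex.
\<close>

definition limit_law :: "site set \<Rightarrow> real \<Rightarrow> (nat \<Rightarrow> site) measure" where
  "limit_law G lam =
     distr (RW G lam) (PiM UNIV (\<lambda>_. count_space UNIV)) (\<lambda>X k. last (limit_walk G X k))"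

lemma limit_walk_eqI:
  assumes "x \<in> saws G" "length x = Suc k" "\<And>n. n > n0 \<Longrightarrow> X n \<in> subtree G x"
  shows "limit_walk G X k = x"
  unfolding limit_walk_def
proof (rule the_equality)
  show "x \<in> saws G \<and> length x = Suc k \<and> (\<exists>n0. \<forall>n>n0. X n \<in> subtree G x)"
    using assms by blast
next
  fix y assume y: "y \<in> saws G \<and> length y = Suc k \<and> (\<exists>n0. \<forall>n>n0. X n \<in> subtree G y)"
  then obtain n1 where "\<And>n. n > n1 \<Longrightarrow> X n \<in> subtree G y" by blast
  then have "X (Suc (max n0 n1)) \<in> subtree G x" "X (Suc (max n0 n1)) \<in> subtree G y"
    using assms(3) by auto
  then show "y = x"
    using y assms(2) by (auto simp: subtree_def)
qed

lemma measurable_limit_walk: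
  "(\<lambda>X k. last (limit_walk G X k)) \<in> RW G lam \<rightarrow>\<^sub>M PiM UNIV (\<lambda>_. count_space UNIV)"
proof (rule measurable_PiM_single')
  fix k
  have [measurable]: "Measurable.pred (RW G lam) (\<lambda>X. X n \<in> S)" for n S
  proof -
    have "(\<lambda>X. X n) \<in> RW G lam \<rightarrow>\<^sub>M count_space UNIV"
      unfolding RW_def measurable_cong_sets[OF sets_markov_chain_law refl]
      by (rule measurable_component_singleton) simp
    then show ?thesis
      by (rule measurable_compose) simp
  qed
  have "(\<lambda>X. limit_walk G X k) \<in> RW G lam \<rightarrow>\<^sub>M count_space UNIV"
    unfolding limit_walk_def
  proof (rule measurable_THE[where I = UNIV])
    fix X :: "nat \<Rightarrow> site list" and x y
    assume "x \<in> saws G \<and> length x = Suc k \<and> (\<exists>n0. \<forall>n>n0. X n \<in> subtree G x)"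
      and "y \<in> saws G \<and> length y = Suc k \<and> (\<exists>n0. \<forall>n>n0. X n \<in> subtree G y)"
    then show "x = y"
      using limit_walk_eqI[of x G k _ X] limit_walk_eqI[of y G k _ X] by metis
  next
    fix x
    show "Measurable.pred (RW G lam)
        (\<lambda>X. x \<in> saws G \<and> length x = Suc k \<and> (\<exists>n0. \<forall>n>n0. X n \<in> subtree G x))"
      by measurable
  qed simp_all
  then show "(\<lambda>X. last (limit_walk G X k)) \<in> RW G lam \<rightarrow>\<^sub>M count_space UNIV"
    by (rule measurable_compose) simp
qed simp

lemma prob_space_limit_law: "prob_space (limit_law G lam)"
  unfolding limit_law_def
  by (intro prob_space.prob_space_distr measurable_limit_walk)
     (simp add: RW_def prob_space_markov_chain_law)

end

theory Submission
  imports Defs "HOL-Library.Sublist"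
begin

text \<open>
  If the walk on the tree visits infinitely often vertices \<open>v\<close> on the line \<open>\<int> \<times> {0}\<close> from which it
  never returns to the parent of \<open>v\<close> with probability at least some \<open>c > 0\<close>, then almost surely it
  infinitely often does not return, and each time it does not, \<open>v\<close> is a prefix of the limit walk.

  Transience for some \<open>\<lambda>' < \<lambda>\<close> forces the number of self-avoiding walks to grow like \<open>\<lambda>'\<^sup>-\<^sup>n\<close>, and
  by the Hammersley--Welsh decomposition there is an \<open>n\<close> with at least \<open>4 \<lambda>\<^sup>-\<^sup>n\<close> bridges of
  length \<open>n\<close>. Concatenated bridges, reflected so as to remain in a corridor, form a subtree on which
  the walk escapes. Hence the escape probability is bounded below at every vertex on the line next
  to which a corridor is free; from a site of a horizontal strip which is farther out than all
  earlier sites in the strip, such a vertex is reached with a probability that is bounded below.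

  Otherwise all sites of a strip which the walk visits lie in a bounded set. If a site were visited
  infinitely often, then so would be its component in the complement of the limit walk, an infinite
  set which lies between two parts of the limit walk; this is impossible in the plane. So
  every site is visited finitely often, and the walk stays off the line after it has moved far enough
  along the limit walk. But then it behaves like the walk in an empty half-plane, which returns to
  the boundary line by the reflection symmetry: a contradiction.
\<close>

section \<open>Markov chains on a countable state space\<close>

text \<open>Escape probabilities on the tree have no uniform lower bound: the past of a walk can
  trap its endpoint. The number 4 in front of \<lambda>^-n pays for two losses: half of the bridges
  are discarded when the path is steered back towards the middle of the corridor, and another factor
  2 is spent on a decay over n steps that absorbs the nonlinear term in the recursion for escape
  probabilities. The return to the boundary of the half-plane is shown indirectly. If the boundary
  could be avoided with positive probability, the walk would be laterally unbounded, and beyond a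
  lateral record lies an empty half-plane turned by a right angle. There the old boundary is
  perpendicular to the new one, at a distance equal to the height of the record, and a path avoiding
  the new boundary almost surely has to meet the old one or its mirror image; so symmetry gives a
  positive lower bound for reaching the old boundary, the same for all records.\<close>

abbreviation path_space :: "(nat \<Rightarrow> 'a) measure" where
  "path_space \<equiv> PiM UNIV (\<lambda>_. count_space UNIV)"

lemma space_path_space [simp]: "space path_space = UNIV"
  by (simp add: space_PiM)

lemma measurable_case_nat_path:
  "case_nat s \<in> path_space \<rightarrow>\<^sub>M path_space"
proof (rule measurable_PiM_single')
  fix i :: nat
  show "(\<lambda>X. case_nat s X i) \<in> path_space \<rightarrow>\<^sub>M count_space UNIV"
    by (cases i) (simp_all add: measurable_component_singleton)
qed simp

text \<open>Events are predicates on trajectories instead of sets, so that measurability follows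
  from the logical form of the event, with \<open>path_event_intros\<close> as introduction
  rules.\<close>

definition path_event :: "((nat \<Rightarrow> 'a) \<Rightarrow> bool) \<Rightarrow> bool" where
  "path_event Q \<longleftrightarrow> {X. Q X} \<in> sets path_space"

lemma path_event_iff_pred: "path_event Q \<longleftrightarrow> Measurable.pred path_space Q"
  by (simp add: path_event_def pred_def)

lemma path_event_coordinate: "path_event (\<lambda>X. Q (X n))"
proof -
  have "(\<lambda>X. X n) \<in> path_space \<rightarrow>\<^sub>M count_space (UNIV :: 'a set)"
    by (rule measurable_component_singleton) simp
  then show ?thesis
    unfolding path_event_iff_pred by (rule measurable_compose) simp
qed

lemma path_event_coordinate_in: "path_event (\<lambda>X. X n \<in> A)"
  by (rule path_event_coordinate)

lemma path_event_coordinate_eq: "path_event (\<lambda>X. X n = a)"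
  by (rule path_event_coordinate)

lemma path_event_const: "path_event (\<lambda>X. c)"
  unfolding path_event_iff_pred by simp

lemma path_event_not: "path_event Q \<Longrightarrow> path_event (\<lambda>X. \<not> Q X)"
  unfolding path_event_iff_pred by (rule pred_intros_logic)

lemma path_event_conj: "path_event Q \<Longrightarrow> path_event R \<Longrightarrow> path_event (\<lambda>X. Q X \<and> R X)"
  unfolding path_event_iff_pred by (rule pred_intros_logic)

lemma path_event_disj: "path_event Q \<Longrightarrow> path_event R \<Longrightarrow> path_event (\<lambda>X. Q X \<or> R X)"
  unfolding path_event_iff_pred by (rule pred_intros_logic)

lemma path_event_imp: "path_event Q \<Longrightarrow> path_event R \<Longrightarrow> path_event (\<lambda>X. Q X \<longrightarrow> R X)"
  unfolding path_event_iff_pred by (rule pred_intros_logic)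

lemma path_event_all:
  "(\<And>i :: 'i :: countable. path_event (Q i)) \<Longrightarrow> path_event (\<lambda>X. \<forall>i. Q i X)"
  unfolding path_event_iff_pred by (rule pred_intros_countable)

lemma path_event_ex:
  "(\<And>i :: 'i :: countable. path_event (Q i)) \<Longrightarrow> path_event (\<lambda>X. \<exists>i. Q i X)"
  unfolding path_event_iff_pred by (rule pred_intros_countable)

text \<open>The event is split over the countably many values at time \<open>n\<close>.\<close>

lemma path_event_coordinates2:
  fixes Q :: "'a::countable \<Rightarrow> 'a \<Rightarrow> bool"
  shows "path_event (\<lambda>X. Q (X n) (X m))"
proof -
  have "path_event (\<lambda>X. \<exists>v. X n = v \<and> Q v (X m))"
    by (intro path_event_ex path_event_conj path_event_coordinate_eq path_event_coordinate)
  then show ?thesis by simp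
qed

lemmas path_event_intros =
  path_event_coordinate_in path_event_coordinate_eq path_event_const path_event_not
  path_event_conj path_event_disj path_event_imp path_event_all path_event_ex

lemma path_event_case_nat: "path_event Q \<Longrightarrow> path_event (\<lambda>X. Q (case_nat s X))"
  unfolding path_event_iff_pred by (rule measurable_compose[OF measurable_case_nat_path])

lemma path_event_set: "path_event Q \<Longrightarrow> {X. Q X} \<in> sets path_space"
  by (simp add: path_event_def)

section \<open>The Markov property at the first step\<close>

lemma emeasure_markov_chain_UNIV [simp]: "emeasure (markov_chain_law s K) UNIV = 1"
  using prob_space.emeasure_space_1[OF prob_space_markov_chain_law[of s K]] by simp

text \<open>The empty set is included so that the family stays closed under intersection when two
  cylinders are incompatible.\<close>

definition cylinders :: "(nat \<Rightarrow> 'a) set set" where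
  "cylinders = insert {} (range (\<lambda>(n, x). {X. \<forall>i\<le>(n::nat). X i = x i}))"

lemma cylinder_in_cylinders: "{X. \<forall>i\<le>n. X i = x i} \<in> cylinders"
  unfolding cylinders_def by (auto intro!: rev_image_eqI[of "(n, x)"])

lemma Int_stable_cylinders: "Int_stable (cylinders :: (nat \<Rightarrow> 'a) set set)"
proof (rule Int_stableI)
  fix a b :: "(nat \<Rightarrow> 'a) set"
  assume a: "a \<in> cylinders" and b: "b \<in> cylinders"
  show "a \<inter> b \<in> cylinders"
  proof (cases "a \<inter> b = {}")
    case True
    then show ?thesis by (simp add: cylinders_def)
  next
    case False
    then obtain z where z: "z \<in> a" "z \<in> b" by auto
    obtain n x where ax: "a = {X. \<forall>i\<le>n. X i = x i}"
      using a z by (auto simp: cylinders_def)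
    obtain m y where bx: "b = {X. \<forall>i\<le>m. X i = y i}"
      using b z by (auto simp: cylinders_def)
    have "a \<inter> b = {X. \<forall>i\<le>max n m. X i = z i}"
      using z unfolding ax bx by (auto simp: le_max_iff_disj)
    then show ?thesis by (simp only: cylinder_in_cylinders)
  qed
qed

text \<open>An event depending on one coordinate is a union of cylinders over words of length
  \<open>Suc n\<close>, and there are only countably many such words.\<close>

lemma sigma_sets_cylinders:
  "sigma_sets UNIV (cylinders :: (nat \<Rightarrow> 'a::countable) set set) = sets path_space"
proof
  have "cylinders \<subseteq> sets (path_space :: (nat \<Rightarrow> 'a) measure)"
  proof
    fix a :: "(nat \<Rightarrow> 'a) set" assume "a \<in> cylinders"
    moreover have "{X. \<forall>i\<le>n. X i = x i} \<in> sets path_space" for n and x :: "nat \<Rightarrow> 'a"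
      by (rule path_event_set) (intro path_event_intros)
    ultimately show "a \<in> sets path_space" by (auto simp: cylinders_def)
  qed
  then show "sigma_sets UNIV cylinders \<subseteq> sets (path_space :: (nat \<Rightarrow> 'a) measure)"
    using sets.sigma_sets_subset[of cylinders "path_space :: (nat \<Rightarrow> 'a) measure"] by simp
next
  let ?\<Sigma> = "sigma_sets UNIV (cylinders :: (nat \<Rightarrow> 'a) set set)"
  have coord: "{X. X n \<in> A} \<in> ?\<Sigma>" for n and A :: "'a set"
  proof -
    let ?L = "{xs :: 'a list. length xs = Suc n \<and> xs ! n \<in> A}"
    have "{X. X n \<in> A} = (\<Union>xs\<in>?L. {X. \<forall>i\<le>n. X i = xs ! i})"
    proof (intro set_eqI iffI)
      fix X :: "nat \<Rightarrow> 'a" assume "X \<in> {X. X n \<in> A}"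
      then show "X \<in> (\<Union>xs\<in>?L. {X. \<forall>i\<le>n. X i = xs ! i})"
        by (auto intro!: exI[of _ "map X [0..<Suc n]"] simp del: upt_Suc)
    qed auto
    also have "\<dots> \<in> ?\<Sigma>"
      by (rule sigma_sets_UNION) (auto intro!: sigma_sets.Basic cylinder_in_cylinders)
    finally show ?thesis .
  qed
  have sp: "sigma_algebra UNIV ?\<Sigma>"
    by (rule sigma_algebra_sigma_sets) simp
  have "sets (path_space :: (nat \<Rightarrow> 'a) measure) =
      sigma_sets UNIV {{f \<in> UNIV \<rightarrow>\<^sub>E UNIV. f i \<in> A} |i A. i \<in> UNIV \<and> A \<in> sets (count_space (UNIV :: 'a set))}"
    by (subst sets_PiM_single) (simp add: space_PiM)
  also have "\<dots> \<subseteq> ?\<Sigma>"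
    by (rule sigma_sets_mono) (use coord in auto)
  finally show "sets (path_space :: (nat \<Rightarrow> 'a) measure) \<subseteq> ?\<Sigma>" .
qed

text \<open>The law of a trajectory that starts with \<open>s\<close>, makes one
  \<open>K\<close>-step and then continues as a fresh chain; \<open>case_nat s\<close> puts
  \<open>s\<close> in front of the continuation.\<close>

definition first_step_law :: "'a \<Rightarrow> ('a \<Rightarrow> 'a pmf) \<Rightarrow> (nat \<Rightarrow> 'a) measure" where
  "first_step_law s K =
     measure_pmf (K s) \<bind> (\<lambda>y. distr (markov_chain_law y K) path_space (case_nat s))"

lemma first_step_kernel_measurable:
  "(\<lambda>y. distr (markov_chain_law y K) path_space (case_nat s)) \<in>
     measure_pmf p \<rightarrow>\<^sub>M subprob_algebra path_space"
proof -
  have "prob_space (distr (markov_chain_law y K) path_space (case_nat s))" for y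
    by (intro prob_space.prob_space_distr prob_space_markov_chain_law)
       (simp add: measurable_cong_sets[OF sets_markov_chain_law refl] measurable_case_nat_path)
  then show ?thesis
    by (auto simp: space_subprob_algebra prob_space_imp_subprob_space)
qed

lemma emeasure_first_step_law:
  assumes "B \<in> sets path_space"
  shows "emeasure (first_step_law s K) B =
    (\<integral>\<^sup>+y. emeasure (markov_chain_law y K) (case_nat s -` B) \<partial>measure_pmf (K s))"
proof -
  have "emeasure (first_step_law s K) B =
      (\<integral>\<^sup>+y. emeasure (distr (markov_chain_law y K) path_space (case_nat s)) B \<partial>measure_pmf (K s))"
    unfolding first_step_law_def
    by (rule emeasure_bind[OF _ first_step_kernel_measurable assms]) simp
  also have "\<dots> = (\<integral>\<^sup>+y. emeasure (markov_chain_law y K) (case_nat s -` B) \<partial>measure_pmf (K s))"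
  proof (rule nn_integral_cong)
    fix y
    show "emeasure (distr (markov_chain_law y K) path_space (case_nat s)) B =
        emeasure (markov_chain_law y K) (case_nat s -` B)"
      using emeasure_distr[of "case_nat s" "markov_chain_law y K" path_space B] assms
      by (simp add: measurable_cong_sets[OF sets_markov_chain_law refl] measurable_case_nat_path)
  qed
  finally show ?thesis .
qed

text \<open>Both laws have the same value on cylinders, where prepending \<open>s\<close> merely
  shifts the fixed word by one index. This is the form in which the Markov property enters
  everything below.\<close>

lemma markov_chain_law_first_step:
  fixes s :: "'a::countable"
  shows "markov_chain_law s K = first_step_law s K"
proof (rule measure_eqI_generator_eq[where E = cylinders and \<Omega> = UNIV
      and A = "\<lambda>i. {X. \<forall>j\<le>0. X j = from_nat i}"])
  show "Int_stable (cylinders :: (nat \<Rightarrow> 'a) set set)" by (rule Int_stable_cylinders)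
  show "sets (markov_chain_law s K) = sigma_sets UNIV cylinders"
    by (simp add: sets_markov_chain_law sigma_sets_cylinders)
  have "sets (first_step_law s K) = sets path_space"
    unfolding first_step_law_def by (rule sets_bind) auto
  then show "sets (first_step_law s K) = sigma_sets UNIV cylinders"
    by (simp add: sigma_sets_cylinders)
  show "range (\<lambda>i. {X. \<forall>j\<le>0. X j = from_nat i}) \<subseteq> (cylinders :: (nat \<Rightarrow> 'a) set set)"
    using cylinder_in_cylinders[of 0 "\<lambda>_. from_nat _"] by (intro image_subsetI)
  show "(\<Union>i. {X. \<forall>j\<le>0. X j = from_nat i}) = (UNIV :: (nat \<Rightarrow> 'a) set)"
  proof -
    have "\<exists>i. X 0 = from_nat i" for X :: "nat \<Rightarrow> 'a"
      by (metis from_nat_to_nat)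
    then show ?thesis by auto
  qed
  show "emeasure (markov_chain_law s K) {X. \<forall>j\<le>0. X j = from_nat i} \<noteq> \<infinity>" for i
    using prob_space.emeasure_le_1[OF prob_space_markov_chain_law[of s K], of "{X. \<forall>j\<le>0. X j = from_nat i}"]
    by (auto simp: top_unique)
  fix B :: "(nat \<Rightarrow> 'a) set" assume B: "B \<in> cylinders"
  show "emeasure (markov_chain_law s K) B = emeasure (first_step_law s K) B"
  proof (cases "B = {}")
    case False
    then obtain n x where Bx: "B = {X. \<forall>i\<le>n. X i = x i}"
      using B by (auto simp: cylinders_def)
    have Bs: "B \<in> sets path_space"
      using B sigma_sets_cylinders by blast
    have e: "emeasure (first_step_law s K) B =
        (\<integral>\<^sup>+y. emeasure (markov_chain_law y K) (case_nat s -` B) \<partial>measure_pmf (K s))"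
      by (rule emeasure_first_step_law[OF Bs])
    show ?thesis
    proof (cases n)
      case 0
      have "case_nat s -` B = (if x 0 = s then UNIV else {})"
        using 0 by (auto simp: Bx)
      then have "emeasure (first_step_law s K) B = (if x 0 = s then 1 else 0)"
        unfolding e using emeasure_markov_chain_UNIV[of _ K]
        by (simp add: measure_pmf.emeasure_space_1[unfolded space_measure_pmf])
      then show ?thesis
        using markov_chain_law_cylinder[of s K 0 x] 0 by (simp add: Bx)
    next
      case (Suc m)
      have pre: "case_nat s -` B = (if x 0 = s then {X. \<forall>i\<le>m. X i = x (Suc i)} else {})"
      proof -
        have "(\<forall>i\<le>Suc m. P i) \<longleftrightarrow> P 0 \<and> (\<forall>i\<le>m. P (Suc i))" for P
          by (metis Suc_le_mono le0 not0_implies_Suc)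
        then show ?thesis unfolding Bx Suc by auto
      qed
      show ?thesis
      proof (cases "x 0 = s")
        case True
        let ?c = "ennreal (\<Prod>i<m. pmf (K (x (Suc i))) (x (Suc (Suc i))))"
        have "emeasure (first_step_law s K) B =
            (\<integral>\<^sup>+y. (if x 1 = y then ?c else 0) \<partial>measure_pmf (K s))"
          unfolding e pre using True
          by (auto intro!: nn_integral_cong simp: markov_chain_law_cylinder[of _ K m "\<lambda>i. x (Suc i)"])
        also have "\<dots> = (\<integral>\<^sup>+y. ?c * indicator {x 1} y \<partial>measure_pmf (K s))"
          by (auto intro!: nn_integral_cong simp: indicator_def)
        also have "\<dots> = ?c * ennreal (pmf (K s) (x 1))"
          by (subst nn_integral_cmult_indicator) (auto simp: emeasure_pmf_single)
        also have "\<dots> = ennreal (\<Prod>i<n. pmf (K (x i)) (x (Suc i)))"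
          unfolding Suc prod.lessThan_Suc_shift using True
          by (simp add: ennreal_mult[symmetric] prod_nonneg mult.commute)
        finally show ?thesis
          using markov_chain_law_cylinder[of s K n x] True by (simp add: Bx)
      next
        case False
        then show ?thesis
          unfolding e pre using markov_chain_law_cylinder[of s K n x] by (simp add: Bx)
      qed
    qed
  qed simp
qed simp

lemma emeasure_markov_first_step:
  fixes s :: "'a::countable"
  assumes "path_event Q"
  shows "emeasure (markov_chain_law s K) {X. Q X} =
    (\<integral>\<^sup>+y. emeasure (markov_chain_law y K) {X. Q (case_nat s X)} \<partial>measure_pmf (K s))"
proof -
  have "emeasure (first_step_law s K) {X. Q X} =
      (\<integral>\<^sup>+y. emeasure (markov_chain_law y K) (case_nat s -` {X. Q X}) \<partial>measure_pmf (K s))"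
    by (rule emeasure_first_step_law[OF path_event_set[OF assms]])
  then show ?thesis
    unfolding markov_chain_law_first_step[of s K] vimage_def mem_Collect_eq .
qed


lemma path_event_markov_set:
  "path_event Q \<Longrightarrow> {X. Q X} \<in> sets (markov_chain_law s K)"
  unfolding sets_markov_chain_law by (rule path_event_set)

lemma emeasure_markov_le_1: "emeasure (markov_chain_law s K) B \<le> 1"
  by (rule prob_space.emeasure_le_1[OF prob_space_markov_chain_law])

lemma emeasure_markov_mono:
  assumes "\<And>X. Q X \<Longrightarrow> R X" "path_event R"
  shows "emeasure (markov_chain_law s K) {X. Q X} \<le> emeasure (markov_chain_law s K) {X. R X}"
proof (rule emeasure_mono)
  show "{X. Q X} \<subseteq> {X. R X}" using assms(1) by blast
  show "{X. R X} \<in> sets (markov_chain_law s K)" by (rule path_event_markov_set[OF assms(2)])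
qed

text \<open>After the first-step formula the trajectory is \<open>case_nat s X\<close>, whose value
  at \<open>0\<close> reduces to \<open>s\<close>.\<close>

lemma emeasure_markov_start:
  fixes s :: "'a::countable"
  assumes Q: "path_event Q"
  shows "emeasure (markov_chain_law s K) {X. Q X} =
    emeasure (markov_chain_law s K) {X. X 0 = s \<and> Q X}"
proof -
  have "path_event (\<lambda>X. X 0 = s \<and> Q X)"
    by (intro path_event_intros Q)
  from emeasure_markov_first_step[OF this, of s K] emeasure_markov_first_step[OF Q, of s K]
  show ?thesis by simp
qed

lemma emeasure_markov_cong_start:
  fixes s :: "'a::countable"
  assumes Q: "path_event Q" and R: "path_event R"
    and "\<And>X. X 0 = s \<Longrightarrow> Q X \<longleftrightarrow> R X"
  shows "emeasure (markov_chain_law s K) {X. Q X} = emeasure (markov_chain_law s K) {X. R X}"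
proof -
  have "{X. X 0 = s \<and> Q X} = {X. X 0 = s \<and> R X}" using assms(3) by blast
  then show ?thesis
    unfolding emeasure_markov_start[OF Q] emeasure_markov_start[OF R] by simp
qed

lemma AE_markov_iff:
  assumes "path_event Q"
  shows "(AE X in markov_chain_law s K. Q X) \<longleftrightarrow> emeasure (markov_chain_law s K) {X. \<not> Q X} = 0"
proof -
  have "{X. \<not> Q X} \<in> sets (markov_chain_law s K)"
    by (rule path_event_markov_set) (intro path_event_intros assms)
  then show ?thesis
    by (rule AE_iff_measurable) simp
qed

lemma AE_markov_start:
  fixes s :: "'a::countable"
  shows "AE X in markov_chain_law s K. X 0 = s"
proof -
  have "emeasure (markov_chain_law s K) {X. X 0 \<noteq> s} = emeasure (markov_chain_law s K) {X. X 0 = s \<and> X 0 \<noteq> s}"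
    by (rule emeasure_markov_start) (intro path_event_intros)
  also have "{X. X 0 = s \<and> X 0 \<noteq> s} = {}" by blast
  finally show ?thesis
    unfolding AE_markov_iff[OF path_event_coordinate_eq] by (simp only: emeasure_empty)
qed

lemma emeasure_markov_compl:
  assumes "path_event Q"
  shows "emeasure (markov_chain_law s K) {X. \<not> Q X} = 1 - emeasure (markov_chain_law s K) {X. Q X}"
proof -
  have eq: "{X. \<not> Q X} = space (markov_chain_law s K) - {X. Q X}" by auto
  have "emeasure (markov_chain_law s K) {X. Q X} \<noteq> \<infinity>"
    using emeasure_markov_le_1[of s K "{X. Q X}"] by (auto simp: top_unique)
  from emeasure_compl[OF path_event_markov_set[OF assms] this] show ?thesis
    unfolding eq by simp
qed

text \<open>
  Bounds for events that pass to the shifted trajectory; they replace the strong Markov property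
  and Levy's 0-1 law.
\<close>

lemma ex_le_Suc_case_nat:
  "(\<exists>m\<le>Suc n. case_nat s X m \<in> T) \<longleftrightarrow> s \<in> T \<or> (\<exists>m\<le>n. X m \<in> T)"
  by (metis (no_types, lifting) Suc_le_mono le0 nat.case(1) nat.case(2) not0_implies_Suc)

text \<open>A strong Markov bound at the first visit to \<open>T\<close>: \<open>J\<close> survives
  deletion of the initial state, so its probability from the visited state is at most \<kappa>. The
  proof is an induction on a time horizon, which is then sent to infinity along increasing
  events.\<close>

lemma emeasure_markov_visit_le:
  fixes T :: "'a::countable set"
  assumes J: "path_event J"
    and shift: "\<forall>s X. J (case_nat s X) \<longrightarrow> J X"
    and bound: "\<And>t. t \<in> T \<Longrightarrow> emeasure (markov_chain_law t K) {X. J X} \<le> \<kappa>"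
  shows "emeasure (markov_chain_law s K) {X. J X \<and> (\<exists>m. X m \<in> T)} \<le>
    emeasure (markov_chain_law s K) {X. \<exists>m. X m \<in> T} * \<kappa>"
proof -
  have in_T: "emeasure (markov_chain_law s K) {X. J X \<and> (\<exists>m\<le>n. X m \<in> T)} \<le>
      emeasure (markov_chain_law s K) {X. \<exists>m\<le>n. X m \<in> T} * \<kappa>" if "s \<in> T" for n s
  proof -
    have "emeasure (markov_chain_law s K) {X. \<exists>m\<le>n. X m \<in> T} = emeasure (markov_chain_law s K) {X. True}"
      by (rule emeasure_markov_cong_start; (intro path_event_intros)?) (use that in auto)
    then have "emeasure (markov_chain_law s K) {X. \<exists>m\<le>n. X m \<in> T} = 1" by simp
    moreover have "emeasure (markov_chain_law s K) {X. J X \<and> (\<exists>m\<le>n. X m \<in> T)} \<le>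
        emeasure (markov_chain_law s K) {X. J X}"
      by (rule emeasure_markov_mono[OF _ J]) blast
    ultimately show ?thesis using bound[OF that] by simp
  qed
  have fin: "emeasure (markov_chain_law s K) {X. J X \<and> (\<exists>m\<le>n. X m \<in> T)} \<le>
      emeasure (markov_chain_law s K) {X. \<exists>m\<le>n. X m \<in> T} * \<kappa>" for n s
  proof (induction n arbitrary: s)
    case 0
    show ?case
    proof (cases "s \<in> T")
      case False
      have "emeasure (markov_chain_law s K) {X. J X \<and> (\<exists>m\<le>(0::nat). X m \<in> T)} =
          emeasure (markov_chain_law s K) {X. False}"
        by (rule emeasure_markov_cong_start; (intro path_event_intros J)?) (use False in auto)
      then show ?thesis by simp
    qed (rule in_T)
  next
    case (Suc n)
    show ?case
    proof (cases "s \<in> T")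
      case False
      have "emeasure (markov_chain_law s K) {X. J X \<and> (\<exists>m\<le>Suc n. X m \<in> T)} =
        (\<integral>\<^sup>+y. emeasure (markov_chain_law y K)
          {X. J (case_nat s X) \<and> (\<exists>m\<le>Suc n. case_nat s X m \<in> T)} \<partial>measure_pmf (K s))"
        by (rule emeasure_markov_first_step) (intro path_event_intros J)
      also have "\<dots> \<le> (\<integral>\<^sup>+y. emeasure (markov_chain_law y K) {X. \<exists>m\<le>n. X m \<in> T} * \<kappa> \<partial>measure_pmf (K s))"
      proof (rule nn_integral_mono)
        fix y
        have "emeasure (markov_chain_law y K) {X. J (case_nat s X) \<and> (\<exists>m\<le>Suc n. case_nat s X m \<in> T)} \<le>
            emeasure (markov_chain_law y K) {X. J X \<and> (\<exists>m\<le>n. X m \<in> T)}"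
        proof (rule emeasure_markov_mono)
          fix X assume "J (case_nat s X) \<and> (\<exists>m\<le>Suc n. case_nat s X m \<in> T)"
          then show "J X \<and> (\<exists>m\<le>n. X m \<in> T)"
            using shift[rule_format, of s X] False unfolding ex_le_Suc_case_nat by simp
        qed (intro path_event_intros J)
        also have "\<dots> \<le> emeasure (markov_chain_law y K) {X. \<exists>m\<le>n. X m \<in> T} * \<kappa>" by (rule Suc.IH)
        finally show "emeasure (markov_chain_law y K) {X. J (case_nat s X) \<and> (\<exists>m\<le>Suc n. case_nat s X m \<in> T)} \<le>
          emeasure (markov_chain_law y K) {X. \<exists>m\<le>n. X m \<in> T} * \<kappa>" .
      qed
      also have "\<dots> = (\<integral>\<^sup>+y. emeasure (markov_chain_law y K) {X. \<exists>m\<le>n. X m \<in> T} \<partial>measure_pmf (K s)) * \<kappa>"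
        by (rule nn_integral_multc) simp
      also have "(\<integral>\<^sup>+y. emeasure (markov_chain_law y K) {X. \<exists>m\<le>n. X m \<in> T} \<partial>measure_pmf (K s)) =
          (\<integral>\<^sup>+y. emeasure (markov_chain_law y K) {X. \<exists>m\<le>Suc n. case_nat s X m \<in> T} \<partial>measure_pmf (K s))"
        using False unfolding ex_le_Suc_case_nat by simp
      also have "\<dots> = emeasure (markov_chain_law s K) {X. \<exists>m\<le>Suc n. X m \<in> T}"
        by (rule emeasure_markov_first_step[symmetric]) (intro path_event_intros)
      finally show ?thesis .
    qed (rule in_T)
  qed
  have "(SUP n. emeasure (markov_chain_law s K) {X. J X \<and> (\<exists>m\<le>n. X m \<in> T)}) =
      emeasure (markov_chain_law s K) (\<Union>n::nat. {X. J X \<and> (\<exists>m\<le>n. X m \<in> T)})"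
  proof (rule SUP_emeasure_incseq)
    have "{X. J X \<and> (\<exists>m\<le>n. X m \<in> T)} \<in> sets (markov_chain_law s K)" for n :: nat
      by (rule path_event_markov_set) (intro path_event_intros J)
    then show "range (\<lambda>n::nat. {X. J X \<and> (\<exists>m\<le>n. X m \<in> T)}) \<subseteq> sets (markov_chain_law s K)"
      by blast
    show "incseq (\<lambda>n::nat. {X. J X \<and> (\<exists>m\<le>n. X m \<in> T)})"
      by (rule incseq_SucI) (auto intro: le_SucI)
  qed
  moreover have "(\<Union>n::nat. {X. J X \<and> (\<exists>m\<le>n. X m \<in> T)}) = {X. J X \<and> (\<exists>m. X m \<in> T)}" by auto
  ultimately have "emeasure (markov_chain_law s K) {X. J X \<and> (\<exists>m. X m \<in> T)} =
      (SUP n. emeasure (markov_chain_law s K) {X. J X \<and> (\<exists>m\<le>n. X m \<in> T)})" by simp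
  also have "\<dots> \<le> emeasure (markov_chain_law s K) {X. \<exists>m. X m \<in> T} * \<kappa>"
  proof (rule SUP_least)
    fix n :: nat
    have "emeasure (markov_chain_law s K) {X. \<exists>m\<le>n. X m \<in> T} \<le> emeasure (markov_chain_law s K) {X. \<exists>m. X m \<in> T}"
    proof (rule emeasure_markov_mono)
      show "path_event (\<lambda>X. \<exists>m. X m \<in> T)" by (intro path_event_intros)
    qed blast
    then show "emeasure (markov_chain_law s K) {X. J X \<and> (\<exists>m\<le>n. X m \<in> T)} \<le>
        emeasure (markov_chain_law s K) {X. \<exists>m. X m \<in> T} * \<kappa>"
      using order_trans[OF fin[of s n] mult_right_mono[of _ _ \<kappa>]] by simp
  qed
  finally show ?thesis .
qed

text \<open>The first states must avoid \<open>B\<close>, and what follows still satisfies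
  \<open>J\<close>, which has probability at most \<theta>. Along decreasing events the bound passes
  to avoidance for ever; finiteness of \<theta> makes multiplication by \<theta> continuous.\<close>

lemma emeasure_markov_avoid_le:
  fixes B :: "'a::countable set"
  assumes J: "path_event J"
    and shift: "\<forall>s X. J (case_nat s X) \<longrightarrow> J X"
    and avoid: "\<And>X n. J X \<Longrightarrow> X n \<notin> B"
    and bound: "\<And>t. emeasure (markov_chain_law t K) {X. J X} \<le> \<theta>"
    and \<theta>: "\<theta> < \<top>"
  shows "emeasure (markov_chain_law s K) {X. J X} \<le>
    emeasure (markov_chain_law s K) {X. \<forall>n. X n \<notin> B} * \<theta>"
proof -
  have split: "(\<forall>m\<le>Suc n. case_nat s X m \<notin> B) \<longleftrightarrow> s \<notin> B \<and> (\<forall>m\<le>n. X m \<notin> B)" for s n and X :: "nat \<Rightarrow> 'a"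
    using ex_le_Suc_case_nat[of n s X B] by blast
  have in_B: "emeasure (markov_chain_law s K) {X. J X} = 0" if "s \<in> B" for s
  proof -
    have "emeasure (markov_chain_law s K) {X. J X} = emeasure (markov_chain_law s K) {X. False}"
      by (rule emeasure_markov_cong_start; (intro path_event_intros J)?) (use that avoid in auto)
    then show ?thesis by simp
  qed
  have fin: "emeasure (markov_chain_law s K) {X. J X} \<le>
      emeasure (markov_chain_law s K) {X. \<forall>m\<le>n. X m \<notin> B} * \<theta>" for n s
  proof (induction n arbitrary: s)
    case 0
    show ?case
    proof (cases "s \<in> B")
      case False
      have "emeasure (markov_chain_law s K) {X. \<forall>m\<le>(0::nat). X m \<notin> B} = emeasure (markov_chain_law s K) {X. True}"
        by (rule emeasure_markov_cong_start; (intro path_event_intros)?) (use False in auto)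
      then show ?thesis using bound[of s] by simp
    qed (simp add: in_B)
  next
    case (Suc n)
    show ?case
    proof (cases "s \<in> B")
      case False
      have "emeasure (markov_chain_law s K) {X. J X} =
        (\<integral>\<^sup>+y. emeasure (markov_chain_law y K) {X. J (case_nat s X)} \<partial>measure_pmf (K s))"
        by (rule emeasure_markov_first_step[OF J])
      also have "\<dots> \<le> (\<integral>\<^sup>+y. emeasure (markov_chain_law y K) {X. \<forall>m\<le>n. X m \<notin> B} * \<theta> \<partial>measure_pmf (K s))"
      proof (rule nn_integral_mono)
        fix y
        have "emeasure (markov_chain_law y K) {X. J (case_nat s X)} \<le> emeasure (markov_chain_law y K) {X. J X}"
          by (rule emeasure_markov_mono[OF _ J]) (use shift in blast)
        also have "\<dots> \<le> emeasure (markov_chain_law y K) {X. \<forall>m\<le>n. X m \<notin> B} * \<theta>" by (rule Suc.IH)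
        finally show "emeasure (markov_chain_law y K) {X. J (case_nat s X)} \<le>
          emeasure (markov_chain_law y K) {X. \<forall>m\<le>n. X m \<notin> B} * \<theta>" .
      qed
      also have "\<dots> = (\<integral>\<^sup>+y. emeasure (markov_chain_law y K) {X. \<forall>m\<le>n. X m \<notin> B} \<partial>measure_pmf (K s)) * \<theta>"
        by (rule nn_integral_multc) simp
      also have "(\<integral>\<^sup>+y. emeasure (markov_chain_law y K) {X. \<forall>m\<le>n. X m \<notin> B} \<partial>measure_pmf (K s)) =
          (\<integral>\<^sup>+y. emeasure (markov_chain_law y K) {X. \<forall>m\<le>Suc n. case_nat s X m \<notin> B} \<partial>measure_pmf (K s))"
        using False unfolding split by simp
      also have "\<dots> = emeasure (markov_chain_law s K) {X. \<forall>m\<le>Suc n. X m \<notin> B}"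
        by (rule emeasure_markov_first_step[symmetric]) (intro path_event_intros)
      finally show ?thesis .
    qed (simp add: in_B)
  qed
  have "(\<lambda>n. emeasure (markov_chain_law s K) {X. \<forall>m\<le>n. X m \<notin> B})
      \<longlonglongrightarrow> emeasure (markov_chain_law s K) (\<Inter>n::nat. {X. \<forall>m\<le>n. X m \<notin> B})"
  proof (rule Lim_emeasure_decseq)
    have "{X. \<forall>m\<le>n. X m \<notin> B} \<in> sets (markov_chain_law s K)" for n :: nat
      by (rule path_event_markov_set) (intro path_event_intros J)
    then show "range (\<lambda>n::nat. {X. \<forall>m\<le>n. X m \<notin> B}) \<subseteq> sets (markov_chain_law s K)" by blast
    show "decseq (\<lambda>n::nat. {X. \<forall>m\<le>n. X m \<notin> B})"
      by (rule decseq_SucI) auto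
    show "emeasure (markov_chain_law s K) {X. \<forall>m\<le>n. X m \<notin> B} \<noteq> \<infinity>" for n :: nat
      using emeasure_markov_le_1[of s K "{X. \<forall>m\<le>n. X m \<notin> B}"] by (auto simp: top_unique)
  qed
  moreover have "(\<Inter>n::nat. {X. \<forall>m\<le>n. X m \<notin> B}) = {X. \<forall>n. X n \<notin> B}"
  proof (intro set_eqI iffI)
    fix X :: "nat \<Rightarrow> 'a" assume X: "X \<in> (\<Inter>n::nat. {X. \<forall>m\<le>n. X m \<notin> B})"
    have "X n \<notin> B" for n
    proof -
      have "\<forall>m\<le>n. X m \<notin> B" using X by simp
      then show ?thesis by simp
    qed
    then show "X \<in> {X. \<forall>n. X n \<notin> B}" by simp
  qed simp
  ultimately have "(\<lambda>n. emeasure (markov_chain_law s K) {X. \<forall>m\<le>n. X m \<notin> B})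
      \<longlonglongrightarrow> emeasure (markov_chain_law s K) {X. \<forall>n. X n \<notin> B}" by simp
  then have "(\<lambda>n. \<theta> * emeasure (markov_chain_law s K) {X. \<forall>m\<le>n. X m \<notin> B})
      \<longlonglongrightarrow> \<theta> * emeasure (markov_chain_law s K) {X. \<forall>n. X n \<notin> B}"
    using \<theta> by (intro ennreal_tendsto_cmult)
  then have "emeasure (markov_chain_law s K) {X. J X} \<le> \<theta> * emeasure (markov_chain_law s K) {X. \<forall>n. X n \<notin> B}"
    by (rule LIMSEQ_le_const) (use fin[of s] in \<open>simp add: mult.commute\<close>)
  then show ?thesis by (simp add: mult.commute)
qed


lemma emeasure_markov_step_ge:
  fixes s :: "'a::countable"
  assumes "path_event Q" "path_event R" "\<And>X. R X \<Longrightarrow> Q (case_nat s X)"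
  shows "ennreal (pmf (K s) y) * emeasure (markov_chain_law y K) {X. R X} \<le> emeasure (markov_chain_law s K) {X. Q X}"
proof -
  have "ennreal (pmf (K s) y) * emeasure (markov_chain_law y K) {X. R X} =
      (\<integral>\<^sup>+z. emeasure (markov_chain_law y K) {X. R X} * indicator {y} z \<partial>measure_pmf (K s))"
    by (subst nn_integral_cmult_indicator) (auto simp: emeasure_pmf_single mult.commute)
  also have "\<dots> \<le> (\<integral>\<^sup>+z. emeasure (markov_chain_law z K) {X. Q (case_nat s X)} \<partial>measure_pmf (K s))"
    by (intro nn_integral_mono)
       (auto simp: indicator_def intro!: emeasure_markov_mono[OF assms(3)] path_event_case_nat assms(1))
  also have "\<dots> = emeasure (markov_chain_law s K) {X. Q X}"
    by (rule emeasure_markov_first_step[symmetric, OF assms(1)])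
  finally show ?thesis .
qed

text \<open>Since \<open>J\<close> is null from every starting state, the first-step formula carries
  nullity from the shift by \<open>n\<close> to the shift by \<open>Suc n\<close>.\<close>

lemma AE_markov_shift:
  fixes s :: "'a::countable"
  assumes J: "path_event J" and "\<And>t. emeasure (markov_chain_law t K) {X. J X} = 0"
  shows "AE X in markov_chain_law s K. \<forall>n. \<not> J (\<lambda>i. X (i + n))"
proof -
  have ev: "path_event (\<lambda>X. J (\<lambda>i. X (i + n)))" for n
    unfolding path_event_iff_pred
    by (rule measurable_compose[OF _ J[unfolded path_event_iff_pred]])
       (rule measurable_PiM_single', simp_all add: measurable_component_singleton)
  have "emeasure (markov_chain_law t K) {X. J (\<lambda>i. X (i + n))} = 0" for n t
  proof (induction n arbitrary: t)
    case 0
    then show ?case using assms(2) by simp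
  next
    case (Suc n)
    have "emeasure (markov_chain_law t K) {X. J (\<lambda>i. X (i + Suc n))} =
        (\<integral>\<^sup>+y. emeasure (markov_chain_law y K) {X. J (\<lambda>i. case_nat t X (i + Suc n))} \<partial>measure_pmf (K t))"
      by (rule emeasure_markov_first_step[OF ev])
    then show ?case using Suc.IH by simp
  qed
  then have "AE X in markov_chain_law s K. \<not> J (\<lambda>i. X (i + n))" for n
    by (subst AE_markov_iff[OF path_event_not[OF ev]]) simp
  then show ?thesis by (simp add: AE_all_countable)
qed

lemma emeasure_markov_null_succ:
  fixes s :: "'a::countable"
  assumes J: "path_event J" and null: "emeasure (markov_chain_law s K) {X. J X} = 0"
    and "path_event R" "\<And>X. R X \<Longrightarrow> J (case_nat s X)" and y: "y \<in> set_pmf (K s)"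
  shows "emeasure (markov_chain_law y K) {X. R X} = 0"
proof -
  have "ennreal (pmf (K s) y) * emeasure (markov_chain_law y K) {X. R X} \<le> 0"
    using emeasure_markov_step_ge[OF J assms(3,4), of K y] null by simp
  moreover have "ennreal (pmf (K s) y) \<noteq> 0"
    using y by (simp add: set_pmf_iff pmf_nonneg less_le)
  ultimately show ?thesis by simp
qed

lemma ennreal_le_mult_less_1:
  fixes \<theta> c :: ennreal
  assumes "\<theta> \<le> c * \<theta>" "c < 1" "\<theta> < \<top>"
  shows "\<theta> = 0"
proof (rule ccontr)
  assume "\<theta> \<noteq> 0"
  then have "c * \<theta> < 1 * \<theta>"
    using assms by (intro ennreal_mult_strict_right_mono) (auto simp: zero_less_iff_neq_zero)
  then show False using assms(1) by simp
qed

section \<open>Infinitely many visits\<close>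

lemma infinite_visits_shift:
  fixes X :: "nat \<Rightarrow> 'a"
  assumes "infinite {n. X n \<in> V}"
  shows "infinite {n. (X (n + k)) \<in> V}"
  using assms infinite_nat_iff_unbounded_le[of "{n. X n \<in> V}"] unfolding infinite_nat_iff_unbounded_le
  by (metis (no_types, lifting) add_le_cancel_right le_add_diff_inverse2 le_add2 le_trans mem_Collect_eq)

lemma infinite_visits_case_nat:
  "infinite {n. case_nat s X n \<in> V} \<longleftrightarrow> infinite {n. X n \<in> V}"
proof -
  have "{n. case_nat s X n \<in> V} - {0} = Suc ` {n. X n \<in> V}"
  proof (intro set_eqI)
    fix n show "n \<in> {n. case_nat s X n \<in> V} - {0} \<longleftrightarrow> n \<in> Suc ` {n. X n \<in> V}"
      by (cases n) auto
  qed
  then have "finite ({n. case_nat s X n \<in> V} - {0}) \<longleftrightarrow> finite {n. X n \<in> V}"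
    by (simp only: finite_image_iff[OF inj_Suc])
  then show ?thesis by simp
qed

lemma path_event_infinite: "path_event (\<lambda>X. infinite {n. X n \<in> V})"
  unfolding infinite_nat_iff_unbounded_le mem_Collect_eq Bex_def
  by (intro path_event_intros)

text \<open>Let \<theta> be the supremum over starting states of the probability of visiting
  \<open>V\<close> infinitely often and never \<open>B\<close>. From a state in \<open>V\<close>
  this probability is at most \<open>(1 - \<epsilon>) * \<theta>\<close>, and a trajectory of this
  kind has to enter \<open>V\<close>; hence \<theta> itself is at most
  \<open>(1 - \<epsilon>) * \<theta>\<close> and vanishes. Finitely many visits to \<open>B\<close>
  become none after a shift.\<close>

theorem AE_markov_recurrent_target:
  fixes V B :: "'a::countable set"
  assumes hit: "\<And>v. v \<in> V \<Longrightarrow> \<epsilon> \<le> emeasure (markov_chain_law v K) {X. \<exists>n. X n \<in> B}"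
    and "\<epsilon> > 0"
  shows "AE X in markov_chain_law s K. infinite {n. X n \<in> V} \<longrightarrow> infinite {n. X n \<in> B}"
proof -
  define J where "J X \<longleftrightarrow> infinite {n. X n \<in> V} \<and> (\<forall>n. X n \<notin> B)" for X :: "nat \<Rightarrow> 'a"
  have J: "path_event J"
    unfolding J_def by (intro path_event_intros path_event_infinite)
  have shift': "J X" if "J (case_nat s X)" for s and X :: "nat \<Rightarrow> 'a"
  proof -
    have "X n \<notin> B" for n
      using that[unfolded J_def] by (metis nat.case(2))
    then show ?thesis using that by (simp add: J_def infinite_visits_case_nat)
  qed
  have shift: "\<forall>s X. J (case_nat s X) \<longrightarrow> J X" by (intro allI impI) (rule shift')
  define \<theta> where "\<theta> = (SUP t. emeasure (markov_chain_law t K) {X. J X})"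
  have \<theta>: "emeasure (markov_chain_law t K) {X. J X} \<le> \<theta>" for t
    unfolding \<theta>_def by (rule SUP_upper) simp
  have "\<theta> \<le> 1" unfolding \<theta>_def by (rule SUP_least) (rule emeasure_markov_le_1)
  then have \<theta>_fin: "\<theta> < \<top>" using le_less_trans by fastforce
  have hitV: "emeasure (markov_chain_law v K) {X. J X} \<le> (1 - \<epsilon>) * \<theta>" if "v \<in> V" for v
  proof -
    have "emeasure (markov_chain_law v K) {X. \<forall>n. X n \<notin> B} = 1 - emeasure (markov_chain_law v K) {X. \<exists>n. X n \<in> B}"
      using emeasure_markov_compl[of "\<lambda>X. \<exists>n. X n \<in> B" v K]
      by (simp add: path_event_intros)
    also have "\<dots> \<le> 1 - \<epsilon>" by (rule ennreal_minus_mono) (use hit[OF that] in auto)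
    finally have "emeasure (markov_chain_law v K) {X. \<forall>n. X n \<notin> B} * \<theta> \<le> (1 - \<epsilon>) * \<theta>"
      by (rule mult_right_mono) simp
    moreover have "emeasure (markov_chain_law v K) {X. J X} \<le> emeasure (markov_chain_law v K) {X. \<forall>n. X n \<notin> B} * \<theta>"
      by (rule emeasure_markov_avoid_le[OF J shift _ \<theta> \<theta>_fin]) (simp add: J_def)
    ultimately show ?thesis by (rule order_trans[rotated])
  qed
  have "emeasure (markov_chain_law t K) {X. J X} \<le> (1 - \<epsilon>) * \<theta>" for t
  proof -
    have "emeasure (markov_chain_law t K) {X. J X} = emeasure (markov_chain_law t K) {X. J X \<and> (\<exists>m. X m \<in> V)}"
    proof -
      have "\<exists>m. X m \<in> V" if "J X" for X :: "nat \<Rightarrow> 'a"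
        using that infinite_imp_nonempty unfolding J_def by blast
      then show ?thesis by metis
    qed
    also have "\<dots> \<le> emeasure (markov_chain_law t K) {X. \<exists>m. X m \<in> V} * ((1 - \<epsilon>) * \<theta>)"
      by (rule emeasure_markov_visit_le[OF J shift hitV])
    also have "\<dots> \<le> 1 * ((1 - \<epsilon>) * \<theta>)"
      by (intro mult_right_mono emeasure_markov_le_1) simp
    finally show ?thesis by simp
  qed
  then have "\<theta> \<le> (1 - \<epsilon>) * \<theta>"
    unfolding \<theta>_def by (intro SUP_least)
  moreover have "1 - \<epsilon> < 1" using \<open>\<epsilon> > 0\<close>
    by (cases \<epsilon>) (auto simp: ennreal_1[symmetric] ennreal_minus simp del: ennreal_1 intro!: ennreal_lessI)
  ultimately have "\<theta> = 0" using \<theta>_fin by (rule ennreal_le_mult_less_1)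
  then have "emeasure (markov_chain_law t K) {X. J X} = 0" for t
    using \<theta>[of t] by simp
  from AE_markov_shift[OF J this, of s] show ?thesis
  proof eventually_elim
    case (elim X)
    show ?case
    proof (intro impI notI)
      assume V: "infinite {n. X n \<in> V}" and "finite {n. X n \<in> B}"
      then obtain k where k: "\<forall>n\<in>{n. X n \<in> B}. n < k"
        using finite_nat_iff_bounded by (metis lessThan_iff subsetD)
      have "J (\<lambda>i. X (i + k))"
        unfolding J_def using infinite_visits_shift[OF V, of k] k by fastforce
      with elim show False by blast
    qed
  qed
qed

text \<open>The same supremum argument, for the event that every visit to \<open>B\<close> is
  followed by a visit to the \<open>par\<close> of the visited state: from \<open>b\<close> in
  \<open>B\<close> the trajectory must reach \<open>par b\<close>, which costs a factor
  \<open>c\<close>, and from there the event still has probability at most \<theta>.\<close>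

theorem AE_markov_no_return:
  fixes B :: "'a::countable set" and par :: "'a \<Rightarrow> 'a"
  assumes ret: "\<And>b. b \<in> B \<Longrightarrow> emeasure (markov_chain_law b K) {X. \<exists>n. X n = par b} \<le> c"
    and "c < 1"
  shows "AE X in markov_chain_law s K. infinite {n. X n \<in> B} \<longrightarrow>
    infinite {n. X n \<in> B \<and> (\<forall>m\<ge>n. X m \<noteq> par (X n))}"
proof -
  define J where "J X \<longleftrightarrow> infinite {n. X n \<in> B} \<and> (\<forall>n. X n \<in> B \<longrightarrow> (\<exists>m. m \<ge> n \<and> X m = par (X n)))" for X :: "nat \<Rightarrow> 'a"
  have J: "path_event J"
    unfolding J_def
    by (intro path_event_intros path_event_infinite path_event_coordinates2)
  have shift': "J X" if "J (case_nat s X)" for s and X :: "nat \<Rightarrow> 'a"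
  proof -
    have "\<exists>m. m \<ge> n \<and> X m = par (X n)" if "X n \<in> B" for n
    proof -
      from that \<open>J (case_nat s X)\<close>[unfolded J_def] obtain m where "m \<ge> Suc n" "case_nat s X m = par (X n)"
        by (metis nat.case(2))
      then show ?thesis by (cases m) auto
    qed
    then show ?thesis using that by (simp add: J_def infinite_visits_case_nat)
  qed
  have shift: "\<forall>s X. J (case_nat s X) \<longrightarrow> J X" by (intro allI impI) (rule shift')
  define \<theta> where "\<theta> = (SUP t. emeasure (markov_chain_law t K) {X. J X})"
  have \<theta>: "emeasure (markov_chain_law t K) {X. J X} \<le> \<theta>" for t
    unfolding \<theta>_def by (rule SUP_upper) simp
  have "\<theta> \<le> 1" unfolding \<theta>_def by (rule SUP_least) (rule emeasure_markov_le_1)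
  then have \<theta>_fin: "\<theta> < \<top>" using le_less_trans by fastforce
  have atB: "emeasure (markov_chain_law b K) {X. J X} \<le> c * \<theta>" if "b \<in> B" for b
  proof -
    have "emeasure (markov_chain_law b K) {X. J X} =
        emeasure (markov_chain_law b K) {X. J X \<and> (\<exists>m. X m \<in> {par b})}"
    proof (rule emeasure_markov_cong_start[OF J])
      show "path_event (\<lambda>X. J X \<and> (\<exists>m. X m \<in> {par b}))"
        by (intro path_event_intros J)
      fix X :: "nat \<Rightarrow> 'a" assume "X 0 = b"
      then show "J X \<longleftrightarrow> J X \<and> (\<exists>m. X m \<in> {par b})"
        using that unfolding J_def by blast
    qed
    also have "\<dots> \<le> emeasure (markov_chain_law b K) {X. \<exists>m. X m \<in> {par b}} * \<theta>"
      by (rule emeasure_markov_visit_le[OF J shift \<theta>])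
    also have "\<dots> \<le> c * \<theta>"
      using ret[OF that] by (intro mult_right_mono) simp_all
    finally show ?thesis .
  qed
  have "emeasure (markov_chain_law t K) {X. J X} \<le> c * \<theta>" for t
  proof -
    have "emeasure (markov_chain_law t K) {X. J X} = emeasure (markov_chain_law t K) {X. J X \<and> (\<exists>m. X m \<in> B)}"
    proof -
      have "\<exists>m. X m \<in> B" if "J X" for X :: "nat \<Rightarrow> 'a"
        using that infinite_imp_nonempty unfolding J_def by blast
      then show ?thesis by metis
    qed
    also have "\<dots> \<le> emeasure (markov_chain_law t K) {X. \<exists>m. X m \<in> B} * (c * \<theta>)"
      by (rule emeasure_markov_visit_le[OF J shift atB])
    also have "\<dots> \<le> 1 * (c * \<theta>)"
      by (intro mult_right_mono emeasure_markov_le_1) simp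
    finally show ?thesis by simp
  qed
  then have "\<theta> \<le> c * \<theta>"
    unfolding \<theta>_def by (intro SUP_least)
  then have "\<theta> = 0" using \<open>c < 1\<close> \<theta>_fin by (rule ennreal_le_mult_less_1)
  then have "emeasure (markov_chain_law t K) {X. J X} = 0" for t
    using \<theta>[of t] by simp
  from AE_markov_shift[OF J this, of s] show ?thesis
  proof eventually_elim
    case (elim X)
    show ?case
    proof (intro impI notI)
      assume B: "infinite {n. X n \<in> B}"
        and "finite {n. X n \<in> B \<and> (\<forall>m\<ge>n. X m \<noteq> par (X n))}"
      then obtain k where k: "\<forall>n\<in>{n. X n \<in> B \<and> (\<forall>m\<ge>n. X m \<noteq> par (X n))}. n < k"
        using finite_nat_iff_bounded by (metis (no_types, lifting) lessThan_iff subsetD)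
      have "\<exists>m. m \<ge> n \<and> X (m + k) = par (X (n + k))" if b: "X (n + k) \<in> B" for n
      proof -
        have "\<not> (\<forall>m\<ge>n + k. X m \<noteq> par (X (n + k)))"
          using k b by fastforce
        then obtain m where "m \<ge> n + k" "X m = par (X (n + k))" by blast
        then show ?thesis by (intro exI[of _ "m - k"]) auto
      qed
      then have "J (\<lambda>i. X (i + k))"
        unfolding J_def using infinite_visits_shift[OF B, of k] by blast
      with elim show False by blast
    qed
  qed
qed

text \<open>Being visited infinitely often passes to the shifted trajectory, so from
  \<open>r\<close> its probability is at most the return probability times itself.\<close>

theorem AE_markov_transient_state:
  fixes r :: "'a::countable"
  assumes "emeasure (markov_chain_law r K) {X. \<exists>n. X (Suc n) = r} < 1"
  shows "AE X in markov_chain_law s K. finite {n. X n = r}"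
proof -
  define J where "J X \<longleftrightarrow> infinite {n. X n \<in> {r}}" for X :: "nat \<Rightarrow> 'a"
  have J: "path_event J"
    unfolding J_def by (rule path_event_infinite)
  have shift': "J X" if "J (case_nat s X)" for s and X :: "nat \<Rightarrow> 'a"
    using that unfolding J_def infinite_visits_case_nat .
  have shift: "\<forall>s X. J (case_nat s X) \<longrightarrow> J X" by (intro allI impI) (rule shift')
  let ?\<theta> = "emeasure (markov_chain_law r K) {X. J X}"
  have visit: "emeasure (markov_chain_law t K) {X. J X} \<le>
      emeasure (markov_chain_law t K) {X. \<exists>m. X m = r} * ?\<theta>" for t
  proof -
    have "\<exists>m. X m \<in> {r}" if "J X" for X :: "nat \<Rightarrow> 'a"
      using that infinite_imp_nonempty unfolding J_def by blast
    then have "emeasure (markov_chain_law t K) {X. J X} = emeasure (markov_chain_law t K) {X. J X \<and> (\<exists>m. X m \<in> {r})}"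
      by metis
    also have "\<dots> \<le> emeasure (markov_chain_law t K) {X. \<exists>m. X m \<in> {r}} * ?\<theta>"
      by (rule emeasure_markov_visit_le[OF J shift]) auto
    finally show ?thesis by simp
  qed
  have "?\<theta> = (\<integral>\<^sup>+y. emeasure (markov_chain_law y K) {X. J (case_nat r X)} \<partial>measure_pmf (K r))"
    by (rule emeasure_markov_first_step[OF J])
  also have "\<dots> \<le> (\<integral>\<^sup>+y. emeasure (markov_chain_law y K) {X. \<exists>m. X m = r} * ?\<theta> \<partial>measure_pmf (K r))"
    by (intro nn_integral_mono order_trans[OF emeasure_markov_mono visit]) (use shift' J in auto)
  also have "\<dots> = (\<integral>\<^sup>+y. emeasure (markov_chain_law y K) {X. \<exists>m. X m = r} \<partial>measure_pmf (K r)) * ?\<theta>"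
    by (rule nn_integral_multc) simp
  also have "(\<integral>\<^sup>+y. emeasure (markov_chain_law y K) {X. \<exists>m. X m = r} \<partial>measure_pmf (K r)) =
      emeasure (markov_chain_law r K) {X. \<exists>n. X (Suc n) = r}"
    by (subst emeasure_markov_first_step[of "\<lambda>X. \<exists>n. X (Suc n) = r"]) (intro path_event_intros, simp)
  finally have "?\<theta> = 0"
    using assms emeasure_markov_le_1[of r K "{X. J X}"]
    by (intro ennreal_le_mult_less_1) (auto intro: le_less_trans)
  then have "emeasure (markov_chain_law s K) {X. J X} = 0"
    using visit[of s] by simp
  then have "AE X in markov_chain_law s K. \<not> J X"
    by (subst AE_markov_iff[OF path_event_not[OF J]]) simp
  then show ?thesis by (simp add: J_def)
qed

text \<open>The confinement to \<open>D\<close> before the hit permits the comparison of chains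
  whose transition laws correspond only in a region.\<close>

definition reaches :: "'a set \<Rightarrow> 'a set \<Rightarrow> (nat \<Rightarrow> 'a) \<Rightarrow> bool" where
  "reaches A D X \<longleftrightarrow> (\<exists>m. X m \<in> A \<and> (\<forall>i<m. X i \<in> D))"

lemma path_event_reaches: "path_event (reaches A D)"
  unfolding reaches_def by (intro path_event_intros)

lemma reaches_case_nat:
  "reaches A D (case_nat s X) \<longleftrightarrow> s \<in> A \<or> s \<in> D \<and> reaches A D X"
proof
  assume "reaches A D (case_nat s X)"
  then obtain m where m: "case_nat s X m \<in> A" "\<forall>i<m. case_nat s X i \<in> D"
    unfolding reaches_def by blast
  show "s \<in> A \<or> s \<in> D \<and> reaches A D X"
  proof (cases m)
    case (Suc k)
    have "s \<in> D" using m(2)[rule_format, of 0] Suc by simp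
    moreover have "X i \<in> D" if "i < k" for i
      using m(2)[rule_format, of "Suc i"] Suc that by simp
    ultimately show ?thesis using m(1) Suc unfolding reaches_def by auto
  qed (use m in auto)
next
  assume "s \<in> A \<or> s \<in> D \<and> reaches A D X"
  then show "reaches A D (case_nat s X)"
  proof
    assume "s \<in> D \<and> reaches A D X"
    then obtain m where "s \<in> D" "X m \<in> A" "\<forall>i<m. X i \<in> D" unfolding reaches_def by blast
    then show ?thesis
      unfolding reaches_def
      by (intro exI[of _ "Suc m"]) (auto split: nat.splits)
  qed (auto simp: reaches_def intro!: exI[of _ 0])
qed

lemma emeasure_reaches_step:
  fixes s :: "'a::countable"
  assumes "s \<notin> A" "s \<in> D"
  shows "emeasure (markov_chain_law s K) {X. reaches A D X} =
    (\<integral>\<^sup>+y. emeasure (markov_chain_law y K) {X. reaches A D X} \<partial>measure_pmf (K s))"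
  by (subst emeasure_markov_first_step[OF path_event_reaches])
     (use assms in \<open>simp add: reaches_case_nat\<close>)

text \<open>Maximum principle: a function that is at least 1 on \<open>A\<close> and superharmonic
  on the rest of \<open>D\<close> dominates the hitting probability. The escape and the growth
  estimates both rest on a suitable choice of \<open>h\<close>.\<close>

theorem emeasure_reaches_le:
  fixes s :: "'a::countable" and h :: "'a \<Rightarrow> ennreal"
  assumes A: "\<And>v. v \<in> A \<Longrightarrow> 1 \<le> h v"
    and D: "\<And>v. v \<in> D \<Longrightarrow> v \<notin> A \<Longrightarrow> (\<integral>\<^sup>+y. h y \<partial>measure_pmf (K v)) \<le> h v"
  shows "emeasure (markov_chain_law s K) {X. reaches A D X} \<le> h s"
proof -
  let ?R = "\<lambda>n X. \<exists>m. m \<le> n \<and> X m \<in> A \<and> (\<forall>i<m. X i \<in> D)"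
  have R: "path_event (?R n)" for n :: nat by (intro path_event_intros)
  have step: "?R (Suc n) (case_nat s X) \<Longrightarrow> s \<in> D \<and> ?R n X" if s: "s \<notin> A" for n s X
  proof -
    assume "?R (Suc n) (case_nat s X)"
    then obtain m where m: "m \<le> Suc n" "case_nat s X m \<in> A" "\<forall>i<m. case_nat s X i \<in> D" by blast
    then obtain k where k: "m = Suc k" using s by (cases m) auto
    have "X i \<in> D" if "i < k" for i
      using m(3)[rule_format, of "Suc i"] k that by simp
    moreover have "s \<in> D" using m(3)[rule_format, of 0] k by simp
    ultimately show ?thesis using m k by auto
  qed
  have fin: "emeasure (markov_chain_law s K) {X. ?R n X} \<le> h s" for n s
  proof (induction n arbitrary: s)
    case 0
    show ?case
    proof (cases "s \<in> A")
      case True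
      then show ?thesis by (intro order_trans[OF emeasure_markov_le_1 A])
    next
      case False
      have "emeasure (markov_chain_law s K) {X. ?R 0 X} = emeasure (markov_chain_law s K) {X. False}"
      proof (rule emeasure_markov_cong_start[OF R path_event_const])
        fix X :: "nat \<Rightarrow> 'a" assume "X 0 = s"
        then show "?R 0 X \<longleftrightarrow> False" using False by simp
      qed
      then show ?thesis by simp
    qed
  next
    case (Suc n)
    show ?case
    proof (cases "s \<in> A")
      case True
      then show ?thesis by (intro order_trans[OF emeasure_markov_le_1 A])
    next
      case sA: False
      have e: "emeasure (markov_chain_law s K) {X. ?R (Suc n) X} =
          (\<integral>\<^sup>+y. emeasure (markov_chain_law y K) {X. ?R (Suc n) (case_nat s X)} \<partial>measure_pmf (K s))"
        by (rule emeasure_markov_first_step[OF R])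
      show ?thesis
      proof (cases "s \<in> D")
        case True
        have "emeasure (markov_chain_law s K) {X. ?R (Suc n) X} \<le> (\<integral>\<^sup>+y. h y \<partial>measure_pmf (K s))"
          unfolding e
        proof (rule nn_integral_mono)
          fix y
          have "emeasure (markov_chain_law y K) {X. ?R (Suc n) (case_nat s X)} \<le> emeasure (markov_chain_law y K) {X. ?R n X}"
          proof (rule emeasure_markov_mono[OF _ R])
            fix X assume "?R (Suc n) (case_nat s X)"
            from step[OF sA this] show "?R n X" by (rule conjunct2)
          qed
          also have "\<dots> \<le> h y" by (rule Suc.IH)
          finally show "emeasure (markov_chain_law y K) {X. ?R (Suc n) (case_nat s X)} \<le> h y" .
        qed
        also have "\<dots> \<le> h s" by (rule D[OF True sA])
        finally show ?thesis .
      next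
        case False
        have "\<not> ?R (Suc n) (case_nat s X)" for X
        proof
          assume "?R (Suc n) (case_nat s X)"
          from step[OF sA this] have "s \<in> D" by (rule conjunct1)
          with False show False by simp
        qed
        then have "{X. ?R (Suc n) (case_nat s X)} = {}" by (simp only: Collect_empty_eq not_False_eq_True simp_thms)
        then show ?thesis unfolding e by (simp only: emeasure_empty nn_integral_const) simp
      qed
    qed
  qed
  have "(SUP n. emeasure (markov_chain_law s K) {X. ?R n X}) =
      emeasure (markov_chain_law s K) (\<Union>n::nat. {X. ?R n X})"
  proof (rule SUP_emeasure_incseq)
    show "range (\<lambda>n. {X. ?R n X}) \<subseteq> sets (markov_chain_law s K)"
      by (intro image_subsetI path_event_markov_set R)
    show "incseq (\<lambda>n. {X. ?R n X})"
    proof (rule incseq_SucI, rule Collect_mono, rule impI)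
      fix n X assume "?R (n :: nat) X"
      then obtain m where "m \<le> n" "X m \<in> A" "\<forall>i<m. X i \<in> D" by blast
      then show "?R (Suc n) X" by (intro exI[of _ m]) simp
    qed
  qed
  moreover have "(\<Union>n::nat. {X. ?R n X}) = {X. reaches A D X}"
    unfolding reaches_def by auto
  ultimately have "emeasure (markov_chain_law s K) {X. reaches A D X} =
      (SUP n. emeasure (markov_chain_law s K) {X. ?R n X})" by simp
  also have "\<dots> \<le> h s" by (rule SUP_least) (rule fin)
  finally show ?thesis .
qed

text \<open>The hitting probability of the second chain, pulled back by \<phi>, is superharmonic for
  the first chain wherever \<phi> intertwines the kernels.\<close>

theorem emeasure_reaches_transfer:
  fixes \<phi> :: "'a::countable \<Rightarrow> 'b::countable"
  assumes "\<phi> ` A \<subseteq> A'" "\<phi> ` D \<subseteq> D'"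
    and K: "\<And>v. v \<in> D \<Longrightarrow> v \<notin> A \<Longrightarrow> K' (\<phi> v) = map_pmf \<phi> (K v)"
  shows "emeasure (markov_chain_law s K) {X. reaches A D X} \<le>
    emeasure (markov_chain_law (\<phi> s) K') {X. reaches A' D' X}"
proof -
  let ?h = "\<lambda>v. emeasure (markov_chain_law (\<phi> v) K') {X. reaches A' D' X}"
  have in_A: "emeasure (markov_chain_law v K') {X. reaches A' D' X} = 1" if "v \<in> A'" for v
  proof -
    have "emeasure (markov_chain_law v K') {X. reaches A' D' X} = emeasure (markov_chain_law v K') {X. True}"
      by (rule emeasure_markov_cong_start[OF path_event_reaches path_event_const])
         (use that in \<open>auto simp: reaches_def intro!: exI[of _ 0]\<close>)
    then show ?thesis by simp
  qed
  show ?thesis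
  proof (rule emeasure_reaches_le[where h = ?h])
    show "1 \<le> ?h v" if "v \<in> A" for v
      using in_A[of "\<phi> v"] that assms(1) by auto
    show "(\<integral>\<^sup>+y. ?h y \<partial>measure_pmf (K v)) \<le> ?h v" if v: "v \<in> D" "v \<notin> A" for v
    proof (cases "\<phi> v \<in> A'")
      case True
      have "(\<integral>\<^sup>+y. ?h y \<partial>measure_pmf (K v)) \<le> (\<integral>\<^sup>+y. 1 \<partial>measure_pmf (K v))"
        by (intro nn_integral_mono emeasure_markov_le_1)
      also have "\<dots> = 1" by (simp add: measure_pmf.emeasure_space_1[unfolded space_measure_pmf])
      finally show ?thesis using in_A[OF True] by simp
    next
      case False
      have "\<phi> v \<in> D'" using v assms(2) by auto
      from emeasure_reaches_step[OF False this, of K'] show ?thesis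
        using K[OF v] by simp
    qed
  qed
qed

section \<open>The self-avoiding tree and its random walk\<close>

lemma AE_markov_support:
  fixes s :: "'a::countable"
  shows "AE X in markov_chain_law s K. \<forall>n. X (Suc n) \<in> set_pmf (K (X n))"
proof -
  define J where "J X \<longleftrightarrow> X 1 \<notin> set_pmf (K (X 0))" for X :: "nat \<Rightarrow> 'a"
  have J: "path_event J"
    unfolding J_def by (rule path_event_coordinates2)
  have "emeasure (markov_chain_law t K) {X. J X} = 0" for t
  proof -
    have "emeasure (markov_chain_law t K) {X. J X} =
        (\<integral>\<^sup>+y. emeasure (markov_chain_law y K) {X. X 0 \<notin> set_pmf (K t)} \<partial>measure_pmf (K t))"
      by (subst emeasure_markov_first_step[OF J]) (simp add: J_def)
    also have "\<dots> = (\<integral>\<^sup>+y. 0 \<partial>measure_pmf (K t))"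
    proof (rule nn_integral_cong_AE, rule AE_pmfI)
      fix y assume y: "y \<in> set_pmf (K t)"
      have "emeasure (markov_chain_law y K) {X. X 0 \<notin> set_pmf (K t)} = emeasure (markov_chain_law y K) {X. False}"
        by (rule emeasure_markov_cong_start) (use y in \<open>auto intro!: path_event_intros\<close>)
      then show "emeasure (markov_chain_law y K) {X. X 0 \<notin> set_pmf (K t)} = 0" by simp
    qed
    finally show ?thesis by simp
  qed
  from AE_markov_shift[OF J this, of s] show ?thesis
    by (simp add: J_def)
qed

section \<open>Self-avoiding walks as vertices of the tree\<close>

lemma saws_appendD: "x @ y \<in> saws G \<Longrightarrow> x \<noteq> [] \<Longrightarrow> x \<in> saws G"
  by (auto simp: saws_def successively_append_iff)

lemma saws_prefix: "y \<in> saws G \<Longrightarrow> prefix x y \<Longrightarrow> x \<noteq> [] \<Longrightarrow> x \<in> saws G"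
  by (auto simp: prefix_def dest: saws_appendD)

lemma saws_not_Nil: "x \<in> saws G \<Longrightarrow> x \<noteq> []"
  by (simp add: saws_def)

lemma saws_snoc:
  "x \<noteq> [] \<Longrightarrow> x @ [v] \<in> saws G \<longleftrightarrow> x \<in> saws G \<and> v \<in> G \<and> v \<notin> set x \<and> nbr (last x) v"
  by (auto simp: saws_def successively_append_iff)

lemma saws_append:
  "x \<in> saws G \<Longrightarrow> set y \<subseteq> G \<Longrightarrow> distinct y \<Longrightarrow> set x \<inter> set y = {} \<Longrightarrow> successively nbr (last x # y) \<Longrightarrow>
    x @ y \<in> saws G"
  by (cases y) (auto simp: saws_def successively_append_iff)

lemma root_in_saws: "(0, 0) \<in> G \<Longrightarrow> root \<in> saws G"
  by (simp add: saws_def root_def)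

lemma saws_length_1: "x \<in> saws G \<Longrightarrow> length x = 1 \<longleftrightarrow> x = root"
  by (cases x) (auto simp: saws_def root_def)

lemma root_not_Nil [simp]: "root \<noteq> []"
  by (simp add: root_def)

lemma parent_in_saws:
  assumes "x \<in> saws G" "x \<noteq> root"
  shows "parent x \<in> saws G"
proof -
  have "length x \<noteq> 0" "length x \<noteq> 1" using assms saws_length_1 saws_not_Nil by auto
  then have "length x \<ge> 2" by arith
  then have "length (butlast x) \<noteq> 0" by simp
  then have "butlast x \<noteq> []" by (simp only: length_0_conv not_False_eq_True)
  then show ?thesis
    unfolding parent_def by (rule saws_prefix[OF assms(1) prefixeq_butlast])
qed

lemma saws_snoc_parent: "x \<in> saws G \<Longrightarrow> x = parent x @ [last x]"
  by (simp add: parent_def saws_not_Nil)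

lemma nbr_iff: "nbr p q \<longleftrightarrow> q \<in> {(fst p + 1, snd p), (fst p - 1, snd p), (fst p, snd p + 1), (fst p, snd p - 1)}"
  by (cases p; cases q) (auto simp: nbr_def abs_if split: if_splits)

lemma nbr_commute: "nbr p q \<longleftrightarrow> nbr q p"
  by (simp add: nbr_def abs_minus_commute)

lemma children_eq:
  "x \<in> saws G \<Longrightarrow> children G x = (\<lambda>v. x @ [v]) ` {v. nbr (last x) v \<and> v \<in> G \<and> v \<notin> set x}"
  by (auto simp: children_def saws_snoc saws_not_Nil)

lemma card_children_le: "x \<in> saws G \<Longrightarrow> card (children G x) \<le> 4"
proof -
  assume x: "x \<in> saws G"
  let ?N = "{(fst (last x) + 1, snd (last x)), (fst (last x) - 1, snd (last x)),
      (fst (last x), snd (last x) + 1), (fst (last x), snd (last x) - 1)}"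
  have "card (children G x) \<le> card {v. nbr (last x) v \<and> v \<in> G \<and> v \<notin> set x}"
    unfolding children_eq[OF x]
    by (rule card_image_le, rule finite_subset[of _ ?N]) (auto simp: nbr_iff)
  also have "\<dots> \<le> card ?N" by (rule card_mono) (auto simp: nbr_iff)
  also have "\<dots> \<le> 4" by (simp add: card_insert_if)
  finally show ?thesis .
qed

lemma children_root_nonempty: "G \<in> {UNIV, half_plane} \<Longrightarrow> children G root \<noteq> {}"
proof -
  assume "G \<in> {UNIV, half_plane}"
  then have "root @ [(0, 1)] \<in> children G root"
    by (auto simp: children_def saws_def root_def nbr_def half_plane_def)
  then show ?thesis by blast
qed

definition tree_step :: "site set \<Rightarrow> site list \<Rightarrow> site list \<Rightarrow> bool" where
  "tree_step G x y \<longleftrightarrow> y \<in> children G x \<or> x \<noteq> root \<and> y = parent x"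

lemma tree_step_saws: "tree_step G x y \<Longrightarrow> x \<in> saws G \<Longrightarrow> y \<in> saws G"
  by (auto simp: tree_step_def children_def parent_in_saws)

lemma children_not_parent: "y \<in> children G x \<Longrightarrow> y \<noteq> parent x"
  using parent_notin_children by auto

text \<open>A lower bound for every transition probability: a vertex has at most four children, so a
  step from the root has probability at least 1/4 and any other step at least min(1, \<lambda>) / (1
  + 4 \<lambda>).\<close>

definition min_step :: "real \<Rightarrow> real" where
  "min_step lam = min (1/4) (min 1 lam / (1 + 4 * lam))"

lemma min_step_pos: "lam > 0 \<Longrightarrow> min_step lam > 0"
  by (simp add: min_step_def)

lemma min_step_le_1: "min_step lam \<le> 1"
  by (simp add: min_step_def)

lemma set_RW_step:
  assumes "lam > 0" "G \<in> {UNIV, half_plane}" "x \<in> saws G" "y \<in> set_pmf (RW_step G lam x)"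
  shows "tree_step G x y"
proof (cases "x = root")
  case True
  then have "y \<in> children G root"
    using assms children_root_nonempty[OF assms(2)] finite_children[of G root] by (simp add: RW_step_def)
  then show ?thesis using True by (simp add: tree_step_def)
next
  case False
  then have "step_prob G lam x y \<noteq> 0"
    using assms(4) pmf_RW_step[OF assms(1) False] by (simp add: set_pmf_iff)
  then show ?thesis using False by (auto simp: step_prob_def tree_step_def split: if_splits)
qed

lemma pmf_RW_step_ge:
  assumes "lam > 0" "G \<in> {UNIV, half_plane}" "x \<in> saws G" "tree_step G x y"
  shows "pmf (RW_step G lam x) y \<ge> min_step lam"
proof -
  have c: "real (card (children G x)) \<le> 4" using card_children_le[OF assms(3)] by simp
  show ?thesis
  proof (cases "x = root")
    case True
    have y: "y \<in> children G root" using assms(4) True by (simp add: tree_step_def)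
    have ne: "children G root \<noteq> {}" by (rule children_root_nonempty[OF assms(2)])
    then have "card (children G root) > 0" by (simp add: card_gt_0_iff finite_children)
    then have "1 / 4 \<le> 1 / real (card (children G root))" using c True by (simp add: field_simps)
    also have "\<dots> = pmf (RW_step G lam x) y"
      using True y ne finite_children[of G root] by (simp add: RW_step_def)
    finally show ?thesis by (simp add: min_step_def)
  next
    case False
    have d: "0 < 1 + real (card (children G x)) * lam" using assms(1) by (intro add_pos_nonneg) auto
    have le: "1 + real (card (children G x)) * lam \<le> 1 + 4 * lam"
      using mult_right_mono[OF c, of lam] assms(1) by simp
    have "min_step lam \<le> min 1 lam / (1 + 4 * lam)" by (simp add: min_step_def)
    also have "\<dots> \<le> min 1 lam / (1 + real (card (children G x)) * lam)"
      using le d assms(1) by (intro divide_left_mono) auto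
    also have "\<dots> \<le> pmf (RW_step G lam x) y"
      using assms(4) False children_not_parent[of y G x] d
      unfolding pmf_RW_step[OF assms(1) False] step_prob_def tree_step_def
      by (auto intro!: divide_right_mono)
    finally show ?thesis .
  qed
qed

section \<open>Trajectories on the tree and their limit ray\<close>

abbreviation RWs :: "site set \<Rightarrow> real \<Rightarrow> site list \<Rightarrow> (nat \<Rightarrow> site list) measure" where
  "RWs G lam s \<equiv> markov_chain_law s (RW_step G lam)"

lemma AE_RW_tree_steps:
  assumes "lam > 0" "G \<in> {UNIV, half_plane}" "s \<in> saws G"
  shows "AE X in RWs G lam s. X 0 = s \<and> (\<forall>n. X n \<in> saws G \<and> tree_step G (X n) (X (Suc n)))"
  using AE_markov_start[where s = s and K = "RW_step G lam"] AE_markov_support[where s = s and K = "RW_step G lam"]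
proof eventually_elim
  case (elim X)
  have "X n \<in> saws G" for n
  proof (induction n)
    case (Suc n)
    then show ?case using elim set_RW_step[OF assms(1,2) Suc] tree_step_saws by blast
  qed (use elim assms(3) in simp)
  then show ?case using elim set_RW_step[OF assms(1,2)] by blast
qed

definition tree_path :: "site set \<Rightarrow> (nat \<Rightarrow> site list) \<Rightarrow> bool" where
  "tree_path G X \<longleftrightarrow> X 0 = root \<and> (\<forall>n. X n \<in> saws G \<and> tree_step G (X n) (X (Suc n)))"

lemma AE_tree_path:
  assumes "lam > 0" "G \<in> {UNIV, half_plane}"
  shows "AE X in RWs G lam root. tree_path G X"
  using AE_RW_tree_steps[OF assms root_in_saws] assms by (auto simp: tree_path_def half_plane_def)

lemma tree_path_saws: "tree_path G X \<Longrightarrow> X n \<in> saws G"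
  by (simp add: tree_path_def)

text \<open>The trajectory starts at the root and each step adds or removes one final site, so a
  walk can only grow through all of its prefixes. This turns sites of \<open>X n\<close> into
  endpoints of earlier positions.\<close>

lemma tree_path_prefix_visited:
  assumes "tree_path G X" "prefix p (X n)" "p \<noteq> []"
  shows "\<exists>m\<le>n. X m = p"
  using assms(2)
proof (induction n)
  case 0
  then show ?case using assms(1,3) by (auto simp: tree_path_def root_def prefix_Cons)
next
  case (Suc n)
  show ?case
  proof (cases "p = X (Suc n)")
    case False
    have "tree_step G (X n) (X (Suc n))" using assms(1) by (simp add: tree_path_def)
    then have "prefix p (X n)"
    proof (unfold tree_step_def, elim disjE conjE)
      assume "X (Suc n) \<in> children G (X n)"
      then obtain v where "X (Suc n) = X n @ [v]" by (auto simp: children_def)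
      then show ?thesis using Suc.prems False by auto
    next
      assume "X (Suc n) = parent (X n)"
      then show ?thesis using Suc.prems prefixeq_butlast prefix_order.trans unfolding parent_def by metis
    qed
    then show ?thesis using Suc.IH le_SucI by blast
  qed auto
qed

text \<open>Only the step from \<open>b\<close> to its parent leaves the subtree of
  \<open>b\<close>.\<close>

lemma tree_path_stay:
  assumes "tree_path G X" "prefix b (X n)" "\<forall>m\<ge>n. X m \<noteq> parent b" "m \<ge> n"
  shows "prefix b (X m)"
  using assms(4)
proof (induction m rule: dec_induct)
  case base
  then show ?case by (rule assms(2))
next
  case (step m)
  have "tree_step G (X m) (X (Suc m))" using assms(1) by (simp add: tree_path_def)
  then show ?case
  proof (unfold tree_step_def, elim disjE conjE)
    assume "X (Suc m) \<in> children G (X m)"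
    then show ?thesis using step.IH by (auto simp: children_def prefix_def)
  next
    assume p: "X (Suc m) = parent (X m)"
    have "X (Suc m) \<noteq> parent b" using assms(3) step.hyps(1) le_SucI by blast
    then have "X m \<noteq> b" using p by metis
    then have "prefix b (butlast (X m))"
      using step.IH by (metis append_butlast_last_id butlast.simps(1) prefix_Nil prefix_snoc)
    then show ?thesis using p by (simp add: parent_def)
  qed
qed

lemma finite_saws_length: "finite {w \<in> saws G. length w \<le> k}"
proof (induction k)
  case 0
  have "{w \<in> saws G. length w \<le> 0} = {}" by (auto simp: saws_def)
  then show ?case by simp
next
  case (Suc k)
  have "{w \<in> saws G. length w \<le> Suc k} \<subseteq> insert root (\<Union>x\<in>{w \<in> saws G. length w \<le> k}. children G x)"
  proof
    fix w assume w: "w \<in> {w \<in> saws G. length w \<le> Suc k}"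
    show "w \<in> insert root (\<Union>x\<in>{w \<in> saws G. length w \<le> k}. children G x)"
    proof (cases "w = root")
      case False
      have "w = parent w @ [last w]" using w saws_snoc_parent by blast
      then have "w \<in> children G (parent w)" using w unfolding children_def by blast
      moreover have "parent w \<in> saws G" using w False parent_in_saws by blast
      moreover have "length (parent w) \<le> k" using w by (auto simp: parent_def)
      ultimately show ?thesis by blast
    qed simp
  qed
  then show ?case
    by (rule finite_subset) (use Suc.IH finite_children in blast)
qed

lemma finite_saws_subset: "finite A \<Longrightarrow> finite {w \<in> saws G. set w \<subseteq> A}"
  by (rule finite_subset[OF _ finite_subset_distinct[of A]]) (auto simp: saws_def)

definition finite_visits :: "(nat \<Rightarrow> 'a) \<Rightarrow> bool" where
  "finite_visits X \<longleftrightarrow> (\<forall>v. finite {n. X n = v})"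

lemma finite_visits_finite_set:
  assumes "finite_visits X" "finite A"
  shows "finite {n. X n \<in> A}"
proof -
  have "{n. X n \<in> A} = (\<Union>v\<in>A. {n. X n = v})" by auto
  then show ?thesis using assms by (simp add: finite_visits_def)
qed

text \<open>There are finitely many walks of each length, so finite visits force the length of
  \<open>X n\<close> to infinity, and the initial sites stabilise to the ray \<omega>.\<close>

lemma tree_path_ray:
  assumes X: "tree_path G X" and fin: "finite_visits X"
  obtains \<omega> :: "nat \<Rightarrow> site" where
    "\<And>k. \<exists>n0. \<forall>n\<ge>n0. k < length (X n) \<and> prefix (map \<omega> [0..<k]) (X n)"
proof -
  have "\<exists>n0. \<forall>n\<ge>n0. k < length (X n)" for k
  proof -
    have "finite {n. X n \<in> {w \<in> saws G. length w \<le> k}}"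
      by (rule finite_visits_finite_set[OF fin finite_saws_length])
    then obtain n0 where "\<forall>n\<in>{n. X n \<in> {w \<in> saws G. length w \<le> k}}. n < n0"
      using finite_nat_iff_bounded by (metis (no_types, lifting) lessThan_iff subsetD)
    then have "\<forall>n\<ge>n0. k < length (X n)"
      using tree_path_saws[OF X] by (metis (mono_tags, lifting) leD leI mem_Collect_eq)
    then show ?thesis by blast
  qed
  then obtain N where N: "\<And>k n. n \<ge> N k \<Longrightarrow> k < length (X n)" by metis
  \<comment> \<open>From time \<open>N (Suc k)\<close> on there are at least \<open>k + 2\<close>
    sites, so removing the last one leaves site \<open>k\<close> in place.\<close>
  define \<omega> where "\<omega> k = X (N (Suc k)) ! k" for k
  have \<omega>: "X n ! k = \<omega> k" if "n \<ge> N (Suc k)" for n k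
    using that
  proof (induction n rule: dec_induct)
    case base
    then show ?case by (simp add: \<omega>_def)
  next
    case (step n)
    have len: "Suc k < length (X n)" using N step.hyps by blast
    have "tree_step G (X n) (X (Suc n))" using X by (simp add: tree_path_def)
    then have "X (Suc n) ! k = X n ! k"
      using len by (auto simp: tree_step_def children_def parent_def nth_append nth_butlast)
    then show ?case using step.IH by simp
  qed
  show ?thesis
  proof (rule that)
    fix k
    define n0 where "n0 = Max (insert (N k) ((\<lambda>j. N (Suc j)) ` {..<k}))"
    have "k < length (X n) \<and> prefix (map \<omega> [0..<k]) (X n)" if n: "n \<ge> n0" for n
    proof
      have "N k \<le> n0" unfolding n0_def by simp
      then show len: "k < length (X n)" using N n le_trans by blast
      have nth: "X n ! j = \<omega> j" if "j < k" for j
      proof -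
        have "N (Suc j) \<le> n0" unfolding n0_def using that by (intro Max_ge) auto
        then show ?thesis using \<omega> n le_trans by blast
      qed
      have "map \<omega> [0..<k] = take k (X n)"
        using len nth by (intro nth_equalityI) auto
      then show "prefix (map \<omega> [0..<k]) (X n)" by (simp add: take_is_prefix)
    qed
    then show "\<exists>n0. \<forall>n\<ge>n0. k < length (X n) \<and> prefix (map \<omega> [0..<k]) (X n)" by blast
  qed
qed

section \<open>Lower bounds for hitting probabilities, and finite visits\<close>

lemma hit_step:
  assumes "lam > 0" "G \<in> {UNIV, half_plane}" "x \<in> saws G" "tree_step G x y"
  shows "ennreal (min_step lam) * emeasure (RWs G lam y) {X. \<exists>n. X n \<in> B} \<le> emeasure (RWs G lam x) {X. \<exists>n. X n \<in> B}"
proof -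
  have "ennreal (min_step lam) * emeasure (RWs G lam y) {X. \<exists>n. X n \<in> B} \<le>
      ennreal (pmf (RW_step G lam x) y) * emeasure (RWs G lam y) {X. \<exists>n. X n \<in> B}"
    using pmf_RW_step_ge[OF assms] by (intro mult_right_mono ennreal_leI) simp_all
  also have "\<dots> \<le> emeasure (RWs G lam x) {X. \<exists>n. X n \<in> B}"
  proof (rule emeasure_markov_step_ge)
    show "path_event (\<lambda>X. \<exists>n. X n \<in> B)" "path_event (\<lambda>X. \<exists>n. X n \<in> B)"
      by (intro path_event_intros)+
    fix X :: "nat \<Rightarrow> site list" assume "\<exists>n. X n \<in> B"
    then obtain n where "X n \<in> B" ..
    then show "\<exists>n. case_nat x X n \<in> B" by (intro exI[of _ "Suc n"]) simp
  qed
  finally show ?thesis .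
qed

lemma hit_self:
  fixes b :: "'a::countable"
  assumes "b \<in> B" shows "emeasure (markov_chain_law b K) {X. \<exists>n. X n \<in> B} = 1"
proof -
  have "emeasure (markov_chain_law b K) {X. \<exists>n. X n \<in> B} = emeasure (markov_chain_law b K) {X. True}"
    by (rule emeasure_markov_cong_start[OF _ path_event_const]) (use assms in \<open>auto intro!: path_event_intros\<close>)
  then show ?thesis by simp
qed

lemma hit_extension:
  assumes "lam > 0" "G \<in> {UNIV, half_plane}" "x @ zs \<in> saws G" "x \<noteq> []"
  shows "ennreal (min_step lam) ^ length zs * emeasure (RWs G lam (x @ zs)) {X. \<exists>n. X n \<in> B} \<le>
    emeasure (RWs G lam x) {X. \<exists>n. X n \<in> B}"
  using assms(3)
proof (induction zs rule: rev_induct)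
  case (snoc z zs)
  have s: "x @ zs \<in> saws G"
    using snoc.prems assms(4) saws_appendD[of "x @ zs" "[z]"] by simp
  have "tree_step G (x @ zs) (x @ zs @ [z])"
    using snoc.prems by (simp add: tree_step_def children_def)
  from hit_step[OF assms(1,2) s this, of B]
  have "ennreal (min_step lam) ^ length zs * (ennreal (min_step lam) * emeasure (RWs G lam (x @ zs @ [z])) {X. \<exists>n. X n \<in> B})
      \<le> ennreal (min_step lam) ^ length zs * emeasure (RWs G lam (x @ zs)) {X. \<exists>n. X n \<in> B}"
    by (rule mult_left_mono) simp
  also have "\<dots> \<le> emeasure (RWs G lam x) {X. \<exists>n. X n \<in> B}" by (rule snoc.IH[OF s])
  finally show ?case by (simp add: mult_ac)
qed simp

lemma hit_extension_ge:
  assumes "lam > 0" "G \<in> {UNIV, half_plane}" "x @ zs \<in> saws G" "x \<noteq> []" "x @ zs \<in> B" "length zs \<le> k"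
  shows "ennreal (min_step lam) ^ k \<le> emeasure (RWs G lam x) {X. \<exists>n. X n \<in> B}"
proof -
  have "ennreal (min_step lam) ^ k \<le> ennreal (min_step lam) ^ length zs"
    using min_step_le_1[of lam] assms(6) by (intro power_decreasing) (simp_all flip: ennreal_1 add: ennreal_leI)
  also have "\<dots> \<le> emeasure (RWs G lam x) {X. \<exists>n. X n \<in> B}"
    using hit_extension[OF assms(1-4), of B] hit_self[OF assms(5), of "RW_step G lam"] by simp
  finally show ?thesis .
qed

lemma min_step_power_pos: "lam > 0 \<Longrightarrow> 0 < ennreal (min_step lam) ^ k"
proof -
  assume "lam > 0"
  then have "0 < min_step lam" by (rule min_step_pos)
  then have "0 < ennreal (min_step lam ^ k)" by (simp only: ennreal_less_zero_iff zero_less_power)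
  then show ?thesis using \<open>0 < min_step lam\<close> by (simp only: ennreal_power less_imp_le)
qed

lemma hit_root_ge:
  assumes "lam > 0" "G \<in> {UNIV, half_plane}" "x \<in> saws G" "length x \<le> Suc k"
  shows "ennreal (min_step lam) ^ k \<le> emeasure (RWs G lam x) {X. \<exists>n. X n \<in> {root}}"
  using assms(3,4)
proof (induction k arbitrary: x)
  case 0
  then have "x = root" using saws_length_1[of x G] saws_not_Nil[of x G]
    by (metis One_nat_def le_antisym length_0_conv not_less_eq_eq zero_le)
  then show ?case using hit_self[of x "{root}"] by simp
next
  case (Suc k)
  show ?case
  proof (cases "x = root")
    case True
    have "ennreal (min_step lam) ^ Suc k \<le> 1"
      using min_step_le_1[of lam] by (intro power_le_one) (simp_all flip: ennreal_1 add: ennreal_leI)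
    then show ?thesis using hit_self[of x "{root}"] True by simp
  next
    case False
    have "ennreal (min_step lam) ^ k \<le> emeasure (RWs G lam (parent x)) {X. \<exists>n. X n \<in> {root}}"
      using Suc.prems False by (intro Suc.IH parent_in_saws) (auto simp: parent_def)
    then have "ennreal (min_step lam) ^ Suc k \<le> ennreal (min_step lam) * emeasure (RWs G lam (parent x)) {X. \<exists>n. X n \<in> {root}}"
      by (simp add: mult_left_mono)
    also have "\<dots> \<le> emeasure (RWs G lam x) {X. \<exists>n. X n \<in> {root}}"
      using False by (intro hit_step[OF assms(1,2) Suc.prems(1)]) (simp add: tree_step_def)
    finally show ?thesis .
  qed
qed

text \<open>From a fixed vertex the root is hit with positive probability, so infinitely many visits
  to a vertex would force infinitely many returns to the root.\<close>

lemma AE_vertex_then_root: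
  assumes "lam > 0" "G \<in> {UNIV, half_plane}"
  shows "AE X in RWs G lam root. finite {n. X n = root} \<longrightarrow> finite_visits X"
proof -
  have "AE X in RWs G lam root. \<forall>v. v \<in> saws G \<longrightarrow> infinite {n. X n \<in> {v}} \<longrightarrow> infinite {n. X n \<in> {root}}"
    unfolding AE_all_countable
  proof (intro allI)
    fix v
    show "AE X in RWs G lam root. v \<in> saws G \<longrightarrow> infinite {n. X n \<in> {v}} \<longrightarrow> infinite {n. X n \<in> {root}}"
    proof (cases "v \<in> saws G")
      case True
      have "AE X in RWs G lam root. infinite {n. X n \<in> {v}} \<longrightarrow> infinite {n. X n \<in> {root}}"
      proof (rule AE_markov_recurrent_target)
        show "0 < ennreal (min_step lam) ^ length v" by (rule min_step_power_pos[OF assms(1)])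
        fix w assume "w \<in> {v}"
        then show "ennreal (min_step lam) ^ length v \<le> emeasure (RWs G lam w) {X. \<exists>n. X n \<in> {root}}"
          using True by (intro hit_root_ge[OF assms]) auto
      qed
      then show ?thesis by simp
    qed simp
  qed
  with AE_tree_path[OF assms] show ?thesis
  proof eventually_elim
    case (elim X)
    show ?case
    proof (intro impI, unfold finite_visits_def, intro allI)
      fix v assume r: "finite {n. X n = root}"
      show "finite {n. X n = v}"
      proof (cases "v \<in> saws G")
        case True
        then show ?thesis using elim(2) r by auto
      next
        case False
        then have "{n. X n = v} = {}" using tree_path_saws[OF elim(1)] by blast
        then show ?thesis by simp
      qed
    qed
  qed
qed

lemma transient_return_lt_1:
  assumes "RW_transient G lam"
  shows "emeasure (RWs G lam root) {X. \<exists>n. X (Suc n) = root} < 1"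
proof (rule ccontr)
  have ev: "path_event (\<lambda>X. \<exists>n. X (Suc n) = root)" by (intro path_event_intros)
  assume "\<not> ?thesis"
  then have one: "emeasure (RWs G lam root) {X. \<exists>n. X (Suc n) = root} = 1"
    unfolding not_less by (intro antisym emeasure_markov_le_1)
  have "emeasure (RWs G lam root) {X. \<not> (\<exists>n. X (Suc n) = root)} = 0"
    unfolding emeasure_markov_compl[OF ev] one by simp
  then have "AE X in RWs G lam root. \<exists>n. X (Suc n) = root"
    unfolding AE_markov_iff[OF ev] .
  then have "RW_recurrent G lam"
    unfolding RW_recurrent_def RW_def by eventually_elim auto
  then show False using assms by (simp add: RW_transient_def)
qed

lemma AE_finite_visits:
  assumes "lam > 0" "G \<in> {UNIV, half_plane}" "RW_transient G lam"
  shows "AE X in RWs G lam root. finite_visits X"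
  using AE_markov_transient_state[OF transient_return_lt_1[OF assms(3)], of root] AE_vertex_then_root[OF assms(1,2)]
  by eventually_elim simp

section \<open>Embeddings of self-avoiding trees\<close>

declare split_paired_All [simp del] split_paired_Ex [simp del]

lemma last_in_saw: "x \<in> saws G \<Longrightarrow> last x \<in> set x"
  by (simp add: saws_not_Nil)

definition isometry :: "(site \<Rightarrow> site) \<Rightarrow> bool" where
  "isometry \<psi> \<longleftrightarrow> bij \<psi> \<and> (\<forall>p q. nbr (\<psi> p) (\<psi> q) \<longleftrightarrow> nbr p q)"

lemma isometry_nbr: "isometry \<psi> \<Longrightarrow> nbr (\<psi> p) (\<psi> q) \<longleftrightarrow> nbr p q"
  unfolding isometry_def by blast

lemma isometry_inj: "isometry \<psi> \<Longrightarrow> inj \<psi>"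
  by (simp add: isometry_def bij_is_inj)

lemma isometry_surjD: "isometry \<psi> \<Longrightarrow> \<exists>q. p = \<psi> q"
  unfolding isometry_def using bij_is_surj by (metis surjD)

lemma inj_embedding: "inj \<psi> \<Longrightarrow> inj (\<lambda>\<tau>. w @ map \<psi> \<tau>)"
  by (simp add: inj_def inj_map_eq_map)

lemma successively_map_isometry:
  "isometry \<psi> \<Longrightarrow> successively nbr (map \<psi> xs) \<longleftrightarrow> successively nbr xs"
  by (simp add: successively_map isometry_nbr)

lemma embedding_in_saws:
  assumes "v \<in> saws G" "isometry \<psi>" "nbr (last v) (\<psi> (0, 0))" "\<tau> \<in> saws G'"
    "\<psi> ` set \<tau> \<subseteq> G" "\<psi> ` set \<tau> \<inter> set v = {}"
  shows "v @ map \<psi> \<tau> \<in> saws G"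
proof (rule saws_append[OF assms(1)])
  have \<tau>: "\<tau> \<noteq> []" "hd \<tau> = (0, 0)" "distinct \<tau>" "successively nbr \<tau>"
    using assms(4) by (auto simp: saws_def)
  show "set (map \<psi> \<tau>) \<subseteq> G" "set v \<inter> set (map \<psi> \<tau>) = {}"
    using assms(5,6) by auto
  show "distinct (map \<psi> \<tau>)"
    using \<tau>(3) isometry_inj[OF assms(2)] by (auto simp: distinct_map intro: inj_on_subset)
  show "successively nbr (last v # map \<psi> \<tau>)"
  proof -
    have "successively nbr (map \<psi> \<tau>)" "hd (map \<psi> \<tau>) = \<psi> (0, 0)" "map \<psi> \<tau> \<noteq> []"
      using \<tau> successively_map_isometry[OF assms(2)] by (auto simp: hd_map)
    then show ?thesis using assms(3) by (simp add: successively_Cons)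
  qed
qed

lemma RW_step_embedding:
  fixes w :: "site list" and \<psi> :: "site \<Rightarrow> site"
  defines "\<phi> \<equiv> \<lambda>\<tau>. w @ map \<psi> \<tau>"
  assumes lam: "lam > 0" and \<psi>: "isometry \<psi>"
    and \<tau>: "\<tau> \<in> saws G" "\<tau> \<noteq> root" and \<phi>\<tau>: "\<phi> \<tau> \<in> saws G'" "\<phi> \<tau> \<noteq> root"
    and dom: "\<And>z. nbr (last \<tau>) z \<Longrightarrow> z \<notin> set \<tau> \<Longrightarrow> z \<in> G \<longleftrightarrow> \<psi> z \<in> G' \<and> \<psi> z \<notin> set w"
  shows "RW_step G' lam (\<phi> \<tau>) = map_pmf \<phi> (RW_step G lam \<tau>)"
proof -
  have inj\<psi>: "inj \<psi>" by (rule isometry_inj[OF \<psi>])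
  have inj: "inj \<phi>" unfolding \<phi>_def by (rule inj_embedding[OF inj\<psi>])
  have ne: "\<tau> \<noteq> []" by (rule saws_not_Nil[OF \<tau>(1)])
  have par: "parent (\<phi> \<tau>) = \<phi> (parent \<tau>)"
    using ne by (simp add: \<phi>_def parent_def butlast_append map_butlast)
  have last: "last (\<phi> \<tau>) = \<psi> (last \<tau>)"
    using ne by (simp add: \<phi>_def last_map)
  have ch: "children G' (\<phi> \<tau>) = \<phi> ` children G \<tau>"
  proof (intro set_eqI iffI)
    fix y assume "y \<in> children G' (\<phi> \<tau>)"
    then obtain v where v: "y = \<phi> \<tau> @ [v]" "nbr (\<psi> (last \<tau>)) v" "v \<in> G'" "v \<notin> set (\<phi> \<tau>)"
      unfolding children_eq[OF \<phi>\<tau>(1)] last by blast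
    obtain z where z: "v = \<psi> z" using isometry_surjD[OF \<psi>] by blast
    have nz: "nbr (last \<tau>) z" using v(2) z isometry_nbr[OF \<psi>] by simp
    have "z \<notin> set \<tau>" "\<psi> z \<notin> set w" using v(4) z by (auto simp: \<phi>_def)
    moreover from this have "z \<in> G" using dom[OF nz] v(3) z by simp
    ultimately have "\<tau> @ [z] \<in> children G \<tau>"
      unfolding children_eq[OF \<tau>(1)] using nz by blast
    moreover have "y = \<phi> (\<tau> @ [z])" using v(1) z by (simp add: \<phi>_def)
    ultimately show "y \<in> \<phi> ` children G \<tau>" by blast
  next
    fix y assume "y \<in> \<phi> ` children G \<tau>"
    then obtain z where z: "y = \<phi> (\<tau> @ [z])" "nbr (last \<tau>) z" "z \<in> G" "z \<notin> set \<tau>"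
      unfolding children_eq[OF \<tau>(1)] by blast
    have "\<psi> z \<in> G'" "\<psi> z \<notin> set w" using dom[OF z(2,4)] z(3) by auto
    moreover have "\<psi> z \<notin> set (map \<psi> \<tau>)" using z(4) inj\<psi> by (auto dest: injD)
    ultimately have "\<psi> z \<in> {v. nbr (last (\<phi> \<tau>)) v \<and> v \<in> G' \<and> v \<notin> set (\<phi> \<tau>)}"
      unfolding last using z(2) isometry_nbr[OF \<psi>] by (simp add: \<phi>_def)
    moreover have "y = \<phi> \<tau> @ [\<psi> z]" using z(1) by (simp add: \<phi>_def)
    ultimately show "y \<in> children G' (\<phi> \<tau>)"
      unfolding children_eq[OF \<phi>\<tau>(1)] by blast
  qed
  have card: "card (children G' (\<phi> \<tau>)) = card (children G \<tau>)"
    unfolding ch by (rule card_image) (rule inj_on_subset[OF inj subset_UNIV])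
  show ?thesis
  proof (rule pmf_eqI)
    fix y
    show "pmf (RW_step G' lam (\<phi> \<tau>)) y = pmf (map_pmf \<phi> (RW_step G lam \<tau>)) y"
    proof (cases "y \<in> range \<phi>")
      case True
      then obtain x where x: "y = \<phi> x" by blast
      have "pmf (map_pmf \<phi> (RW_step G lam \<tau>)) y = step_prob G lam \<tau> x"
        unfolding x pmf_map_inj'[OF inj] by (rule pmf_RW_step[OF lam \<tau>(2)])
      moreover have "\<phi> x = \<phi> (parent \<tau>) \<longleftrightarrow> x = parent \<tau>" "\<phi> x \<in> \<phi> ` children G \<tau> \<longleftrightarrow> x \<in> children G \<tau>"
        using inj by (auto dest: injD)
      ultimately show ?thesis
        unfolding pmf_RW_step[OF lam \<phi>\<tau>(2)] step_prob_def card unfolding ch par x by simp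
    next
      case False
      have "pmf (map_pmf \<phi> (RW_step G lam \<tau>)) y = 0"
        by (rule pmf_map_outside) (use False in blast)
      moreover have "y \<noteq> parent (\<phi> \<tau>)" "y \<notin> children G' (\<phi> \<tau>)"
        using False unfolding par ch by blast+
      ultimately show ?thesis
        unfolding pmf_RW_step[OF lam \<phi>\<tau>(2)] step_prob_def by simp
    qed
  qed
qed

text \<open>Rephrases plain hitting with the domain \<open>saws G - B\<close>, so that a comparison
  of chains has to be checked only at genuine walks outside the target.\<close>

lemma hit_eq_reaches:
  assumes "lam > 0" "G \<in> {UNIV, half_plane}" "s \<in> saws G"
  shows "emeasure (RWs G lam s) {X. \<exists>n. X n \<in> B} = emeasure (RWs G lam s) {X. reaches B (saws G - B) X}"
proof (rule emeasure_eq_AE)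
  show "{X. \<exists>n. X n \<in> B} \<in> sets (RWs G lam s)"
    by (intro path_event_markov_set path_event_intros)
  show "{X. reaches B (saws G - B) X} \<in> sets (RWs G lam s)"
    by (intro path_event_markov_set path_event_reaches)
  show "AE X in RWs G lam s. X \<in> {X. \<exists>n. X n \<in> B} \<longleftrightarrow> X \<in> {X. reaches B (saws G - B) X}"
    using AE_RW_tree_steps[OF assms]
  proof eventually_elim
    case (elim X)
    show ?case
    proof
      assume "X \<in> {X. \<exists>n. X n \<in> B}"
      then have ex: "\<exists>n. X n \<in> B" by simp
      have "X (LEAST n. X n \<in> B) \<in> B" using ex by (rule LeastI_ex)
      moreover have "X i \<in> saws G - B" if "i < (LEAST n. X n \<in> B)" for i
        using not_less_Least[OF that] elim by blast
      ultimately show "X \<in> {X. reaches B (saws G - B) X}"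
        unfolding reaches_def by blast
    next
      assume "X \<in> {X. reaches B (saws G - B) X}"
      then show "X \<in> {X. \<exists>n. X n \<in> B}" unfolding reaches_def by blast
    qed
  qed
qed

lemma reaches_le_hit:
  "emeasure (markov_chain_law s K) {X. reaches B D X} \<le> emeasure (markov_chain_law s K) {X. \<exists>n. X n \<in> B}"
  by (rule emeasure_markov_mono) (auto simp: reaches_def intro!: path_event_intros)

text \<open>The site \<open>p\<close> itself is left out, so that the segment can be appended to a
  walk ending at \<open>p\<close>.\<close>

definition run :: "site \<Rightarrow> site \<Rightarrow> nat \<Rightarrow> site list" where
  "run p d k = map (\<lambda>i. (fst p + (int i + 1) * fst d, snd p + (int i + 1) * snd d)) [0..<k]"

lemma run_Suc: "run p d (Suc k) = run p d k @ [(fst p + (int k + 1) * fst d, snd p + (int k + 1) * snd d)]"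
  by (simp add: run_def)

lemma last_run: "last (p # run p d k) = (fst p + int k * fst d, snd p + int k * snd d)"
  by (cases k) (simp_all add: run_def)

lemma length_run [simp]: "length (run p d k) = k"
  by (simp add: run_def)

lemma set_run: "set (run p d k) = {(fst p + j * fst d, snd p + j * snd d) |j. 1 \<le> j \<and> j \<le> int k}"
proof -
  have "j \<in> (\<lambda>i. int i + 1) ` {0..<k}" if "1 \<le> j" "j \<le> int k" for j
    by (rule image_eqI[of _ _ "nat (j - 1)"]) (use that in auto)
  then show ?thesis by (auto simp: run_def image_iff)
qed

lemma run_in_saws:
  assumes v: "v \<in> saws G" and d: "\<bar>fst d\<bar> + \<bar>snd d\<bar> = (1 :: int)"
    and "\<And>j. 1 \<le> j \<Longrightarrow> j \<le> int k \<Longrightarrow>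
      (fst (last v) + j * fst d, snd (last v) + j * snd d) \<in> G - set v"
  shows "v @ run (last v) d k \<in> saws G"
proof (rule saws_append[OF v])
  show "set (run (last v) d k) \<subseteq> G" "set v \<inter> set (run (last v) d k) = {}"
    using assms(3) unfolding set_run by blast+
  have "fst d \<noteq> 0 \<or> snd d \<noteq> 0" using d by auto
  then show "distinct (run (last v) d k)"
    by (auto simp: run_def distinct_map inj_on_def)
  show "successively nbr (last v # run (last v) d k)"
  proof (induction k)
    case (Suc k)
    have "nbr (last (last v # run (last v) d k)) (fst (last v) + (int k + 1) * fst d, snd (last v) + (int k + 1) * snd d)"
      unfolding last_run using d by (simp add: nbr_def algebra_simps)
    then show ?case
      using Suc unfolding run_Suc append_Cons[symmetric] successively_append_iff by simp
  qed (simp add: run_def)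
qed

text \<open>Cutting \<open>X n\<close> at its first site with property \<open>P\<close> gives a
  prefix, hence a visited vertex. Applied to a threshold, this produces a vertex at which a record
  is set.\<close>

lemma tree_path_site_visited:
  assumes X: "tree_path G X" and p: "p \<in> set (X n)" and P: "P p"
  shows "\<exists>m. prefix (X m) (X n) \<and> P (last (X m)) \<and> (\<forall>r\<in>set (butlast (X m)). \<not> P r)"
proof -
  have "\<exists>x\<in>set (X n). P x" using p P by blast
  then obtain ys x zs where s: "X n = ys @ x # zs" "P x" "\<forall>y\<in>set ys. \<not> P y"
    by (rule split_list_first_propE)
  have pre: "prefix (ys @ [x]) (X n)" unfolding s(1) by simp
  then obtain m where "X m = ys @ [x]"
    using tree_path_prefix_visited[OF X pre] by auto
  then have "prefix (X m) (X n) \<and> P (last (X m)) \<and> (\<forall>r\<in>set (butlast (X m)). \<not> P r)"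
    using pre s by simp
  then show ?thesis ..
qed

section \<open>The half-plane\<close>

definition line :: "site list set" where
  "line = {v. snd (last v) = 0}"

section \<open>Reflection in the vertical axis\<close>

definition reflect :: "site \<Rightarrow> site" where
  "reflect p = (- fst p, snd p)"

lemma isometry_reflect: "isometry reflect"
  unfolding isometry_def
proof (intro conjI allI)
  show "bij reflect" by (rule o_bij[of reflect]) (auto simp: reflect_def fun_eq_iff)
qed (auto simp: reflect_def nbr_def)

lemma reflect_half_plane: "reflect p \<in> half_plane \<longleftrightarrow> p \<in> half_plane"
  by (cases p) (simp add: reflect_def half_plane_def)

lemma half_plane_iff: "p \<in> half_plane \<longleftrightarrow> 0 \<le> snd p"
  by (cases p) (simp add: half_plane_def)

lemma reflect_mem: "G \<in> {UNIV, half_plane} \<Longrightarrow> reflect p \<in> G \<longleftrightarrow> p \<in> G"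
  by (elim insertE) (simp_all add: reflect_half_plane)

lemma map_reflect_saws:
  assumes "G \<in> {UNIV, half_plane}" "v \<in> saws G"
  shows "map reflect v \<in> saws G"
proof -
  have "distinct (map reflect v)"
    using assms(2) inj_on_subset[OF isometry_inj[OF isometry_reflect] subset_UNIV]
    by (simp add: saws_def distinct_map)
  moreover have "set (map reflect v) \<subseteq> G"
    using assms reflect_mem[OF assms(1)] by (auto simp: saws_def simp del: split_paired_All)
  moreover have "hd (map reflect v) = (0, 0)"
    using assms(2) by (simp add: saws_def hd_map reflect_def)
  ultimately show ?thesis
    using assms(2) successively_map_isometry[OF isometry_reflect] by (simp add: saws_def)
qed

lemma map_reflect_map_reflect [simp]: "map reflect (map reflect v) = v"
  by (simp add: reflect_def o_def)

lemma map_reflect_root: "map reflect v = root \<longleftrightarrow> v = root"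
proof -
  have "map reflect root = root" by (simp add: root_def reflect_def)
  then show ?thesis by (metis map_reflect_map_reflect)
qed

lemma inj_map_reflect: "inj (map reflect)"
  by (metis injI map_reflect_map_reflect)

lemma children_reflect_subset:
  assumes "G \<in> {UNIV, half_plane}"
  shows "map reflect ` children G v \<subseteq> children G (map reflect v)"
  using map_reflect_saws[OF assms] by (auto simp: children_def)

lemma RW_step_reflect:
  assumes G: "G \<in> {UNIV, half_plane}" and lam: "lam > 0" and v: "v \<in> saws G"
  shows "RW_step G lam (map reflect v) = map_pmf (map reflect) (RW_step G lam v)"
proof (cases "v = root")
  case True
  have r: "map reflect root = root" using map_reflect_root by simp
  have "map reflect ` children G root = children G root"
  proof
    show 1: "map reflect ` children G root \<subseteq> children G root"
      using children_reflect_subset[OF G, of root] unfolding r .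
    show "children G root \<subseteq> map reflect ` children G root"
    proof
      fix y assume "y \<in> children G root"
      then have "map reflect y \<in> children G root" using 1 by blast
      then show "y \<in> map reflect ` children G root" by (metis image_eqI map_reflect_map_reflect)
    qed
  qed
  then show ?thesis
    using map_pmf_of_set_inj[OF inj_on_subset[OF inj_map_reflect subset_UNIV]
        children_root_nonempty[OF G] finite_children]
    unfolding True r by (simp add: RW_step_def)
next
  case False
  show ?thesis
    using RW_step_embedding[where w = "[]" and \<psi> = reflect and \<tau> = v and G = G and G' = G and lam = lam]
      lam isometry_reflect map_reflect_saws[OF G v] v False
    by (simp add: map_reflect_root reflect_mem[OF G])
qed

lemma hit_reflect:
  assumes G: "G \<in> {UNIV, half_plane}" and lam: "lam > 0" and v: "v \<in> saws G" and "map reflect ` A \<subseteq> B"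
  shows "emeasure (RWs G lam v) {X. \<exists>n. X n \<in> A} \<le> emeasure (RWs G lam (map reflect v)) {X. \<exists>n. X n \<in> B}"
proof -
  have "emeasure (RWs G lam v) {X. \<exists>n. X n \<in> A} = emeasure (RWs G lam v) {X. reaches A (saws G - A) X}"
    by (rule hit_eq_reaches[OF lam G v])
  also have "\<dots> \<le> emeasure (RWs G lam (map reflect v)) {X. reaches B UNIV X}"
    by (rule emeasure_reaches_transfer[OF assms(4)]) (use RW_step_reflect[OF G lam] in auto)
  also have "\<dots> \<le> emeasure (RWs G lam (map reflect v)) {X. \<exists>n. X n \<in> B}"
    by (rule reaches_le_hit)
  finally show ?thesis .
qed

lemma saws_half_plane_site: "v \<in> saws half_plane \<Longrightarrow> p \<in> set v \<Longrightarrow> 0 \<le> snd p"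
  unfolding saws_def half_plane_iff[symmetric] by blast

lemma last_saws_half_plane: "v \<in> saws half_plane \<Longrightarrow> 0 \<le> snd (last v)"
  by (simp add: saws_half_plane_site saws_not_Nil)

section \<open>Unbounded horizontal extent of transient trajectories\<close>

definition top_records :: "int \<Rightarrow> site list set" where
  "top_records M = {v \<in> saws half_plane. (\<forall>p\<in>set v. \<bar>fst p\<bar> < M) \<and> (\<forall>p\<in>set (butlast v). snd p < snd (last v))}"

text \<open>The row of a top record contains no earlier site, so the walk can run straight to column
  \<open>M\<close>. This takes at most \<open>2 * M\<close> steps, because the record lies in a
  column beyond \<open>- M\<close>.\<close>

lemma top_record_hits:
  assumes lam: "lam > 0" and v: "v \<in> top_records M"
  shows "ennreal (min_step lam) ^ nat (2 * M) \<le> emeasure (RWs half_plane lam v) {X. \<exists>n. X n \<in> {u. fst (last u) = M}}"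
proof -
  have vs: "v \<in> saws half_plane" and x: "\<And>p. p \<in> set v \<Longrightarrow> \<bar>fst p\<bar> < M"
    and y: "\<And>p. p \<in> set (butlast v) \<Longrightarrow> snd p < snd (last v)"
    using v by (auto simp: top_records_def)
  have ne: "v \<noteq> []" using vs by (rule saws_not_Nil)
  have lx: "\<bar>fst (last v)\<bar> < M" using x ne by simp
  have ly: "snd (last v) \<ge> 0" using last_saws_half_plane[OF vs] .
  define k where "k = nat (M - fst (last v))"
  have dv: "distinct v" using vs by (simp add: saws_def)
  have fresh: "(fst (last v) + j * fst (1, 0), snd (last v) + j * snd (1, 0::int)) \<in> half_plane - set v"
    if "1 \<le> j" "j \<le> int k" for j
  proof -
    let ?z = "(fst (last v) + j, snd (last v))"
    have "?z \<noteq> last v" using that(1) by (cases "last v") auto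
    moreover have "?z \<notin> set (butlast v)" using y[of ?z] by auto
    moreover have "set v = insert (last v) (set (butlast v))"
      using ne by (metis append_butlast_last_id list.simps(15) rotate1.simps(2) set_rotate1)
    ultimately show ?thesis using ly by (simp add: half_plane_iff)
  qed
  have "v @ run (last v) (1, 0) k \<in> saws half_plane"
    by (rule run_in_saws[OF vs]) (use fresh in auto)
  moreover have "last (v @ run (last v) (1, 0) k) = last (last v # run (last v) (1, 0) k)"
    using ne by (simp add: last_append)
  then have "v @ run (last v) (1, 0) k \<in> {u. fst (last u) = M}"
    unfolding last_run using lx by (simp add: k_def)
  ultimately show ?thesis
    using lx by (intro hit_extension_ge[OF lam _ _ ne]) (auto simp: k_def)
qed

text \<open>A box contains only finitely many self-avoiding walks, so finite visits within a bounded
  range of columns force the height to be unbounded, and every new height is first attained at a top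
  record.\<close>

lemma top_records_visited:
  assumes X: "tree_path half_plane X" and fin: "finite_visits X"
    and bd: "\<And>n. \<bar>fst (last (X n))\<bar> < M"
  shows "infinite {n. X n \<in> top_records M}"
proof
  assume f: "finite {n. X n \<in> top_records M}"
  then have "finite ((\<lambda>n. snd (last (X n))) ` {n. X n \<in> top_records M})" by simp
  then obtain N where N: "\<And>n. X n \<in> top_records M \<Longrightarrow> snd (last (X n)) \<le> N"
    by (metis (no_types, lifting) Max_ge image_eqI mem_Collect_eq)
  have sites: "\<bar>fst p\<bar> < M" if p: "p \<in> set (X n)" for p n
  proof -
    obtain m where "last (X m) = p"
      using tree_path_site_visited[OF X p, of "\<lambda>r. r = p"] by auto
    then show ?thesis using bd[of m] by simp
  qed
  have "\<exists>n. \<exists>p\<in>set (X n). snd p > N"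
  proof (rule ccontr)
    assume no: "\<not> ?thesis"
    let ?A = "{w \<in> saws half_plane. set w \<subseteq> {-M..M} \<times> {0..N}}"
    have "X n \<in> ?A" for n
    proof -
      have "p \<in> {-M..M} \<times> {0..N}" if p: "p \<in> set (X n)" for p
      proof -
        have "snd p \<ge> 0" by (rule saws_half_plane_site[OF tree_path_saws[OF X] p])
        moreover have "snd p \<le> N" using no p not_less by blast
        ultimately show ?thesis using sites[OF p] by (cases p) auto
      qed
      then show ?thesis using tree_path_saws[OF X] by blast
    qed
    then have "{n. X n \<in> ?A} = UNIV" by blast
    moreover have "finite {n. X n \<in> ?A}"
      by (rule finite_visits_finite_set[OF fin]) (rule finite_saws_subset, simp)
    ultimately show False by simp
  qed
  then obtain n p where np: "p \<in> set (X n)" "snd p > N" by blast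
  obtain m where q: "snd (last (X m)) > N" "\<forall>r\<in>set (butlast (X m)). \<not> snd r > N"
    using tree_path_site_visited[OF X np(1), of "\<lambda>r. snd r > N"] np(2) by blast
  have "X m \<in> top_records M"
    using q tree_path_saws[OF X, of m] sites[of _ m] unfolding top_records_def by fastforce
  then show False using N[of m] q(1) by simp
qed

text \<open>If all columns stayed below \<open>M\<close> in absolute value, there would be
  infinitely many top records, and these would force a visit to column \<open>M\<close>.\<close>

lemma AE_half_plane_wide:
  assumes lam: "lam > 0"
  shows "AE X in RWs half_plane lam root. finite {n. X n = root} \<longrightarrow> (\<forall>M. \<exists>n. \<bar>fst (last (X n))\<bar> \<ge> M)"
proof -
  have G: "half_plane \<in> {UNIV, half_plane}" by simp
  have "AE X in RWs half_plane lam root. \<forall>M. infinite {n. X n \<in> top_records M} \<longrightarrow> infinite {n. X n \<in> {u. fst (last u) = M}}"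
    unfolding AE_all_countable
    by (intro allI AE_markov_recurrent_target[OF top_record_hits[OF lam] min_step_power_pos[OF lam]])
  with AE_vertex_then_root[OF lam G] AE_tree_path[OF lam G] show ?thesis
  proof eventually_elim
    case (elim X)
    show ?case
    proof (intro impI allI, rule ccontr)
      fix M assume fr: "finite {n. X n = root}" and "\<nexists>n. M \<le> \<bar>fst (last (X n))\<bar>"
      then have bd: "\<bar>fst (last (X n))\<bar> < M" for n by (meson not_less)
      have "infinite {n. X n \<in> top_records M}"
        by (rule top_records_visited) (use elim fr bd in auto)
      then have "infinite {n. X n \<in> {u. fst (last u) = M}}" using elim by blast
      then obtain n where "fst (last (X n)) = M" using not_finite_existsD by blast
      then show False using bd[of n] by simp
    qed
  qed
qed

section \<open>Return to the boundary line from lateral records\<close>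

definition side_records :: "site list set" where
  "side_records = {v \<in> saws half_plane. \<forall>p\<in>set (butlast v). \<bar>fst p\<bar> < \<bar>fst (last v)\<bar>}"

lemma side_records_visited:
  assumes X: "tree_path half_plane X" and w: "\<And>M. \<exists>n. \<bar>fst (last (X n))\<bar> \<ge> M"
  shows "infinite {n. X n \<in> side_records}"
proof
  assume f: "finite {n. X n \<in> side_records}"
  then have "finite ((\<lambda>n. \<bar>fst (last (X n))\<bar>) ` {n. X n \<in> side_records})" by simp
  then obtain N where N: "\<And>n. X n \<in> side_records \<Longrightarrow> \<bar>fst (last (X n))\<bar> \<le> N"
    by (metis (no_types, lifting) Max_ge image_eqI mem_Collect_eq)
  obtain n where n: "\<bar>fst (last (X n))\<bar> \<ge> N + 1" using w by blast
  have l: "last (X n) \<in> set (X n)" by (rule last_in_saw[OF tree_path_saws[OF X]])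
  obtain m where q: "\<bar>fst (last (X m))\<bar> \<ge> N + 1" "\<forall>r\<in>set (butlast (X m)). \<not> \<bar>fst r\<bar> \<ge> N + 1"
    using tree_path_site_visited[OF X l, of "\<lambda>r. \<bar>fst r\<bar> \<ge> N + 1"] n by blast
  have "X m \<in> side_records"
    using q tree_path_saws[OF X, of m] unfolding side_records_def by fastforce
  then show False using N[of m] q(1) by simp
qed

definition up_vertex :: "site list" where
  "up_vertex = [(0, 0), (0, 1)]"

lemma up_vertex_saws: "up_vertex \<in> saws half_plane"
  by (simp add: up_vertex_def saws_def half_plane_def nbr_def)

lemma up_vertex_child: "up_vertex \<in> children half_plane root"
  using up_vertex_saws by (simp add: children_def up_vertex_def root_def)

lemma up_vertex_succ_root: "up_vertex \<in> set_pmf (RW_step half_plane lam root)"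
proof -
  have "children half_plane root \<noteq> {}" using up_vertex_child by blast
  then have "set_pmf (RW_step half_plane lam root) = children half_plane root"
    by (simp add: RW_step_def finite_children)
  then show ?thesis using up_vertex_child by simp
qed

definition side :: "int \<Rightarrow> site list set" where
  "side a = {v. v \<noteq> [] \<and> fst (last v) = a}"

text \<open>All sites of the walk are confined to the columns between \<open>- a\<close> and
  \<open>a\<close>, and not only its endpoint: the whole rotated copy used in
  \<open>right_record_hits_line\<close> then fits above the line.\<close>

definition slab :: "int \<Rightarrow> site list set" where
  "slab a = {v \<in> saws half_plane. snd (last v) \<ge> 1 \<and> (\<forall>p\<in>set v. \<bar>fst p\<bar> < a)}"

lemma reaches_side_reflect:
  assumes lam: "lam > 0"
  shows "emeasure (RWs half_plane lam up_vertex) {X. reaches (side a) (slab \<bar>a\<bar>) X} \<le>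
    emeasure (RWs half_plane lam up_vertex) {X. reaches (side (- a)) (slab \<bar>a\<bar>) X}"
proof -
  have "emeasure (RWs half_plane lam up_vertex) {X. reaches (side a) (slab \<bar>a\<bar>) X} \<le>
    emeasure (RWs half_plane lam (map reflect up_vertex)) {X. reaches (side (- a)) (slab \<bar>a\<bar>) X}"
  proof (rule emeasure_reaches_transfer)
    show "map reflect ` side a \<subseteq> side (- a)"
      by (auto simp: side_def last_map reflect_def)
    show "map reflect ` slab \<bar>a\<bar> \<subseteq> slab \<bar>a\<bar>"
      proof
      fix u assume "u \<in> map reflect ` slab \<bar>a\<bar>"
      then obtain v where v: "u = map reflect v" "v \<in> saws half_plane" "1 \<le> snd (last v)" "\<forall>p\<in>set v. \<bar>fst p\<bar> < \<bar>a\<bar>"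
        unfolding slab_def by blast
      then show "u \<in> slab \<bar>a\<bar>"
        using map_reflect_saws[of half_plane v] by (auto simp: slab_def last_map reflect_def saws_not_Nil)
    qed
    fix v assume v: "v \<in> slab \<bar>a\<bar>"
    then show "RW_step half_plane lam (map reflect v) = map_pmf (map reflect) (RW_step half_plane lam v)"
      by (intro RW_step_reflect lam) (auto simp: slab_def)
  qed
  then show ?thesis by (simp add: up_vertex_def reflect_def)
qed

text \<open>Consider the first time at which the endpoint is at distance at least \<open>a\<close>
  from the axis. Sites are added only as endpoints, so all earlier walks lie inside the slab; and as
  a step changes the column by at most 1, the endpoint is then exactly in column \<open>a\<close> or
  \<open>- a\<close>.\<close>

lemma first_side_visit:
  assumes X: "\<And>n. X n \<in> saws half_plane \<and> tree_step half_plane (X n) (X (Suc n))" "X 0 = up_vertex"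
    and off: "\<And>n. X n \<notin> line" and n: "\<bar>fst (last (X n))\<bar> \<ge> a" and a: "a \<ge> 1"
  shows "reaches (side a) (slab a) X \<or> reaches (side (- a)) (slab a) X"
proof -
  let ?P = "\<lambda>n. \<bar>fst (last (X n))\<bar> \<ge> a"
  define m where "m = (LEAST n. ?P n)"
  have m: "?P m" unfolding m_def using n by (rule LeastI)
  have lt: "\<not> ?P i" if "i < m" for i using that not_less_Least unfolding m_def by blast
  have sites: "\<forall>p\<in>set (X i). \<bar>fst p\<bar> < a" if "i < m" for i
    using that
  proof (induction i)
    case 0
    then show ?case using X(2) a by (simp add: up_vertex_def)
  next
    case (Suc i)
    have IH: "\<forall>p\<in>set (X i). \<bar>fst p\<bar> < a" using Suc by simp
    have l: "\<bar>fst (last (X (Suc i)))\<bar> < a" using lt[OF Suc.prems] by simp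
    have "tree_step half_plane (X i) (X (Suc i))" using X by simp
    then show ?case
      unfolding tree_step_def
    proof (elim disjE conjE)
      assume "X (Suc i) \<in> children half_plane (X i)"
      then obtain v where "X (Suc i) = X i @ [v]" by (auto simp: children_def)
      then show ?thesis using IH l by auto
    next
      assume "X (Suc i) = parent (X i)"
      then show ?thesis using IH by (auto simp: parent_def dest: in_set_butlastD)
    qed
  qed
  have slab: "X i \<in> slab a" if "i < m" for i
  proof -
    have "snd (last (X i)) \<ge> 0" using X(1)[of i] last_saws_half_plane by blast
    moreover have "snd (last (X i)) \<noteq> 0" using off[of i] by (simp add: line_def)
    ultimately show ?thesis using sites[OF that] X(1)[of i] by (simp add: slab_def)
  qed
  have "\<bar>fst (last (X m))\<bar> = a"
  proof (cases m)
    case 0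
    then show ?thesis using m X(2) a by (simp add: up_vertex_def)
  next
    case (Suc i)
    have IH: "\<forall>p\<in>set (X i). \<bar>fst p\<bar> < a" by (rule sites) (simp add: Suc)
    have "tree_step half_plane (X i) (X m)" using X Suc by simp
    then show ?thesis
      unfolding tree_step_def
    proof (elim disjE conjE)
      assume "X m \<in> children half_plane (X i)"
      then obtain v where v: "X m = X i @ [v]" by (auto simp: children_def)
      have "nbr (last (X i)) v" using X(1)[of m] v X(1)[of i] saws_snoc[of "X i" v] saws_not_Nil by auto
      moreover have "\<bar>fst (last (X i))\<bar> < a" using IH X(1)[of i] last_in_saw by blast
      ultimately show ?thesis using m v by (auto simp: nbr_def)
    next
      assume p: "X m = parent (X i)"
      have "last (X m) \<in> set (X i)"
        using p X(1)[of m] saws_not_Nil[of "X m"] by (metis in_set_butlastD last_in_set parent_def)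
      then show ?thesis using IH m by fastforce
    qed
  qed
  then have "X m \<in> side a \<or> X m \<in> side (- a)"
    using X(1)[of m] saws_not_Nil by (auto simp: side_def)
  then show ?thesis unfolding reaches_def using slab by blast
qed

text \<open>A trajectory avoiding the line almost surely has unbounded horizontal extent, hence
  leaves the slab on the left or on the right, and the reflection compares the two sides.\<close>

lemma AE_up_vertex_side:
  assumes lam: "lam > 0" and a: "a \<ge> 1"
  shows "emeasure (RWs half_plane lam up_vertex) {X. \<forall>n. X n \<notin> line} \<le>
    2 * emeasure (RWs half_plane lam up_vertex) {X. reaches (side (- a)) (slab a) X}"
proof -
  let ?M = "RWs half_plane lam up_vertex"
  have G: "half_plane \<in> {UNIV, half_plane}" by simp
  \<comment> \<open>The root lies on the line, so for the chain from the root avoidance is required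
    only from time 1. The null event then passes to \<open>R\<close> for the chain from
    \<open>up_vertex\<close>.\<close>
  define J where "J X \<longleftrightarrow> (\<forall>n. X (Suc n) \<notin> line) \<and> (\<forall>n. X n \<notin> {v. \<bar>fst (last v)\<bar> \<ge> a})" for X :: "nat \<Rightarrow> site list"
  define R where "R X \<longleftrightarrow> (\<forall>n. X n \<notin> line) \<and> (\<forall>n. X n \<notin> {v. \<bar>fst (last v)\<bar> \<ge> a})" for X :: "nat \<Rightarrow> site list"
  have J: "path_event J" unfolding J_def by (intro path_event_intros)
  have R: "path_event R" unfolding R_def by (intro path_event_intros)
  have "AE X in RWs half_plane lam root. \<not> J X"
    using AE_half_plane_wide[OF lam]
  proof eventually_elim
    case (elim X)
    show ?case
    proof
      assume JX: "J X"
      have "X n = root \<Longrightarrow> n = 0" for n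
      proof (cases n)
        case (Suc k)
        assume "X n = root"
        then have "X (Suc k) \<in> line" using Suc by (simp add: line_def root_def)
        then show ?thesis using JX unfolding J_def by blast
      qed
      then have "{n. X n = root} \<subseteq> {0}" by blast
      then have "finite {n. X n = root}" using finite_subset by blast
      with elim obtain n where "\<bar>fst (last (X n))\<bar> \<ge> a" by blast
      then show False using JX by (simp add: J_def)
    qed
  qed
  then have "emeasure (RWs half_plane lam root) {X. J X} = 0"
    unfolding AE_markov_iff[OF path_event_not[OF J]] by simp
  then have null: "emeasure ?M {X. R X} = 0"
  proof (rule emeasure_markov_null_succ[OF J _ R])
    fix X :: "nat \<Rightarrow> site list" assume RX: "R X"
    have "case_nat root X n \<notin> {v. \<bar>fst (last v)\<bar> \<ge> a}" for n
      using RX a unfolding R_def by (cases n) (simp_all add: root_def)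
    then show "J (case_nat root X)"
      using RX unfolding J_def R_def by simp
  qed (rule up_vertex_succ_root)
  have "emeasure ?M {X. \<forall>n. X n \<notin> line} \<le>
      emeasure ?M ({X. R X} \<union> ({X. reaches (side a) (slab a) X} \<union> {X. reaches (side (- a)) (slab a) X}))"
  proof (rule emeasure_mono_AE)
    show "{X. R X} \<union> ({X. reaches (side a) (slab a) X} \<union> {X. reaches (side (- a)) (slab a) X}) \<in> sets ?M"
      by (intro sets.Un path_event_markov_set R path_event_reaches)
    show "AE X in ?M. X \<in> {X. \<forall>n. X n \<notin> line} \<longrightarrow>
      X \<in> {X. R X} \<union> ({X. reaches (side a) (slab a) X} \<union> {X. reaches (side (- a)) (slab a) X})"
      using AE_RW_tree_steps[OF lam G up_vertex_saws]
    proof eventually_elim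
      case (elim X)
      show ?case
      proof
        assume "X \<in> {X. \<forall>n. X n \<notin> line}"
        then have off: "\<And>n. X n \<notin> line" by simp
        show "X \<in> {X. R X} \<union> ({X. reaches (side a) (slab a) X} \<union> {X. reaches (side (- a)) (slab a) X})"
        proof (cases "R X")
          case False
          then obtain n where "\<bar>fst (last (X n))\<bar> \<ge> a" using off unfolding R_def by blast
          with first_side_visit[where X = X and n = n and a = a] elim off a show ?thesis by blast
        qed simp
      qed
    qed
  qed
  also have "\<dots> \<le> emeasure ?M {X. R X} + (emeasure ?M {X. reaches (side a) (slab a) X} + emeasure ?M {X. reaches (side (- a)) (slab a) X})"
    by (intro order_trans[OF emeasure_subadditive] add_left_mono emeasure_subadditive sets.Un
        path_event_markov_set R path_event_reaches)
  also have "\<dots> \<le> 0 + (emeasure ?M {X. reaches (side (- a)) (slab a) X} + emeasure ?M {X. reaches (side (- a)) (slab a) X})"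
    using null reaches_side_reflect[OF lam, of a] a by (intro add_mono) simp_all
  finally show ?thesis by (simp add: mult_2)
qed

text \<open>Swaps the coordinates and translates, so that the half-plane is carried to the
  half-plane to the right of \<open>p\<close> and the origin to the right neighbour of
  \<open>p\<close>.\<close>

definition rotate_to :: "site \<Rightarrow> site \<Rightarrow> site" where
  "rotate_to p q = (fst p + 1 + snd q, snd p + fst q)"

lemma isometry_rotate_to: "isometry (rotate_to p)"
  unfolding isometry_def
proof (intro conjI allI)
  show "bij (rotate_to p)"
    by (rule o_bij[of "\<lambda>q. (snd q - snd p, fst q - fst p - 1)"]) (auto simp: rotate_to_def fun_eq_iff)
qed (auto simp: rotate_to_def nbr_def)

lemma right_record_hits_line:
  assumes lam: "lam > 0" and v: "v \<in> side_records" and x: "fst (last v) \<ge> 0" and y: "snd (last v) \<ge> 1"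
  shows "ennreal (min_step lam) ^ 2 * (emeasure (RWs half_plane lam up_vertex) {X. \<forall>n. X n \<notin> line} / 2)
    \<le> emeasure (RWs half_plane lam v) {X. \<exists>n. X n \<in> line}"
proof -
  have G: "half_plane \<in> {UNIV, half_plane}" by simp
  define a where "a = snd (last v)"
  let ?\<psi> = "rotate_to (last v)"
  let ?\<phi> = "\<lambda>\<tau>. v @ map ?\<psi> \<tau>"
  have vs: "v \<in> saws half_plane" using v by (simp add: side_records_def)
  have ne: "v \<noteq> []" by (rule saws_not_Nil[OF vs])
  have vx: "fst p \<le> fst (last v)" if "p \<in> set v" for p
  proof (cases "p = last v")
    case False
    then have "p \<in> set (butlast v)" using that ne by (metis append_butlast_last_id in_set_conv_decomp rotate1.simps(2) set_ConsD set_rotate1)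
    then show ?thesis using v x by (auto simp: side_records_def)
  qed simp
  have out: "?\<psi> q \<notin> set v" if "snd q \<ge> 0" for q
    using vx[of "?\<psi> q"] that by (auto simp: rotate_to_def)
  have emb: "?\<phi> \<tau> \<in> saws half_plane" if "\<tau> \<in> saws half_plane" "\<And>p. p \<in> set \<tau> \<Longrightarrow> fst p \<ge> - a" for \<tau>
  proof (rule embedding_in_saws[OF vs isometry_rotate_to _ that(1)])
    show "nbr (last v) (?\<psi> (0, 0))" by (simp add: rotate_to_def nbr_def)
    have pos: "snd p \<ge> 0" if "p \<in> set \<tau>" for p
      using that \<open>\<tau> \<in> saws half_plane\<close> saws_half_plane_site by blast
    show "?\<psi> ` set \<tau> \<subseteq> half_plane"
      using that(2) by (auto simp: rotate_to_def half_plane_iff a_def dest!: that(2))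
    show "?\<psi> ` set \<tau> \<inter> set v = {}" using out pos by blast
  qed
  have "emeasure (RWs half_plane lam up_vertex) {X. reaches (side (- a)) (slab a) X} \<le>
      emeasure (RWs half_plane lam (?\<phi> up_vertex)) {X. reaches line UNIV X}"
  proof (rule emeasure_reaches_transfer)
    show "?\<phi> ` side (- a) \<subseteq> line"
      by (auto simp: side_def line_def last_map rotate_to_def a_def)
    show "?\<phi> ` slab a \<subseteq> UNIV" by simp
    fix \<tau> assume \<tau>: "\<tau> \<in> slab a"
    have \<tau>s: "\<tau> \<in> saws half_plane" and \<tau>y: "snd (last \<tau>) \<ge> 1" and \<tau>x: "\<And>p. p \<in> set \<tau> \<Longrightarrow> \<bar>fst p\<bar> < a"
      using \<tau> by (auto simp: slab_def)
    have \<tau>ne: "\<tau> \<noteq> []" by (rule saws_not_Nil[OF \<tau>s])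
    have lx: "\<bar>fst (last \<tau>)\<bar> < a" using \<tau>x \<tau>ne by simp
    show "RW_step half_plane lam (?\<phi> \<tau>) = map_pmf ?\<phi> (RW_step half_plane lam \<tau>)"
    proof (rule RW_step_embedding[OF lam isometry_rotate_to \<tau>s])
      show "\<tau> \<noteq> root" using \<tau>y by (auto simp: root_def)
      show "?\<phi> \<tau> \<in> saws half_plane" using \<tau>x by (intro emb[OF \<tau>s]) force
      have "length (?\<phi> \<tau>) \<ge> 2" using ne \<tau>ne by (cases v; cases \<tau>) auto
      moreover have "length root = 1" by (simp add: root_def)
      ultimately show "?\<phi> \<tau> \<noteq> root" by force
      fix z assume z: "nbr (last \<tau>) z"
      have "snd z \<ge> 0" "fst z \<ge> - a" using z \<tau>y lx by (auto simp: nbr_def)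
      then show "z \<in> half_plane \<longleftrightarrow> ?\<psi> z \<in> half_plane \<and> ?\<psi> z \<notin> set v"
        using out by (auto simp: half_plane_iff rotate_to_def a_def)
    qed
  qed
  also have "\<dots> \<le> emeasure (RWs half_plane lam (?\<phi> up_vertex)) {X. \<exists>n. X n \<in> line}"
    by (rule reaches_le_hit)
  finally have r: "emeasure (RWs half_plane lam up_vertex) {X. reaches (side (- a)) (slab a) X} \<le>
      emeasure (RWs half_plane lam (?\<phi> up_vertex)) {X. \<exists>n. X n \<in> line}" .
  have "emeasure (RWs half_plane lam up_vertex) {X. \<forall>n. X n \<notin> line} / 2 \<le>
      emeasure (RWs half_plane lam up_vertex) {X. reaches (side (- a)) (slab a) X}"
    using AE_up_vertex_side[OF lam, of a] y by (intro divide_le_posI_ennreal) (simp_all add: a_def)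
  also note r
  finally have "ennreal (min_step lam) ^ 2 * (emeasure (RWs half_plane lam up_vertex) {X. \<forall>n. X n \<notin> line} / 2)
     \<le> ennreal (min_step lam) ^ 2 * emeasure (RWs half_plane lam (?\<phi> up_vertex)) {X. \<exists>n. X n \<in> line}"
    by (rule mult_left_mono) simp
  also have "\<dots> \<le> emeasure (RWs half_plane lam v) {X. \<exists>n. X n \<in> line}"
  proof -
    have "?\<phi> up_vertex \<in> saws half_plane"
      using y by (intro emb[OF up_vertex_saws]) (auto simp: up_vertex_def a_def)
    from hit_extension[OF lam G this ne, of line] show ?thesis
      by (simp add: up_vertex_def numeral_2_eq_2)
  qed
  finally show ?thesis .
qed

text \<open>On the line the hit is immediate, and a left record is the mirror image of a right
  one.\<close>

lemma side_record_hits_line: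
  assumes lam: "lam > 0" and v: "v \<in> side_records"
  shows "ennreal (min_step lam) ^ 2 * (emeasure (RWs half_plane lam up_vertex) {X. \<forall>n. X n \<notin> line} / 2)
    \<le> emeasure (RWs half_plane lam v) {X. \<exists>n. X n \<in> line}"
proof -
  have G: "half_plane \<in> {UNIV, half_plane}" by simp
  have vs: "v \<in> saws half_plane" using v by (simp add: side_records_def)
  have ne: "v \<noteq> []" by (rule saws_not_Nil[OF vs])
  have ly: "snd (last v) \<ge> 0" using last_saws_half_plane[OF vs] .
  consider "snd (last v) = 0" | "snd (last v) \<ge> 1" "fst (last v) \<ge> 0" | "snd (last v) \<ge> 1" "fst (last v) < 0"
    using ly by linarith
  then show ?thesis
  proof cases
    case 1
    then have "emeasure (RWs half_plane lam v) {X. \<exists>n. X n \<in> line} = 1"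
      by (intro hit_self) (simp add: line_def)
    moreover have "ennreal (min_step lam) ^ 2 * (emeasure (RWs half_plane lam up_vertex) {X. \<forall>n. X n \<notin> line} / 2) \<le> 1 * 1"
    proof (rule mult_mono)
      show "ennreal (min_step lam) ^ 2 \<le> 1"
        using min_step_le_1[of lam] by (intro power_le_one) (simp_all flip: ennreal_1 add: ennreal_leI)
      have "emeasure (RWs half_plane lam up_vertex) {X. \<forall>n. X n \<notin> line} \<le> 2 * 1"
        by (rule order_trans[OF emeasure_markov_le_1]) simp
      then show "emeasure (RWs half_plane lam up_vertex) {X. \<forall>n. X n \<notin> line} / 2 \<le> 1"
        by (intro divide_le_posI_ennreal) simp_all
    qed simp_all
    ultimately show ?thesis by simp
  next
    case 2
    then show ?thesis by (intro right_record_hits_line[OF lam v])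
  next
    case 3
    let ?r = "map reflect v"
    have rs: "?r \<in> saws half_plane" by (rule map_reflect_saws[OF G vs])
    have "?r \<in> side_records"
      using v rs by (auto simp: side_records_def map_butlast[symmetric] last_map ne reflect_def)
    then have "ennreal (min_step lam) ^ 2 * (emeasure (RWs half_plane lam up_vertex) {X. \<forall>n. X n \<notin> line} / 2)
      \<le> emeasure (RWs half_plane lam ?r) {X. \<exists>n. X n \<in> line}"
      using 3 ne by (intro right_record_hits_line[OF lam]) (simp_all add: last_map reflect_def)
    also have "\<dots> \<le> emeasure (RWs half_plane lam (map reflect ?r)) {X. \<exists>n. X n \<in> line}"
    proof (rule hit_reflect[OF G lam rs])
      show "map reflect ` line \<subseteq> line"
      proof
        fix u assume "u \<in> map reflect ` line"
        then obtain w where "u = map reflect w" "snd (last w) = 0" by (auto simp: line_def)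
        then show "u \<in> line" by (cases "w = []") (auto simp: line_def last_map reflect_def)
      qed
    qed
    also have "map reflect ?r = v" by (rule map_reflect_map_reflect)
    finally show ?thesis .
  qed
qed

text \<open>
  If the walk avoided the boundary line with positive probability, then by the reflection
  symmetry it would, from every lateral record, hit the boundary line with a probability that is
  bounded below, because the half-plane beyond the record is fresh.
\<close>

theorem half_plane_hits_line:
  assumes lam: "lam > 0"
  shows "emeasure (RWs half_plane lam up_vertex) {X. \<forall>n. X n \<notin> line} = 0"
proof (rule ccontr)
  let ?e = "emeasure (RWs half_plane lam up_vertex) {X. \<forall>n. X n \<notin> line}"
  assume "?e \<noteq> 0"
  then have "?e / 2 \<noteq> 0" by simp
  moreover have "ennreal (min_step lam) ^ 2 \<noteq> 0" using min_step_power_pos[OF lam, of 2] by (metis less_irrefl)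
  ultimately have pos: "0 < ennreal (min_step lam) ^ 2 * (?e / 2)"
    by (simp add: zero_less_iff_neq_zero)
  have G: "half_plane \<in> {UNIV, half_plane}" by simp
  have ev: "path_event (\<lambda>X. \<forall>n. X (Suc n) \<notin> line)" "path_event (\<lambda>X. \<forall>n. X n \<notin> line)"
    by (intro path_event_intros)+
  have rec: "AE X in RWs half_plane lam root. infinite {n. X n \<in> side_records} \<longrightarrow> infinite {n. X n \<in> line}"
    by (rule AE_markov_recurrent_target[OF side_record_hits_line[OF lam] pos])
  have "AE X in RWs half_plane lam root. \<not> (\<forall>n. X (Suc n) \<notin> line)"
    using rec AE_half_plane_wide[OF lam] AE_tree_path[OF lam G]
  proof eventually_elim
    case (elim X)
    show ?case
    proof
      assume off: "\<forall>n. X (Suc n) \<notin> line"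
      have off': "X n \<in> line \<Longrightarrow> n = 0" for n using off by (cases n) blast+
      then have sub: "{n. X n \<in> line} \<subseteq> {0}" by blast
      moreover have "{n. X n = root} \<subseteq> {n. X n \<in> line}" by (auto simp: line_def root_def)
      ultimately have "finite {n. X n \<in> line}" "finite {n. X n = root}"
        by (meson finite.emptyI finite.insertI finite_subset)+
      moreover from this have "infinite {n. X n \<in> side_records}"
        using elim by (intro side_records_visited) auto
      ultimately show False using elim by blast
    qed
  qed
  then have "emeasure (RWs half_plane lam root) {X. \<forall>n. X (Suc n) \<notin> line} = 0"
    unfolding AE_markov_iff[OF path_event_not[OF ev(1)]] by simp
  then have "?e = 0"
  proof (rule emeasure_markov_null_succ[OF ev(1) _ ev(2)])
    show "up_vertex \<in> set_pmf (RW_step half_plane lam root)"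
      by (rule up_vertex_succ_root)
  qed simp
  with \<open>?e \<noteq> 0\<close> show False by simp
qed

text \<open>Each step along \<open>zs\<close> has positive probability and starts off the line, so
  nullity is inherited from \<open>up_vertex\<close>.\<close>

lemma half_plane_hits_line_from:
  assumes lam: "lam > 0" and "(0, 0) # (0, 1) # zs \<in> saws half_plane" "\<forall>p\<in>set zs. snd p \<noteq> 0"
  shows "emeasure (RWs half_plane lam ((0, 0) # (0, 1) # zs)) {X. \<forall>n. X n \<notin> line} = 0"
  using assms(2,3)
proof (induction zs rule: rev_induct)
  case Nil
  then show ?case using half_plane_hits_line[OF lam] by (simp add: up_vertex_def)
next
  case (snoc z zs)
  have G: "half_plane \<in> {UNIV, half_plane}" by simp
  let ?v = "(0, 0) # (0, 1) # zs"
  have v: "?v \<in> saws half_plane" using saws_appendD[of ?v "[z]"] snoc.prems by simp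
  have "?v \<notin> line" using snoc.prems(2) by (auto simp: line_def)
  have ev: "path_event (\<lambda>X. \<forall>n. X n \<notin> line)" by (intro path_event_intros)
  have null: "emeasure (RWs half_plane lam ?v) {X. \<forall>n. X n \<notin> line} = 0"
    by (rule snoc.IH[OF v]) (use snoc.prems in auto)
  have "emeasure (RWs half_plane lam (?v @ [z])) {X. \<forall>n. X n \<notin> line} = 0"
  proof (rule emeasure_markov_null_succ[OF ev null ev])
    fix X :: "nat \<Rightarrow> site list" assume "\<forall>n. X n \<notin> line"
    then show "\<forall>n. case_nat ?v X n \<notin> line" using \<open>?v \<notin> line\<close> by (auto split: nat.splits)
  next
    have "tree_step half_plane ?v (?v @ [z])"
      using snoc.prems(1) by (simp add: tree_step_def children_def)
    from pmf_RW_step_ge[OF lam G v this] min_step_pos[OF lam]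
    show "?v @ [z] \<in> set_pmf (RW_step half_plane lam ?v)" by (simp add: set_pmf_iff)
  qed
  then show ?case by simp
qed

section \<open>Escape probabilities\<close>

lemma nn_integral_RW_step:
  assumes lam: "lam > 0" and u: "u \<noteq> root" and g: "\<And>y. 0 \<le> g y"
  shows "(\<integral>\<^sup>+y. ennreal (g y) \<partial>measure_pmf (RW_step G lam u)) =
    ennreal ((g (parent u) + lam * (\<Sum>c\<in>children G u. g c)) / (1 + real (card (children G u)) * lam))"
proof -
  let ?d = "1 + real (card (children G u)) * lam"
  let ?S = "insert (parent u) (children G u)"
  have d: "?d > 0" using lam by (intro add_pos_nonneg) auto
  have fin: "finite ?S" by (simp add: finite_children)
  have sp: "pmf (RW_step G lam u) y = step_prob G lam u y" for y
    by (rule pmf_RW_step[OF lam u])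
  have "set_pmf (RW_step G lam u) \<subseteq> ?S"
    by (auto simp: set_pmf_iff sp step_prob_def split: if_splits)
  then have "(\<integral>\<^sup>+y. ennreal (g y) \<partial>measure_pmf (RW_step G lam u)) = (\<Sum>y\<in>?S. ennreal (g y) * ennreal (pmf (RW_step G lam u) y))"
    using fin by (subst nn_integral_measure_pmf_support[of ?S]) (auto simp: set_pmf_iff)
  also have "\<dots> = ennreal (\<Sum>y\<in>?S. g y * step_prob G lam u y)"
    using g by (subst sum_ennreal[symmetric]) (auto simp: ennreal_mult sp[symmetric])
  also have "(\<Sum>y\<in>?S. g y * step_prob G lam u y) = g (parent u) / ?d + (\<Sum>c\<in>children G u. g c * step_prob G lam u c)"
    using parent_notin_children[of u G] by (simp add: finite_children step_prob_def)
  also have "(\<Sum>c\<in>children G u. g c * step_prob G lam u c) = (\<Sum>c\<in>children G u. lam / ?d * g c)"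
    using children_not_parent by (intro sum.cong) (auto simp: step_prob_def)
  also have "\<dots> = lam / ?d * (\<Sum>c\<in>children G u. g c)"
    by (rule sum_distrib_left[symmetric])
  finally show ?thesis by (simp add: add_divide_distrib)
qed

definition esc :: "site set \<Rightarrow> real \<Rightarrow> site list \<Rightarrow> ennreal" where
  "esc G lam v = emeasure (RWs G lam v) {X. \<forall>n. X n \<noteq> parent v}"

lemma esc_eq: "esc G lam v = 1 - emeasure (RWs G lam v) {X. \<exists>n. X n \<in> {parent v}}"
proof -
  have "esc G lam v = emeasure (RWs G lam v) {X. \<not> (\<exists>n. X n \<in> {parent v})}"
    by (simp add: esc_def)
  also have "\<dots> = 1 - emeasure (RWs G lam v) {X. \<exists>n. X n \<in> {parent v}}"
    by (rule emeasure_markov_compl) (intro path_event_intros)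
  finally show ?thesis .
qed

lemma steps_stay_below:
  assumes X: "\<And>n. X n \<in> saws G \<and> tree_step G (X n) (X (Suc n))" "X 0 = v"
    and "\<forall>i<m. X i \<noteq> parent v"
  shows "\<forall>i<m. prefix v (X i)"
proof (intro allI impI)
  fix i show "i < m \<Longrightarrow> prefix v (X i)"
  proof (induction i)
    case (Suc i)
    have IH: "prefix v (X i)" using Suc by simp
    have "tree_step G (X i) (X (Suc i))" using X by simp
    then show ?case
      unfolding tree_step_def
    proof (elim disjE conjE)
      assume "X (Suc i) \<in> children G (X i)"
      then show ?thesis using IH by (auto simp: children_def prefix_def)
    next
      assume p: "X (Suc i) = parent (X i)"
      then have "X i \<noteq> v" using assms(3) Suc.prems by metis
      then show ?thesis using IH p
        by (metis append_butlast_last_id butlast.simps(1) parent_def prefix_Nil prefix_snoc)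
    qed
  qed (simp add: X(2))
qed

text \<open>
  A subsolution \<open>f\<close> of the recursion for the escape probabilities yields the superharmonic
  function \<open>\<Prod> (1 - f)\<close>, the product being taken along the ancestors below \<open>v\<close>.
\<close>

lemma esc_ge:
  assumes lam: "lam > 0" and G: "G \<in> {UNIV, half_plane}" and v: "v \<in> saws G" "v \<noteq> root"
    and f: "\<And>u. 0 \<le> f u" "\<And>u. f u < (1 :: real)"
    and sub: "\<And>u. u \<in> saws G \<Longrightarrow> prefix v u \<Longrightarrow> f u \<le> (1 - f u) * lam * (\<Sum>c\<in>children G u. f c)"
  shows "ennreal (f v) \<le> esc G lam v"
proof -
  define l where "l = length v"
  \<comment> \<open>The index starts at \<open>length v\<close>, so the factor of \<open>v\<close>
    itself is included and \<open>h v\<close> becomes \<open>1 - f v\<close>.\<close>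
  define P where "P u = (\<Prod>k=l..length u. 1 - f (take k u))" for u :: "site list"
  \<comment> \<open>Equal to 1 outside the subtree of \<open>v\<close>, in particular at the target
    \<open>parent v\<close>.\<close>
  define h where "h u = (if prefix v u then P u else 1)" for u
  have P0: "0 \<le> P u" for u unfolding P_def using f(2) by (intro prod_nonneg) (auto simp: less_imp_le)
  have h0: "0 \<le> h u" for u using P0 by (simp add: h_def)
  have Psnoc: "P (u @ [z]) = P u * (1 - f (u @ [z]))" if "prefix v u" for u z
  proof -
    have "l \<le> Suc (length u)" using prefix_length_le[OF that] by (simp add: l_def)
    then have "P (u @ [z]) = (\<Prod>k=l..length u. 1 - f (take k (u @ [z]))) * (1 - f (u @ [z]))"
      by (simp add: P_def)
    also have "(\<Prod>k=l..length u. 1 - f (take k (u @ [z]))) = P u"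
      unfolding P_def by (intro prod.cong) auto
    finally show ?thesis .
  qed
  have vne: "v \<noteq> []" by (rule saws_not_Nil[OF v(1)])
  have npar: "\<not> prefix v (parent v)"
    using vne prefix_length_le[of v "parent v"] by (cases v rule: rev_cases) (auto simp: parent_def)
  have "emeasure (RWs G lam v) {X. \<exists>n. X n \<in> {parent v}} =
      emeasure (RWs G lam v) {X. reaches {parent v} {u \<in> saws G. prefix v u} X}"
  proof (rule emeasure_eq_AE)
    show "{X. \<exists>n. X n \<in> {parent v}} \<in> sets (RWs G lam v)"
      by (intro path_event_markov_set path_event_intros)
    show "{X. reaches {parent v} {u \<in> saws G. prefix v u} X} \<in> sets (RWs G lam v)"
      by (intro path_event_markov_set path_event_reaches)
    show "AE X in RWs G lam v. X \<in> {X. \<exists>n. X n \<in> {parent v}} \<longleftrightarrow> X \<in> {X. reaches {parent v} {u \<in> saws G. prefix v u} X}"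
      using AE_RW_tree_steps[OF lam G v(1)]
    proof eventually_elim
      case (elim X)
      show ?case
      proof
        assume "X \<in> {X. \<exists>n. X n \<in> {parent v}}"
        then have ex: "\<exists>n. X n = parent v" by simp
        define m where "m = (LEAST n. X n = parent v)"
        have "X m = parent v" unfolding m_def using ex by (rule LeastI_ex)
        moreover have "\<forall>i<m. X i \<noteq> parent v" using not_less_Least unfolding m_def by blast
        then have "\<forall>i<m. prefix v (X i)" by (intro steps_stay_below[of X G]) (use elim in auto)
        ultimately show "X \<in> {X. reaches {parent v} {u \<in> saws G. prefix v u} X}"
          using elim unfolding reaches_def by blast
      next
        assume "X \<in> {X. reaches {parent v} {u \<in> saws G. prefix v u} X}"
        then show "X \<in> {X. \<exists>n. X n \<in> {parent v}}" unfolding reaches_def by blast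
      qed
    qed
  qed
  also have "\<dots> \<le> ennreal (h v)"
  proof (rule emeasure_reaches_le[where h = "\<lambda>u. ennreal (h u)"])
    fix u assume "u \<in> {parent v}"
    then show "1 \<le> ennreal (h u)" using npar by (simp add: h_def)
  next
    fix u assume "u \<in> {u \<in> saws G. prefix v u}"
    then have u: "u \<in> saws G" "prefix v u" by auto
    have une: "u \<noteq> root"
      using u(2) v vne unfolding root_def by (metis prefix_Cons prefix_Nil root_def)
    let ?k = "real (card (children G u))"
    let ?S = "\<Sum>c\<in>children G u. f c"
    have d: "1 + ?k * lam > 0" using lam by (intro add_pos_nonneg) auto
    have hpar: "h (parent u) * (1 - f u) = h u"
    proof (cases "u = v")
      case True
      then show ?thesis using npar vne by (simp add: h_def P_def l_def)
    next
      case False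
      then have p: "prefix v (parent u)"
        using u(2) by (metis append_butlast_last_id butlast.simps(1) parent_def prefix_Nil prefix_snoc)
      then show ?thesis
        using Psnoc[OF p, of "last u"] saws_snoc_parent[OF u(1)] u(2) by (simp add: h_def)
    qed
    have hc: "h c = h u * (1 - f c)" if c: "c \<in> children G u" for c
    proof -
      obtain z where "c = u @ [z]" using c by (auto simp: children_def)
      moreover have "prefix v (u @ [z])" using u(2) by simp
      ultimately show ?thesis using Psnoc[OF u(2), of z] u(2) by (simp add: h_def)
    qed
    have "(\<Sum>c\<in>children G u. h c) = h u * (?k - ?S)"
      by (simp add: hc sum_distrib_left[symmetric] sum_subtractf)
    then have "lam * (\<Sum>c\<in>children G u. h c) = h u * ?k * lam - h u * (lam * ?S)"
      by (simp only: right_diff_distrib mult_ac)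
    moreover have "h (parent u) \<le> h u * (1 + lam * ?S)"
    proof -
      \<comment> \<open>The true escape probabilities satisfy e(u) = (1 - e(u)) \<lambda> S, with S
        the sum of e over the children of u. The inequality \<open>sub\<close> is brought into the
        multiplicative form that makes \<open>h\<close> superharmonic at \<open>u\<close>.\<close>
      have "1 \<le> (1 - f u) * (1 + lam * ?S)" using sub[OF u] by (simp add: algebra_simps)
      then have "h (parent u) * 1 \<le> h (parent u) * ((1 - f u) * (1 + lam * ?S))"
        by (rule mult_left_mono) (rule h0)
      then show ?thesis unfolding hpar[symmetric] by (simp add: mult.assoc)
    qed
    ultimately have "h (parent u) + lam * (\<Sum>c\<in>children G u. h c) \<le> h u * (1 + ?k * lam)"
      by (simp only: distrib_left mult_1_right mult.assoc)
    then have "(h (parent u) + lam * (\<Sum>c\<in>children G u. h c)) / (1 + ?k * lam) \<le> h u"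
      using d by (simp add: divide_le_eq)
    then show "(\<integral>\<^sup>+y. ennreal (h y) \<partial>measure_pmf (RW_step G lam u)) \<le> ennreal (h u)"
      unfolding nn_integral_RW_step[OF lam une h0] by (rule ennreal_leI)
  qed
  also have "h v = 1 - f v" by (simp add: h_def P_def l_def)
  finally have "emeasure (RWs G lam v) {X. \<exists>n. X n \<in> {parent v}} \<le> ennreal (1 - f v)" .
  then have "1 - ennreal (1 - f v) \<le> esc G lam v"
    unfolding esc_eq by (rule ennreal_minus_mono[OF order_refl])
  then show ?thesis
    using f(2)[of v] by (simp flip: ennreal_1 add: ennreal_minus)
qed

text \<open>Avoiding \<open>v\<close> after a step to its child keeps the trajectory in the subtree
  of this child, which does not contain the parent of \<open>v\<close>.\<close>

lemma esc_step:
  assumes lam: "lam > 0" and G: "G \<in> {UNIV, half_plane}" and v: "v @ [z] \<in> saws G" "v \<noteq> []"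
  shows "ennreal (min_step lam) * esc G lam (v @ [z]) \<le> esc G lam v"
proof -
  let ?c = "v @ [z]"
  have vs: "v \<in> saws G" using v saws_appendD by blast
  have pc: "parent ?c = v" by (simp add: parent_def)
  have npv: "\<not> prefix ?c (parent v)" using prefix_length_le[of ?c "parent v"] by (auto simp: parent_def)
  have ev: "path_event (\<lambda>X. \<forall>n. X n \<noteq> v)" "path_event (\<lambda>X. \<forall>n. X n \<noteq> parent v)" "path_event (\<lambda>X. (\<forall>n. X n \<noteq> v) \<and> (\<forall>n. X n \<noteq> parent v))"
    by (intro path_event_intros)+
  have "esc G lam ?c \<le> emeasure (RWs G lam ?c) {X. (\<forall>n. X n \<noteq> v) \<and> (\<forall>n. X n \<noteq> parent v)}"
    unfolding esc_def pc
  proof (rule emeasure_mono_AE)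
    show "AE X in RWs G lam ?c. X \<in> {X. \<forall>n. X n \<noteq> v} \<longrightarrow> X \<in> {X. (\<forall>n. X n \<noteq> v) \<and> (\<forall>n. X n \<noteq> parent v)}"
      using AE_RW_tree_steps[OF lam G v(1)]
    proof eventually_elim
      case (elim X)
      show ?case
      proof
        assume "X \<in> {X. \<forall>n. X n \<noteq> v}"
        then have a: "\<And>n. X n \<noteq> v" by simp
        have "prefix ?c (X n)" for n
          using steps_stay_below[of X G ?c "Suc n"] elim a pc by auto
        then have "X n \<noteq> parent v" for n using npv by metis
        then show "X \<in> {X. (\<forall>n. X n \<noteq> v) \<and> (\<forall>n. X n \<noteq> parent v)}" using a by simp
      qed
    qed
  qed (rule path_event_markov_set[OF ev(3)])
  then have "ennreal (min_step lam) * esc G lam ?c \<le>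
      ennreal (pmf (RW_step G lam v) ?c) * emeasure (RWs G lam ?c) {X. (\<forall>n. X n \<noteq> v) \<and> (\<forall>n. X n \<noteq> parent v)}"
    using pmf_RW_step_ge[OF lam G vs, of ?c] v(1)
    by (intro mult_mono ennreal_leI) (auto simp: tree_step_def children_def)
  also have "\<dots> \<le> emeasure (RWs G lam v) {X. \<forall>n. X n \<noteq> parent v}"
  proof (rule emeasure_markov_step_ge[OF ev(2) ev(3)])
    fix X :: "nat \<Rightarrow> site list" assume "(\<forall>n. X n \<noteq> v) \<and> (\<forall>n. X n \<noteq> parent v)"
    moreover have "v \<noteq> parent v" using v(2) by (metis append_butlast_last_id append_self_conv list.distinct(1) parent_def)
    ultimately show "\<forall>n. case_nat v X n \<noteq> parent v" by (auto split: nat.splits)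
  qed
  finally show ?thesis by (simp add: esc_def)
qed

lemma esc_extension:
  assumes lam: "lam > 0" and G: "G \<in> {UNIV, half_plane}" and v: "v @ zs \<in> saws G" "v \<noteq> []"
  shows "ennreal (min_step lam) ^ length zs * esc G lam (v @ zs) \<le> esc G lam v"
  using v(1)
proof (induction zs rule: rev_induct)
  case (snoc z zs)
  have s: "v @ zs \<in> saws G" using snoc.prems v(2) saws_appendD[of "v @ zs" "[z]"] by simp
  have "ennreal (min_step lam) ^ length zs * (ennreal (min_step lam) * esc G lam (v @ zs @ [z])) \<le>
      ennreal (min_step lam) ^ length zs * esc G lam (v @ zs)"
    using esc_step[OF lam G, of "v @ zs" z] snoc.prems v(2) by (intro mult_left_mono) simp_all
  also have "\<dots> \<le> esc G lam v" by (rule snoc.IH[OF s])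
  finally show ?case by (simp add: mult_ac)
qed simp

lemma esc_reflect:
  assumes "G \<in> {UNIV, half_plane}" "lam > 0" "v \<in> saws G"
  shows "esc G lam v \<le> esc G lam (map reflect v)"
proof -
  have p: "map reflect (parent v) = parent (map reflect v)" by (simp add: parent_def map_butlast)
  have "emeasure (RWs G lam (map reflect v)) {X. \<exists>n. X n \<in> {parent (map reflect v)}} \<le>
      emeasure (RWs G lam (map reflect (map reflect v))) {X. \<exists>n. X n \<in> {parent v}}"
    by (rule hit_reflect[OF assms(1,2) map_reflect_saws[OF assms(1,3)]])
       (simp only: image_insert image_empty p[symmetric] map_reflect_map_reflect subset_refl)
  then show ?thesis
    unfolding esc_eq map_reflect_map_reflect by (intro ennreal_minus_mono order_refl)
qed

section \<open>Bridges and corridors\<close>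

text \<open>Bridges in the horizontal direction, with \<open>n\<close> steps. When they are laid end
  to end, their tails occupy disjoint ranges of columns and so cannot meet.\<close>

definition bridges :: "nat \<Rightarrow> site list set" where
  "bridges n = {\<beta> \<in> saws UNIV. length \<beta> = Suc n \<and> (\<forall>p\<in>set (tl \<beta>). 0 < fst p \<and> fst p \<le> fst (last \<beta>))}"

lemma finite_bridges: "finite (bridges n)"
  by (rule finite_subset[OF _ finite_saws_length[of UNIV "Suc n"]]) (auto simp: bridges_def)

definition flip :: "site \<Rightarrow> site" where
  "flip p = (fst p, - snd p)"

lemma isometry_flip: "isometry flip"
  unfolding isometry_def
proof (intro conjI allI)
  show "bij flip" by (rule o_bij[of flip]) (auto simp: flip_def fun_eq_iff)
qed (auto simp: flip_def nbr_def)

lemma map_flip_bridges: "\<beta> \<in> bridges n \<Longrightarrow> map flip \<beta> \<in> bridges n"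
proof -
  assume b: "\<beta> \<in> bridges n"
  then have ne: "\<beta> \<noteq> []" by (auto simp: bridges_def saws_def)
  have "map flip \<beta> \<in> saws UNIV"
    using b inj_on_subset[OF isometry_inj[OF isometry_flip] subset_UNIV]
    by (simp add: bridges_def saws_def successively_map_isometry[OF isometry_flip] hd_map distinct_map flip_def)
  then show ?thesis using b ne by (auto simp: bridges_def last_map map_tl[symmetric] flip_def)
qed

definition toward :: "nat \<Rightarrow> bool \<Rightarrow> site list set" where
  "toward n up = {\<beta> \<in> bridges n. if up then snd (last \<beta>) \<ge> 0 else snd (last \<beta>) \<le> 0}"

text \<open>The flip exchanges the two vertical directions, so each of them has at least half of all
  bridges; a bridge that ends at its starting height counts for both.\<close>

lemma card_bridges_le: "card (bridges n) \<le> 2 * card (toward n up)"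
proof -
  have fin: "finite (toward n b)" for b
    by (rule finite_subset[OF _ finite_bridges]) (auto simp: toward_def)
  have "map flip ` toward n b \<subseteq> toward n (\<not> b)" for b
  proof
    fix y assume "y \<in> map flip ` toward n b"
    then obtain \<beta> where y: "y = map flip \<beta>" "\<beta> \<in> toward n b" by blast
    then have "\<beta> \<noteq> []" by (auto simp: toward_def bridges_def saws_def)
    then show "y \<in> toward n (\<not> b)"
      using y map_flip_bridges by (auto simp: toward_def last_map flip_def split: if_splits)
  qed
  moreover have "inj (map flip)" using isometry_inj[OF isometry_flip] by simp
  ultimately have le: "card (toward n b) \<le> card (toward n (\<not> b))" for b
    using fin by (metis card_image card_mono inj_on_subset subset_UNIV)
  have "bridges n = toward n up \<union> toward n (\<not> up)" by (cases up) (auto simp: toward_def)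
  then have "card (bridges n) \<le> card (toward n up) + card (toward n (\<not> up))"
    by (simp add: card_Un_le)
  then show ?thesis using le[of "\<not> up"] by simp
qed

lemma walk_displacement:
  "successively nbr \<beta> \<Longrightarrow> i < length \<beta> \<Longrightarrow> \<bar>snd (\<beta> ! i) - snd (\<beta> ! 0)\<bar> \<le> int i"
proof (induction i)
  case (Suc i)
  have "nbr (\<beta> ! i) (\<beta> ! Suc i)" using Suc.prems by (simp add: successively_conv_nth)
  then have "\<bar>snd (\<beta> ! Suc i) - snd (\<beta> ! i)\<bar> \<le> 1" by (auto simp: nbr_def)
  moreover have "\<bar>snd (\<beta> ! i) - snd (\<beta> ! 0)\<bar> \<le> int i" using Suc by simp
  ultimately show ?case by simp
qed simp

lemma bridge_height:
  assumes "\<beta> \<in> bridges n" "p \<in> set \<beta>"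
  shows "\<bar>snd p\<bar> \<le> int n"
proof -
  obtain i where i: "i < length \<beta>" "p = \<beta> ! i" using assms(2) by (metis in_set_conv_nth)
  have "\<beta> \<noteq> []" "hd \<beta> = (0, 0)" "successively nbr \<beta>" "length \<beta> = Suc n" using assms(1) by (auto simp: bridges_def saws_def)
  then show ?thesis using walk_displacement[of \<beta> i] i by (simp add: hd_conv_nth)
qed

definition shift :: "site \<Rightarrow> site \<Rightarrow> site" where
  "shift a p = (fst a + fst p, snd a + snd p)"

lemma isometry_shift: "isometry (shift a)"
  unfolding isometry_def
proof (intro conjI allI)
  show "bij (shift a)"
    by (rule o_bij[of "shift (- fst a, - snd a)"]) (auto simp: shift_def fun_eq_iff)
qed (auto simp: shift_def nbr_def)

text \<open>Chosen so that \<open>esc_fun\<close> stays below 1/(4n): 4^n bounds the number of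
  continuations up to the next station, and the power of \<open>max 1 lam\<close> bounds the powers
  of \<lambda>.\<close>

definition escape_bound :: "real \<Rightarrow> nat \<Rightarrow> real" where
  "escape_bound lam n = 1 / (4 * real n * (4 * max 1 lam) ^ n)"

lemma escape_bound_pos: "n \<ge> 1 \<Longrightarrow> 0 < escape_bound lam n"
  by (simp add: escape_bound_def)

locale corridor =
  fixes G :: "site set" and lam :: real and n :: nat and b :: "site list"
  assumes G: "G \<in> {UNIV, half_plane}" and lam: "lam > 0" and n: "n \<ge> 1"
    and many: "4 \<le> real (card (bridges n)) * lam ^ n"
    and b: "b \<in> saws G" "b \<noteq> root" and height: "snd (last b) = 2 * int n"
    and fresh: "\<And>p. p \<in> set b \<Longrightarrow> fst (last b) < fst p \<Longrightarrow> \<not> (0 \<le> snd p \<and> snd p \<le> 4 * int n)"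
begin

text \<open>Encodes not a concatenation of bridges but the properties that allow one more to be
  added: the continuation has a multiple of \<open>n\<close> steps and ends in its rightmost column,
  in a row between \<open>n\<close> and \<open>3 * n\<close>, so that a bridge of \<open>n\<close>
  steps cannot leave the strip.\<close>

definition stations :: "site list set" where
  "stations = {z \<in> saws G. \<exists>\<zeta>. z = b @ \<zeta> \<and> n dvd length \<zeta> \<and>
     (\<forall>p\<in>set \<zeta>. fst (last b) < fst p \<and> fst p \<le> fst (last z) \<and> 0 \<le> snd p \<and> snd p \<le> 4 * int n) \<and>
     int n \<le> snd (last z) \<and> snd (last z) \<le> 3 * int n}"

lemma b_station: "b \<in> stations"
  unfolding stations_def using b height n by (auto intro!: exI[of _ "[]"])

text \<open>From the lower half of the strip the bridge ends no lower, from the upper half no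
  higher, so the new end is again in the rows \<open>n\<close> to \<open>3 * n\<close>. In the
  strip, the columns beyond \<open>last u\<close> are free of \<open>b\<close> and of the earlier
  blocks.\<close>

lemma station_extend:
  assumes u: "u \<in> stations" and \<beta>: "\<beta> \<in> toward n (snd (last u) < 2 * int n)"
  shows "u @ map (shift (last u)) (tl \<beta>) \<in> stations"
proof -
  obtain \<zeta> where \<zeta>: "u = b @ \<zeta>" "n dvd length \<zeta>"
      "\<And>p. p \<in> set \<zeta> \<Longrightarrow> fst (last b) < fst p \<and> fst p \<le> fst (last u) \<and> 0 \<le> snd p \<and> snd p \<le> 4 * int n"
      "int n \<le> snd (last u)" "snd (last u) \<le> 3 * int n" and us: "u \<in> saws G"
    using u unfolding stations_def by blast
  have une: "u \<noteq> []" by (rule saws_not_Nil[OF us])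
  have \<beta>b: "\<beta> \<in> bridges n" using \<beta> by (simp add: toward_def)
  have \<beta>s: "\<beta> \<noteq> []" "hd \<beta> = (0, 0)" "distinct \<beta>" "successively nbr \<beta>" "length \<beta> = Suc n"
    and \<beta>x: "\<And>p. p \<in> set (tl \<beta>) \<Longrightarrow> 0 < fst p \<and> fst p \<le> fst (last \<beta>)"
    using \<beta>b by (auto simp: bridges_def saws_def)
  have tne: "tl \<beta> \<noteq> []" using \<beta>s(5) n by (cases \<beta>) auto
  have \<beta>eq: "\<beta> = (0, 0) # tl \<beta>" using \<beta>s(1,2) by (metis list.collapse)
  have lt: "last (tl \<beta>) = last \<beta>" using tne by (simp add: last_tl)
  let ?e = "map (shift (last u)) (tl \<beta>)"
  have \<beta>y: "\<bar>snd p\<bar> \<le> int n" if "p \<in> set (tl \<beta>)" for p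
    using bridge_height[OF \<beta>b] that by (metis list.set_sel(2) \<beta>s(1))
  have ex: "fst (last u) < fst q \<and> fst q \<le> fst (last u) + fst (last \<beta>) \<and> 0 \<le> snd q \<and> snd q \<le> 4 * int n"
    if "q \<in> set ?e" for q
  proof -
    obtain p where "p \<in> set (tl \<beta>)" "q = shift (last u) p" using \<open>q \<in> set ?e\<close> by auto
    then show ?thesis using \<beta>x[of p] \<beta>y[of p] \<zeta>(4,5) by (auto simp: shift_def)
  qed
  have lb: "fst (last b) \<le> fst (last u)"
  proof (cases "\<zeta> = []")
    case False
    then show ?thesis using \<zeta>(3)[of "last \<zeta>"] \<zeta>(1) by simp
  qed (use \<zeta>(1) in simp)
  have es: "u @ ?e \<in> saws G"
  proof (rule saws_append[OF us])
    show "set ?e \<subseteq> G" using ex G by (auto simp: half_plane_iff simp del: set_map)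
    show "distinct ?e" using \<beta>s(3) inj_on_subset[OF isometry_inj[OF isometry_shift] subset_UNIV]
      by (simp add: distinct_map distinct_tl)
    show "set u \<inter> set ?e = {}"
    proof (rule ccontr)
      assume "\<not> ?thesis"
      then obtain q where q: "q \<in> set u" "q \<in> set ?e" by blast
      note e = ex[OF q(2)]
      from q(1) \<zeta>(1) have "q \<in> set b \<or> q \<in> set \<zeta>" by auto
      then show False using e fresh[of q] \<zeta>(3)[of q] lb by auto
    qed
    have "map (shift (last u)) \<beta> = last u # ?e"
      by (subst \<beta>eq) (simp add: shift_def)
    then show "successively nbr (last u # ?e)"
      using \<beta>s(4) successively_map_isometry[OF isometry_shift, of "last u" \<beta>] by simp
  qed
  have le: "last (u @ ?e) = shift (last u) (last \<beta>)" using tne lt by (simp add: last_map)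
  have y: "int n \<le> snd (last (u @ ?e))" "snd (last (u @ ?e)) \<le> 3 * int n"
    using \<beta> \<zeta>(4,5) \<beta>y[of "last \<beta>"] lt tne unfolding le
    by (auto simp: shift_def toward_def split: if_splits) (use last_in_set in force)+
  have "0 \<le> fst (last \<beta>)" using \<beta>x[of "last \<beta>"] lt tne last_in_set by fastforce
  then have "fst (last b) < fst p \<and> fst p \<le> fst (last (u @ ?e)) \<and> 0 \<le> snd p \<and> snd p \<le> 4 * int n"
    if "p \<in> set (\<zeta> @ ?e)" for p
    using that ex[of p] \<zeta>(3)[of p] lb unfolding le by (auto simp: shift_def simp del: set_map)
  moreover have "n dvd length (\<zeta> @ ?e)" using \<zeta>(2) \<beta>s(5) by simp
  ultimately show ?thesis
    unfolding stations_def using es y \<zeta>(1) by (intro CollectI conjI exI[of _ "\<zeta> @ ?e"]) auto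
qed

text \<open>At a station the value is \<open>n\<close> and not 0: the distance is to the following
  station level, with lengths counted from \<open>b\<close>.\<close>

definition dist_next :: "site list \<Rightarrow> nat" where
  "dist_next u = n - (length u - length b) mod n"

definition nexts :: "site list \<Rightarrow> site list set" where
  "nexts u = {z \<in> stations. \<exists>\<rho>. z = u @ \<rho> \<and> length \<rho> = dist_next u}"

lemma dist_next: "1 \<le> dist_next u" "dist_next u \<le> n"
proof -
  have "(length u - length b) mod n < n" using n by simp
  then show "1 \<le> dist_next u" unfolding dist_next_def by simp
qed (simp add: dist_next_def)

lemma nexts_subset: "nexts u \<subseteq> {z \<in> saws G. length z \<le> length u + n}"
  using dist_next(2)[of u] by (auto simp: nexts_def stations_def)

lemma finite_nexts: "finite (nexts u)"
  by (rule finite_subset[OF nexts_subset finite_saws_length])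

lemma card_extensions: "u \<in> saws G \<Longrightarrow> card {z \<in> saws G. \<exists>\<rho>. z = u @ \<rho> \<and> length \<rho> = r} \<le> 4 ^ r"
proof (induction r)
  case 0
  then have "{z \<in> saws G. \<exists>\<rho>. z = u @ \<rho> \<and> length \<rho> = 0} = {u}" by auto
  then show ?case by simp
next
  case (Suc r)
  let ?E = "\<lambda>r. {z \<in> saws G. \<exists>\<rho>. z = u @ \<rho> \<and> length \<rho> = r}"
  have fin: "finite (?E r)" for r
    by (rule finite_subset[OF _ finite_saws_length[of G "length u + r"]]) auto
  have "?E (Suc r) \<subseteq> (\<Union>y\<in>?E r. children G y)"
  proof
    fix z assume "z \<in> ?E (Suc r)"
    then obtain \<rho> where \<rho>: "z = u @ \<rho>" "length \<rho> = Suc r" "z \<in> saws G" by blast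
    then have e: "z = (u @ butlast \<rho>) @ [last \<rho>]" by (cases \<rho> rule: rev_cases) auto
    have "u @ butlast \<rho> \<in> saws G" using \<rho>(3) e saws_appendD saws_not_Nil[OF Suc.prems]
      by (metis append_is_Nil_conv)
    then have "u @ butlast \<rho> \<in> ?E r" using \<rho>(2) by auto
    moreover have "z \<in> children G (u @ butlast \<rho>)" unfolding children_def using \<rho>(3) e by blast
    ultimately show "z \<in> (\<Union>y\<in>?E r. children G y)" by blast
  qed
  then have "card (?E (Suc r)) \<le> card (\<Union>y\<in>?E r. children G y)"
    using fin finite_children by (intro card_mono) auto
  also have "\<dots> \<le> (\<Sum>y\<in>?E r. card (children G y))" by (rule card_UN_le[OF fin])
  also have "\<dots> \<le> (\<Sum>y\<in>?E r. 4)" by (intro sum_mono card_children_le) auto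
  also have "\<dots> \<le> 4 ^ Suc r" using Suc by simp
  finally show ?case .
qed

lemma card_nexts_le: "u \<in> saws G \<Longrightarrow> card (nexts u) \<le> 4 ^ n"
proof -
  assume u: "u \<in> saws G"
  have "card (nexts u) \<le> card {z \<in> saws G. \<exists>\<rho>. z = u @ \<rho> \<and> length \<rho> = dist_next u}"
    by (intro card_mono finite_subset[OF _ finite_saws_length[of G "length u + n"]])
       (use dist_next(2)[of u] in \<open>auto simp: nexts_def stations_def\<close>)
  also have "\<dots> \<le> 4 ^ dist_next u" by (rule card_extensions[OF u])
  also have "\<dots> \<le> 4 ^ n" using dist_next(2) by (intro power_increasing) auto
  finally show ?thesis .
qed

lemma station_length: "u \<in> stations \<Longrightarrow> n dvd (length u - length b) \<and> prefix b u"
  by (auto simp: stations_def)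

lemma dist_next_station: "u \<in> stations \<Longrightarrow> dist_next u = n"
  using station_length[of u] by (simp add: dist_next_def mod_eq_0_iff_dvd)

text \<open>Steering keeps at least half of the bridges, which leaves 2 of the 4 in
  \<open>many\<close>.\<close>

lemma card_nexts_station:
  assumes u: "u \<in> stations"
  shows "2 \<le> real (card (nexts u)) * lam ^ n"
proof -
  let ?T = "toward n (snd (last u) < 2 * int n)"
  let ?f = "\<lambda>\<beta>. u @ map (shift (last u)) (tl \<beta>)"
  have inj: "inj_on ?f ?T"
  proof (rule inj_onI)
    fix \<beta> \<gamma> assume bg: "\<beta> \<in> ?T" "\<gamma> \<in> ?T" and "?f \<beta> = ?f \<gamma>"
    then have "tl \<beta> = tl \<gamma>" using isometry_inj[OF isometry_shift] by (simp add: inj_map_eq_map)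
    moreover have "hd \<beta> = hd \<gamma>" "\<beta> \<noteq> []" "\<gamma> \<noteq> []" using bg by (auto simp: toward_def bridges_def saws_def)
    ultimately show "\<beta> = \<gamma>" by (metis list.collapse)
  qed
  have "?f ` ?T \<subseteq> nexts u"
  proof
    fix y assume "y \<in> ?f ` ?T"
    then obtain \<beta> where \<beta>: "\<beta> \<in> ?T" "y = ?f \<beta>" by blast
    have "length \<beta> = Suc n" using \<beta>(1) by (simp add: toward_def bridges_def)
    then show "y \<in> nexts u"
      unfolding nexts_def using \<beta>(2) station_extend[OF u \<beta>(1)] dist_next_station[OF u] by simp
  qed
  then have "card ?T \<le> card (nexts u)"
    using card_mono[OF finite_nexts] card_image[OF inj] by metis
  then have "card (bridges n) \<le> 2 * card (nexts u)"
    using card_bridges_le[of n "snd (last u) < 2 * int n"] by linarith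
  then have "real (card (bridges n)) \<le> 2 * real (card (nexts u))" by linarith
  then have "real (card (bridges n)) * lam ^ n \<le> 2 * real (card (nexts u)) * lam ^ n"
    using lam by (intro mult_right_mono) auto
  then show ?thesis using many by simp
qed

text \<open>Close enough to 1 for \<open>decay ^ n\<close> to be at least 1/2 by Bernoulli's
  inequality, yet with a gap 1/(2n) that absorbs the factor 1 - f in the recursion of
  \<open>esc_ge\<close>.\<close>

definition decay :: real where
  "decay = 1 - 1 / (2 * real n)"

text \<open>Counts the next stations below \<open>u\<close>, with a factor
  \<open>decay * lam\<close> for every step still missing. Between station levels the counts of the
  children add up to at least that of \<open>u\<close>; at a station the surplus of bridges restores
  at least \<open>escape_bound\<close>.\<close>

definition esc_fun :: "site list \<Rightarrow> real" where
  "esc_fun u = (if u \<in> saws G then escape_bound lam n * (decay * lam) ^ dist_next u * real (card (nexts u)) else 0)"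

lemma decay: "0 < decay" "decay < 1" "1 / 2 \<le> decay ^ n"
proof -
  have n1: "real n \<ge> 1" using n by simp
  then show "0 < decay" "decay < 1" by (auto simp: decay_def field_simps)
  have "1 + real n * (- (1 / (2 * real n))) \<le> (1 + (- (1 / (2 * real n)))) ^ n"
    by (rule Bernoulli_inequality) (use n1 in \<open>auto simp: field_simps\<close>)
  then show "1 / 2 \<le> decay ^ n" using n1 by (simp add: decay_def)
qed

lemma esc_fun_nonneg: "0 \<le> esc_fun u"
  using escape_bound_pos[OF n, of lam] decay(1) lam by (simp add: esc_fun_def)

lemma esc_fun_le: "esc_fun u \<le> 1 - decay"
proof (cases "u \<in> saws G")
  case True
  have m: "1 \<le> max 1 lam" by simp
  have "(decay * lam) ^ dist_next u \<le> (max 1 lam) ^ dist_next u"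
    using decay lam by (intro power_mono) (auto simp: le_max_iff_disj mult_le_cancel_right2 mult_nonneg_nonneg)
  also have "\<dots> \<le> (max 1 lam) ^ n" using dist_next(2) by (intro power_increasing) auto
  finally have p: "(decay * lam) ^ dist_next u \<le> (max 1 lam) ^ n" .
  have c: "real (card (nexts u)) \<le> 4 ^ n" using card_nexts_le[OF True] by (metis of_nat_le_iff of_nat_numeral of_nat_power)
  have "esc_fun u = escape_bound lam n * ((decay * lam) ^ dist_next u * real (card (nexts u)))"
    using True by (simp add: esc_fun_def)
  also have "\<dots> \<le> escape_bound lam n * ((max 1 lam) ^ n * 4 ^ n)"
    using p c escape_bound_pos[OF n, of lam] decay(1) lam by (intro mult_left_mono mult_mono) auto
  also have "\<dots> = 1 / (4 * real n)"
    using lam n by (simp add: escape_bound_def power_mult_distrib)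
  also have "\<dots> \<le> 1 - decay" using n by (simp add: decay_def field_simps)
  finally show ?thesis .
qed (use decay in \<open>simp add: esc_fun_def\<close>)

lemma esc_fun_station: "u \<in> stations \<Longrightarrow> escape_bound lam n \<le> esc_fun u"
proof -
  assume u: "u \<in> stations"
  have us: "u \<in> saws G" using u by (simp add: stations_def)
  have "1 \<le> (1 / 2) * (real (card (nexts u)) * lam ^ n)" using card_nexts_station[OF u] by simp
  also have "\<dots> \<le> decay ^ n * (real (card (nexts u)) * lam ^ n)"
    using decay(3) lam by (intro mult_right_mono) auto
  finally have "escape_bound lam n * 1 \<le> escape_bound lam n * (decay ^ n * (real (card (nexts u)) * lam ^ n))"
    using escape_bound_pos[OF n, of lam] by (intro mult_left_mono) auto
  then show ?thesis using us by (simp add: esc_fun_def dist_next_station[OF u] power_mult_distrib mult_ac)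
qed

text \<open>One step before a station level the next stations are children, each of value at least
  \<open>escape_bound\<close>. Elsewhere every next station of \<open>u\<close> is a next station of
  some child, and the distance drops by one.\<close>

lemma esc_fun_sub:
  assumes u: "u \<in> saws G" "prefix b u"
  shows "esc_fun u \<le> decay * lam * (\<Sum>c\<in>children G u. esc_fun c)"
proof -
  have lc: "length c = Suc (length u)" "c \<in> saws G" if "c \<in> children G u" for c
    using that by (auto simp: children_def)
  have lb: "length b \<le> length u" by (rule prefix_length_le[OF u(2)])
  show ?thesis
  proof (cases "dist_next u = 1")
    case True
    have sub: "nexts u \<subseteq> children G u"
    proof
      fix z assume "z \<in> nexts u"
      then obtain \<rho> where "z \<in> stations" "z = u @ \<rho>" "length \<rho> = 1" unfolding nexts_def True by blast
      then show "z \<in> children G u" unfolding children_def stations_def by (cases \<rho>) auto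
    qed
    have "escape_bound lam n * real (card (nexts u)) = (\<Sum>c\<in>nexts u. escape_bound lam n)" by simp
    also have "\<dots> \<le> (\<Sum>c\<in>nexts u. esc_fun c)"
      by (intro sum_mono esc_fun_station) (auto simp: nexts_def)
    also have "\<dots> \<le> (\<Sum>c\<in>children G u. esc_fun c)"
      using sub by (intro sum_mono2 finite_children esc_fun_nonneg) auto
    finally have "decay * lam * (escape_bound lam n * real (card (nexts u))) \<le> decay * lam * (\<Sum>c\<in>children G u. esc_fun c)"
      using decay(1) lam by (intro mult_left_mono) auto
    then show ?thesis using u True by (simp add: esc_fun_def mult_ac)
  next
    case False
    define j where "j = length u - length b"
    have jm: "j mod n + 1 < n"
      using False dist_next(1)[of u] unfolding dist_next_def j_def[symmetric] by simp
    have "Suc j mod n = Suc (j mod n)" using jm by (simp add: mod_Suc)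
    then have dn: "dist_next u = Suc (dist_next c)" if "c \<in> children G u" for c
      using lc(1)[OF that] lb jm unfolding dist_next_def by (simp add: Suc_diff_le j_def[symmetric])
    have sub: "nexts u \<subseteq> (\<Union>c\<in>children G u. nexts c)"
    proof
      fix z assume "z \<in> nexts u"
      then obtain \<rho> where z: "z \<in> stations" "z = u @ \<rho>" "length \<rho> = dist_next u" unfolding nexts_def by blast
      then obtain s \<rho>' where s: "\<rho> = s # \<rho>'" using dist_next(1)[of u] by (cases \<rho>) auto
      have zs: "(u @ [s]) @ \<rho>' \<in> saws G" using z s by (simp add: stations_def)
      then have "u @ [s] \<in> saws G" by (rule saws_appendD) simp
      then have c: "u @ [s] \<in> children G u" by (simp add: children_def)
      have "z \<in> nexts (u @ [s])" unfolding nexts_def using z s dn[OF c] by simp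
      then show "z \<in> (\<Union>c\<in>children G u. nexts c)" using c by blast
    qed
    have "card (nexts u) \<le> card (\<Union>c\<in>children G u. nexts c)"
      using sub finite_children finite_nexts by (intro card_mono) auto
    also have "\<dots> \<le> (\<Sum>c\<in>children G u. card (nexts c))" by (rule card_UN_le[OF finite_children])
    finally have card: "real (card (nexts u)) \<le> (\<Sum>c\<in>children G u. real (card (nexts c)))"
      by (metis of_nat_le_iff of_nat_sum)
    have "esc_fun u = escape_bound lam n * (decay * lam) ^ dist_next u * real (card (nexts u))"
      using u by (simp add: esc_fun_def)
    also have "\<dots> \<le> escape_bound lam n * (decay * lam) ^ dist_next u * (\<Sum>c\<in>children G u. real (card (nexts c)))"
      using card escape_bound_pos[OF n, of lam] decay(1) lam by (intro mult_left_mono) auto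
    also have "\<dots> = (\<Sum>c\<in>children G u. decay * lam * esc_fun c)"
      unfolding sum_distrib_left by (intro sum.cong) (auto simp: esc_fun_def lc(2) dn mult_ac)
    also have "\<dots> = decay * lam * (\<Sum>c\<in>children G u. esc_fun c)" by (rule sum_distrib_left[symmetric])
    finally show ?thesis .
  qed
qed

theorem corridor_escape: "ennreal (escape_bound lam n) \<le> esc G lam b"
proof -
  have "ennreal (escape_bound lam n) \<le> ennreal (esc_fun b)" by (intro ennreal_leI esc_fun_station b_station)
  also have "\<dots> \<le> esc G lam b"
  proof (rule esc_ge[OF lam G b, where f = esc_fun])
    show "0 \<le> esc_fun u" for u by (rule esc_fun_nonneg)
    show "esc_fun u < 1" for u using esc_fun_le[of u] decay(1) by simp
    fix u assume u: "u \<in> saws G" "prefix b u"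
    let ?S = "\<Sum>c\<in>children G u. esc_fun c"
    have "0 \<le> lam * ?S" using lam esc_fun_nonneg by (simp add: sum_nonneg)
    \<comment> \<open>Here the nonlinearity is paid for: \<open>esc_fun u\<close> is at most
      \<open>1 - decay\<close>.\<close>
    then have "decay * (lam * ?S) \<le> (1 - esc_fun u) * (lam * ?S)"
      using esc_fun_le[of u] by (intro mult_right_mono) auto
    then show "esc_fun u \<le> (1 - esc_fun u) * lam * ?S"
      using esc_fun_sub[OF u] by (simp add: mult.assoc)
  qed
  finally show ?thesis .
qed

end

section \<open>Transience implies growth\<close>

text \<open>If the lengths stayed bounded, the trajectory would hit the root infinitely often. The
  length changes by one per step, so the level is met exactly.\<close>

lemma avoid_root_reaches_level:
  assumes lam: "lam > 0" and G: "G \<in> {UNIV, half_plane}" and y: "y \<in> saws G" "length y \<le> Suc N"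
  shows "emeasure (RWs G lam y) {X. \<forall>n. X n \<noteq> root} \<le>
    emeasure (RWs G lam y) {X. reaches {w. length w = Suc N} (saws G - {root}) X}"
proof (rule emeasure_mono_AE)
  show "{X. reaches {w. length w = Suc N} (saws G - {root}) X} \<in> sets (RWs G lam y)"
    by (intro path_event_markov_set path_event_reaches)
  let ?V = "{w \<in> saws G. length w \<le> Suc N}"
  have hit: "ennreal (min_step lam) ^ N \<le> emeasure (RWs G lam v) {X. \<exists>n. X n \<in> {root}}" if "v \<in> ?V" for v
    using that by (intro hit_root_ge[OF lam G]) auto
  have rec: "AE X in RWs G lam y. infinite {n. X n \<in> ?V} \<longrightarrow> infinite {n. X n \<in> {root}}"
    by (rule AE_markov_recurrent_target[OF hit min_step_power_pos[OF lam]])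
  show "AE X in RWs G lam y. X \<in> {X. \<forall>n. X n \<noteq> root} \<longrightarrow>
      X \<in> {X. reaches {w. length w = Suc N} (saws G - {root}) X}"
    using rec AE_RW_tree_steps[OF lam G y(1)]
  proof eventually_elim
    case (elim X)
    show ?case
    proof
      assume "X \<in> {X. \<forall>n. X n \<noteq> root}"
      then have nr: "\<And>n. X n \<noteq> root" by simp
      have "{n. X n \<in> {root}} = {}" using nr by simp
      then have "finite {n. X n \<in> ?V}" using elim by (metis finite.emptyI)
      then have "{n. X n \<in> ?V} \<noteq> UNIV" by (metis infinite_UNIV_nat)
      then obtain k where "X k \<notin> ?V" by blast
      then have k: "length (X k) > Suc N" using elim by (simp add: not_le)
      define m where "m = (LEAST n. length (X n) \<ge> Suc N)"
      have m: "length (X m) \<ge> Suc N" unfolding m_def by (rule LeastI[of _ k]) (use k in simp)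
      have lt: "length (X i) < Suc N" if "i < m" for i
        using not_less_Least[OF that[unfolded m_def]] by simp
      have "length (X m) = Suc N"
      proof (cases m)
        case 0
        then show ?thesis using m y(2) elim by simp
      next
        case (Suc i)
        have "length (X i) < Suc N" by (rule lt) (simp add: Suc)
        moreover have "tree_step G (X i) (X m)" using elim Suc by blast
        then have "length (X m) \<le> Suc (length (X i))" by (auto simp: tree_step_def children_def parent_def)
        ultimately show ?thesis using m by simp
      qed
      then show "X \<in> {X. reaches {w. length w = Suc N} (saws G - {root}) X}"
        unfolding reaches_def using elim nr by blast
    qed
  qed
qed

locale level_count =
  fixes G :: "site set" and lam :: real and N :: nat
  assumes G: "G \<in> {UNIV, half_plane}" and lam: "lam > 0"
begin

definition desc :: "site list \<Rightarrow> nat" where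
  "desc p = card {w \<in> saws G. length w = Suc N \<and> prefix p w}"

text \<open>The voltage of the flow that sends one unit to each walk with \<open>N\<close> steps:
  the edge into depth \<open>j\<close> has resistance (1/\<lambda>)^j and carries the current
  \<open>desc\<close>.\<close>

definition pot :: "site list \<Rightarrow> real" where
  "pot u = (\<Sum>j\<in>{1..N}. if Suc j \<le> length u then (1 / lam) ^ j * real (desc (take (Suc j) u)) else 0)"

lemma finite_level: "finite {w \<in> saws G. length w = Suc N \<and> Q w}"
  by (rule finite_subset[OF _ finite_saws_length[of G "Suc N"]]) auto

lemma desc_le: "desc p \<le> card {w \<in> saws G. length w = Suc N}"
  unfolding desc_def using finite_level[of "\<lambda>_. True"] by (intro card_mono) auto

lemma pot_nonneg: "0 \<le> pot u"
  using lam by (auto simp: pot_def intro!: sum_nonneg)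

lemma pot_snoc:
  assumes "length u \<ge> 1"
  shows "pot (u @ [z]) = pot u + (if length u \<le> N then (1 / lam) ^ length u * real (desc (u @ [z])) else 0)"
proof -
  have "pot (u @ [z]) - pot u = (\<Sum>j\<in>{1..N}. if j = length u then (1 / lam) ^ j * real (desc (u @ [z])) else 0)"
    unfolding pot_def sum_subtractf[symmetric] by (intro sum.cong) (auto simp: take_Suc_conv_app_nth)
  also have "\<dots> = (if length u \<le> N then (1 / lam) ^ length u * real (desc (u @ [z])) else 0)"
    using assms by (simp add: sum.delta')
  finally show ?thesis by simp
qed

lemma sum_desc_children:
  assumes u: "u \<in> saws G"
  shows "(\<Sum>c\<in>children G u. desc c) \<le> desc u"
proof -
  have "(\<Sum>c\<in>children G u. desc c) = card (\<Union>c\<in>children G u. {w \<in> saws G. length w = Suc N \<and> prefix c w})"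
    unfolding desc_def
  proof (rule card_UN_disjoint[symmetric])
    show "\<forall>c\<in>children G u. \<forall>d\<in>children G u. c \<noteq> d \<longrightarrow>
      {w \<in> saws G. length w = Suc N \<and> prefix c w} \<inter> {w \<in> saws G. length w = Suc N \<and> prefix d w} = {}"
    proof (intro ballI impI)
      fix c d assume cd: "c \<in> children G u" "d \<in> children G u" "c \<noteq> d"
      have "length c = length d" using cd(1,2) by (auto simp: children_def)
      then have "\<not> (prefix c w \<and> prefix d w)" for w
        using cd(3) by (auto simp: prefix_def)
      then show "{w \<in> saws G. length w = Suc N \<and> prefix c w} \<inter> {w \<in> saws G. length w = Suc N \<and> prefix d w} = {}"
        by blast
    qed
  qed (use finite_children finite_level in auto)
  also have "\<dots> \<le> desc u"
    unfolding desc_def using finite_level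
    by (intro card_mono) (auto simp: children_def dest: append_prefixD)
  finally show ?thesis .
qed

text \<open>The current entering \<open>u\<close> is at least the current leaving it, by
  \<open>sum_desc_children\<close>. The level itself is excluded because the current ends
  there.\<close>

lemma pot_superharmonic:
  assumes u: "u \<in> saws G" "u \<noteq> root" "length u \<noteq> Suc N"
  shows "pot (parent u) + lam * (\<Sum>c\<in>children G u. pot c) \<le> pot u * (1 + real (card (children G u)) * lam)"
proof -
  let ?k = "real (card (children G u))"
  have l0: "length u \<noteq> 0" using saws_not_Nil[OF u(1)] by simp
  have l1: "length u \<noteq> 1" using saws_length_1[OF u(1)] u(2) by blast
  have l2: "length u \<ge> 2" using l0 l1 by arith
  have par: "pot u = pot (parent u) + (if length u \<le> Suc N then (1 / lam) ^ (length u - 1) * real (desc u) else 0)"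
    using pot_snoc[of "parent u" "last u"] saws_snoc_parent[OF u(1)] l2 by (auto simp: parent_def)
  have ch: "pot c = pot u + (if length u \<le> N then (1 / lam) ^ length u * real (desc c) else 0)" if c: "c \<in> children G u" for c
  proof -
    obtain z where "c = u @ [z]" using c by (auto simp: children_def)
    then show ?thesis using pot_snoc[of u z] l2 by simp
  qed
  have sum: "(\<Sum>c\<in>children G u. pot c) = ?k * pot u + (if length u \<le> N then (1 / lam) ^ length u * real (\<Sum>c\<in>children G u. desc c) else 0)"
    by (simp add: ch sum.distrib sum_distrib_left)
  show ?thesis
  proof (cases "length u \<le> N")
    case True
    obtain l where l: "length u = Suc l" using l2 by (cases "length u") auto
    have "lam * ((1 / lam) ^ length u * real (\<Sum>c\<in>children G u. desc c)) = (1 / lam) ^ l * real (\<Sum>c\<in>children G u. desc c)"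
      using lam by (simp add: l)
    also have "\<dots> \<le> (1 / lam) ^ l * real (desc u)"
    proof (rule mult_left_mono)
      show "real (\<Sum>c\<in>children G u. desc c) \<le> real (desc u)"
        by (simp only: of_nat_le_iff sum_desc_children[OF u(1)])
    qed (use lam in simp)
    finally show ?thesis using par sum True l by (simp add: algebra_simps)
  next
    case False
    then show ?thesis using par sum u(3) by (simp add: algebra_simps)
  qed
qed

text \<open>On the level the potential is at least (1/\<lambda>)^N, since each walk there is its own
  descendant, while at a child of the root it has a single term, bounded by the size of the whole
  level.\<close>

lemma reaches_level_le:
  assumes y: "y \<in> children G root" and N: "N \<ge> 1"
  shows "emeasure (RWs G lam y) {X. reaches {w. length w = Suc N} (saws G - {root}) X} \<le>
    ennreal (real (card {w \<in> saws G. length w = Suc N}) * lam ^ (N - 1))"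
proof -
  have ys: "y \<in> saws G" "length y = 2" using y by (auto simp: children_def root_def)
  let ?A = "{w. length w = Suc N}"
  have "emeasure (RWs G lam y) {X. reaches ?A (saws G - {root}) X} \<le>
      emeasure (RWs G lam y) {X. reaches (saws G \<inter> ?A) (saws G - {root}) X}"
  proof (rule emeasure_mono_AE)
    show "{X. reaches (saws G \<inter> ?A) (saws G - {root}) X} \<in> sets (RWs G lam y)"
      by (intro path_event_markov_set path_event_reaches)
    show "AE X in RWs G lam y. X \<in> {X. reaches ?A (saws G - {root}) X} \<longrightarrow> X \<in> {X. reaches (saws G \<inter> ?A) (saws G - {root}) X}"
      using AE_RW_tree_steps[OF lam G ys(1)]
    proof eventually_elim
      case (elim X)
      then show ?case unfolding reaches_def by blast
    qed
  qed
  also have "\<dots> \<le> ennreal (lam ^ N * pot y)"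
  proof (rule emeasure_reaches_le[where h = "\<lambda>u. ennreal (lam ^ N * pot u)"])
    fix u assume u: "u \<in> saws G \<inter> ?A"
    have "desc u \<ge> 1"
    proof -
      have "u \<in> {w \<in> saws G. length w = Suc N \<and> prefix u w}" using u by auto
      then have "{w \<in> saws G. length w = Suc N \<and> prefix u w} \<noteq> {}" by blast
      then have "0 < card {w \<in> saws G. length w = Suc N \<and> prefix u w}"
        using finite_level by (simp only: card_gt_0_iff simp_thms not_False_eq_True)
      then show ?thesis by (simp add: desc_def)
    qed
    then have "(1 / lam) ^ N * 1 \<le> (1 / lam) ^ N * real (desc (take (Suc N) u))"
      using u lam by (intro mult_left_mono) auto
    also have "\<dots> = (if Suc N \<le> length u then (1 / lam) ^ N * real (desc (take (Suc N) u)) else 0)" using u by simp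
    also have "\<dots> \<le> pot u"
      unfolding pot_def using N lam by (intro member_le_sum) auto
    finally have "lam ^ N * ((1 / lam) ^ N * 1) \<le> lam ^ N * pot u"
      using lam by (intro mult_left_mono) auto
    moreover have "lam ^ N * (1 / lam) ^ N = 1"
      using lam by (simp add: power_mult_distrib[symmetric])
    ultimately show "1 \<le> ennreal (lam ^ N * pot u)" by simp
  next
    fix u assume u: "u \<in> saws G - {root}" "u \<notin> saws G \<inter> ?A"
    then have us: "u \<in> saws G" "u \<noteq> root" "length u \<noteq> Suc N" by auto
    have d: "1 + real (card (children G u)) * lam > 0" using lam by (intro add_pos_nonneg) auto
    have "lam ^ N * (pot (parent u) + lam * (\<Sum>c\<in>children G u. pot c)) \<le> lam ^ N * (pot u * (1 + real (card (children G u)) * lam))"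
      using pot_superharmonic[OF us] lam by (intro mult_left_mono) auto
    then have "(lam ^ N * pot (parent u) + lam * (\<Sum>c\<in>children G u. lam ^ N * pot c)) / (1 + real (card (children G u)) * lam) \<le> lam ^ N * pot u"
      using d by (simp add: divide_le_eq algebra_simps sum_distrib_left)
    then show "(\<integral>\<^sup>+y. ennreal (lam ^ N * pot y) \<partial>measure_pmf (RW_step G lam u)) \<le> ennreal (lam ^ N * pot u)"
      using lam pot_nonneg by (subst nn_integral_RW_step[OF lam us(2)]) (auto intro!: ennreal_leI)
  qed
  also have "\<dots> \<le> ennreal (real (card {w \<in> saws G. length w = Suc N}) * lam ^ (N - 1))"
  proof (rule ennreal_leI)
    have "pot root = 0" by (auto simp: pot_def root_def)
    moreover obtain z where "y = root @ [z]" using y by (auto simp: children_def)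
    ultimately have "pot y = (1 / lam) * real (desc y)"
      using pot_snoc[of root z] N by (simp add: root_def)
    then have "lam ^ N * pot y = lam ^ (N - 1) * real (desc y)"
      using N lam by (cases N) auto
    also have "\<dots> \<le> lam ^ (N - 1) * real (card {w \<in> saws G. length w = Suc N})"
      using desc_le lam by (intro mult_left_mono) auto
    finally show "lam ^ N * pot y \<le> real (card {w \<in> saws G. length w = Suc N}) * lam ^ (N - 1)"
      by (simp add: mult.commute)
  qed
  finally show ?thesis .
qed

end

text \<open>The probability of never returning to the root is positive by transience, and for each
  \<open>N\<close> it is at most the number of walks with \<open>N\<close> steps times
  \<open>lam ^ (N - 1)\<close>.\<close>

theorem transient_growth:
  assumes lam: "lam > 0" and G: "G \<in> {UNIV, half_plane}" and tr: "RW_transient G lam"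
  obtains \<delta> where "\<delta> > 0"
    "\<And>N. N \<ge> 1 \<Longrightarrow> \<delta> \<le> real (card {w \<in> saws G. length w = Suc N}) * lam ^ N"
proof -
  have ev: "path_event (\<lambda>X. \<exists>n. X (Suc n) = root)" by (intro path_event_intros)
  have ev': "path_event (\<lambda>X. \<forall>n. X (Suc n) \<noteq> root)" by (intro path_event_intros)
  define \<rho> where "\<rho> = emeasure (RWs G lam root) {X. \<forall>n. X (Suc n) \<noteq> root}"
  have "\<rho> = 1 - emeasure (RWs G lam root) {X. \<exists>n. X (Suc n) = root}"
    unfolding \<rho>_def using emeasure_markov_compl[OF ev, of root "RW_step G lam"] by simp
  then have pos: "\<rho> > 0"
    using transient_return_lt_1[OF tr] by (simp add: diff_gr0_ennreal)
  have "\<rho> \<le> 1" unfolding \<rho>_def by (rule emeasure_markov_le_1)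
  then obtain r where r: "\<rho> = ennreal r" "0 \<le> r" by (cases \<rho>) (auto simp: top_unique)
  have "r > 0" using pos r by simp
  have bound: "r \<le> real (card {w \<in> saws G. length w = Suc N}) * lam ^ (N - 1)" if N: "N \<ge> 1" for N
  proof -
    interpret level_count G lam N using G lam by unfold_locales
    let ?c = "real (card {w \<in> saws G. length w = Suc N}) * lam ^ (N - 1)"
    have "\<rho> = (\<integral>\<^sup>+y. emeasure (RWs G lam y) {X. \<forall>n. X n \<noteq> root} \<partial>measure_pmf (RW_step G lam root))"
      unfolding \<rho>_def by (subst emeasure_markov_first_step[OF ev']) simp
    also have "\<dots> \<le> (\<integral>\<^sup>+y. ennreal ?c \<partial>measure_pmf (RW_step G lam root))"
    proof (rule nn_integral_mono_AE, rule AE_pmfI)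
      fix y assume "y \<in> set_pmf (RW_step G lam root)"
      then have y: "y \<in> children G root"
        using children_root_nonempty[OF G] finite_children[of G root] by (simp add: RW_step_def)
      then have "y \<in> saws G" "length y = 2" by (auto simp: children_def root_def)
      then show "emeasure (RWs G lam y) {X. \<forall>n. X n \<noteq> root} \<le> ennreal ?c"
        using order_trans[OF avoid_root_reaches_level[OF lam G] reaches_level_le[OF y N]] N by simp
    qed
    also have "\<dots> = ennreal ?c" by (simp add: measure_pmf.emeasure_space_1[unfolded space_measure_pmf])
    finally show ?thesis using r lam by (simp add: ennreal_le_iff)
  qed
  show ?thesis
  proof (rule that[of "r * lam"])
    show "r * lam > 0" using \<open>r > 0\<close> lam by simp
    fix N :: nat assume N: "N \<ge> 1"
    then have "r * lam \<le> (real (card {w \<in> saws G. length w = Suc N}) * lam ^ (N - 1)) * lam"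
      using bound lam by (intro mult_right_mono) auto
    then show "r * lam \<le> real (card {w \<in> saws G. length w = Suc N}) * lam ^ N"
      using N by (cases N) (auto simp: mult_ac)
  qed
qed

section \<open>The Hammersley--Welsh decomposition\<close>

context
  fixes x :: real
  assumes x: "x > 0"
begin

definition weight :: "site list \<Rightarrow> real" where
  "weight w = x ^ (length w - 1)"

text \<open>\<open>N\<close> bounds the number of steps and \<open>a\<close> the width; the
  truncation at \<open>N\<close> makes all generating functions finite sums.\<close>

definition half_space :: "nat \<Rightarrow> nat \<Rightarrow> site list set" where
  "half_space N a = {w \<in> saws UNIV. length w \<le> Suc N \<and> (\<forall>p\<in>set (tl w). 0 < fst p \<and> fst p \<le> int a)}"

text \<open>Bridges that end exactly in column \<open>a\<close>, so that different widths give
  disjoint sets.\<close>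

definition spanning :: "nat \<Rightarrow> nat \<Rightarrow> site list set" where
  "spanning N a = {w \<in> saws UNIV. length w \<le> Suc N \<and> tl w \<noteq> [] \<and> (\<forall>p\<in>set (tl w). 0 < fst p \<and> fst p \<le> int a) \<and> fst (last w) = int a}"

lemma weight_nonneg: "0 \<le> weight w"
  using x by (simp add: weight_def)

lemma finite_half_space: "finite (half_space N a)" and finite_spanning: "finite (spanning N a)"
  by (rule finite_subset[OF _ finite_saws_length[of UNIV "Suc N"]]; auto simp: half_space_def spanning_def)+

definition mirror_at :: "site \<Rightarrow> site \<Rightarrow> site" where
  "mirror_at q p = (fst q - fst p, snd q + snd p)"

lemma saws_UNIV_iff: "w \<in> saws UNIV \<longleftrightarrow> w \<noteq> [] \<and> hd w = (0, 0) \<and> distinct w \<and> successively nbr w"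
  by (auto simp: saws_def)

lemma segment_in_saws:
  assumes "successively nbr (q # r)" "distinct (q # r)" "isometry \<psi>" "\<psi> q = (0, 0)"
  shows "(0, 0) # map \<psi> r \<in> saws UNIV"
proof -
  have "(0, 0) # map \<psi> r = map \<psi> (q # r)" using assms(4) by simp
  moreover have "map \<psi> (q # r) \<in> saws UNIV"
    unfolding saws_UNIV_iff
    using assms inj_on_subset[OF isometry_inj[OF assms(3)] subset_UNIV]
    by (simp only: successively_map_isometry distinct_map) simp
  ultimately show ?thesis by simp
qed

lemma half_space_0: "half_space N 0 = {[(0, 0)]}"
proof
  show "half_space N 0 \<subseteq> {[(0, 0)]}"
  proof
    fix w assume w: "w \<in> half_space N 0"
    then have "w \<noteq> []" "hd w = (0, 0)" "\<forall>p\<in>set (tl w). 0 < fst p \<and> fst p \<le> 0"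
      by (auto simp: half_space_def saws_UNIV_iff)
    moreover from this have "tl w = []" by (cases "tl w") auto
    ultimately show "w \<in> {[(0, 0)]}" by (cases w) auto
  qed
qed (auto simp: half_space_def saws_UNIV_iff)

text \<open>The cut is at the last visit to the farthest column \<open>Suc a\<close>. The first
  piece is a bridge, and the rest never returns to this column; mirrored at the cut, it is a
  half-space walk of width at most \<open>a\<close>. Hence the widths of successive bridges strictly
  decrease.\<close>

lemma half_space_split:
  assumes w: "w \<in> half_space N (Suc a)" "w \<notin> half_space N a"
  shows "\<exists>\<beta> r. \<beta> \<in> spanning N (Suc a) \<and> r \<in> half_space N a \<and>
    w = \<beta> @ map (mirror_at (last \<beta>)) (tl r)"
proof -
  let ?A = "int (Suc a)"
  have ws: "w \<noteq> []" "hd w = (0, 0)" "distinct w" "successively nbr w" "length w \<le> Suc N"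
    and wx: "\<And>p. p \<in> set (tl w) \<Longrightarrow> 0 < fst p \<and> fst p \<le> ?A"
    using w(1) by (auto simp: half_space_def saws_UNIV_iff)
  have "\<exists>p\<in>set (tl w). fst p = ?A"
  proof (rule ccontr)
    assume no: "\<not> ?thesis"
    have "0 < fst p \<and> fst p \<le> int a" if "p \<in> set (tl w)" for p using wx[OF that] no that by force
    then show False using w by (auto simp: half_space_def)
  qed
  then have "\<exists>p\<in>set w. fst p = ?A" using ws(1) by (metis list.set_sel(2))
  then obtain ys q zs where split: "w = ys @ q # zs" "fst q = ?A" "\<forall>z\<in>set zs. fst z \<noteq> ?A"
    by (rule split_list_last_propE)
  have ysne: "ys \<noteq> []" using split(1,2) ws(2) by (cases ys) auto
  define \<beta> where "\<beta> = ys @ [q]"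
  have w\<beta>: "w = \<beta> @ zs" by (simp add: \<beta>_def split(1))
  have tlw: "tl w = tl \<beta> @ zs" using ysne by (simp add: \<beta>_def split(1))
  have zx: "0 < fst z \<and> fst z \<le> int a" if "z \<in> set zs" for z
    using wx[of z] split(3) that tlw by force
  have \<beta>: "\<beta> \<in> spanning N (Suc a)"
    using ws wx split(2) ysne tlw unfolding spanning_def saws_UNIV_iff
    by (auto simp: \<beta>_def split(1) successively_append_iff)
  define pull where "pull p = (fst q - fst p, snd p - snd q)" for p :: site
  have pull: "mirror_at q (pull p) = p" for p by (simp add: mirror_at_def pull_def)
  have iso: "isometry pull"
    unfolding isometry_def
  proof (intro conjI allI)
    show "bij pull" by (rule o_bij[of "mirror_at q"]) (auto simp: mirror_at_def pull_def fun_eq_iff)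
  qed (auto simp: pull_def nbr_def)
  define r where "r = (0, 0) # map pull zs"
  have "successively nbr (q # zs)" "distinct (q # zs)" using ws split(1) by (auto simp: successively_append_iff)
  then have "r \<in> saws UNIV" unfolding r_def by (rule segment_in_saws[OF _ _ iso]) (simp add: pull_def)
  moreover have "length r \<le> Suc N" using ws(5) split(1) ysne by (cases ys) (auto simp: r_def)
  moreover have "0 < fst p \<and> fst p \<le> int a" if pr: "p \<in> set (tl r)" for p
  proof -
    obtain z where z: "z \<in> set zs" "p = pull z" using pr by (auto simp: r_def)
    show ?thesis using zx[OF z(1)] split(2) by (simp add: z(2) pull_def)
  qed
  ultimately have "r \<in> half_space N a" by (simp add: half_space_def)
  moreover have "w = \<beta> @ map (mirror_at (last \<beta>)) (tl r)"
    by (simp add: w\<beta> r_def o_def pull) (simp add: \<beta>_def pull)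
  ultimately show ?thesis using \<beta> by blast
qed

text \<open>Either the walk already has width at most \<open>a\<close>, or it splits. The weight is
  multiplicative, since \<open>tl r\<close> counts the common site of the two pieces only
  once.\<close>

lemma half_space_sum_step:
  "(\<Sum>w\<in>half_space N (Suc a). weight w) \<le>
   (\<Sum>w\<in>half_space N a. weight w) * (1 + (\<Sum>w\<in>spanning N (Suc a). weight w))"
proof -
  let ?j = "\<lambda>(\<beta>, r). \<beta> @ map (mirror_at (last \<beta>)) (tl r)"
  let ?P = "spanning N (Suc a) \<times> half_space N a"
  have sub: "half_space N (Suc a) \<subseteq> half_space N a \<union> ?j ` ?P"
  proof
    fix w assume w: "w \<in> half_space N (Suc a)"
    show "w \<in> half_space N a \<union> ?j ` ?P"
    proof (cases "w \<in> half_space N a")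
      case False
      from half_space_split[OF w False] obtain \<beta> r where "\<beta> \<in> spanning N (Suc a)" "r \<in> half_space N a"
        "w = \<beta> @ map (mirror_at (last \<beta>)) (tl r)" by blast
      then have "w = ?j (\<beta>, r)" "(\<beta>, r) \<in> ?P" by simp_all
      then show ?thesis by blast
    qed simp
  qed
  have finP: "finite ?P" by (simp add: finite_half_space finite_spanning)
  have "(\<Sum>w\<in>half_space N (Suc a). weight w) \<le> (\<Sum>w\<in>half_space N a \<union> ?j ` ?P. weight w)"
    using sub finP finite_half_space weight_nonneg by (intro sum_mono2) auto
  also have "\<dots> \<le> (\<Sum>w\<in>half_space N a. weight w) + (\<Sum>w\<in>?j ` ?P. weight w)"
    using finP finite_half_space weight_nonneg by (subst sum_Un) (auto intro!: sum_nonneg)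
  also have "(\<Sum>w\<in>?j ` ?P. weight w) \<le> (\<Sum>z\<in>?P. weight (?j z))"
    using sum_image_le[OF finP, of weight ?j] weight_nonneg by (simp add: o_def)
  also have "(\<Sum>z\<in>?P. weight (?j z)) = (\<Sum>z\<in>?P. weight (fst z) * weight (snd z))"
  proof (rule sum.cong[OF refl])
    fix z assume z: "z \<in> ?P"
    obtain \<beta> r where zz: "z = (\<beta>, r)" by (cases z)
    have "length \<beta> \<ge> 1" "length r \<ge> 1"
      using z zz by (auto simp: spanning_def half_space_def saws_UNIV_iff Suc_le_eq)
    then show "weight (?j z) = weight (fst z) * weight (snd z)"
      by (simp add: zz weight_def power_add[symmetric])
  qed
  also have "\<dots> = (\<Sum>\<beta>\<in>spanning N (Suc a). weight \<beta>) * (\<Sum>r\<in>half_space N a. weight r)"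
    by (simp add: sum_product sum.cartesian_product case_prod_beta)
  finally show ?thesis by (simp add: algebra_simps)
qed

text \<open>Each width is used at most once, which gives a product of factors 1 + B, with B the
  weight of the bridges of one width, and each factor is at most exp B.\<close>

lemma half_space_sum_le:
  "(\<Sum>w\<in>half_space N a. weight w) \<le> exp (\<Sum>i\<in>{1..a}. \<Sum>w\<in>spanning N i. weight w)"
proof (induction a)
  case 0
  then show ?case by (simp add: half_space_0 weight_def)
next
  case (Suc a)
  let ?b = "\<Sum>w\<in>spanning N (Suc a). weight w"
  have b: "0 \<le> ?b" using weight_nonneg by (intro sum_nonneg) auto
  have "(\<Sum>w\<in>half_space N (Suc a). weight w) \<le> (\<Sum>w\<in>half_space N a. weight w) * (1 + ?b)"
    by (rule half_space_sum_step)
  also have "\<dots> \<le> exp (\<Sum>i\<in>{1..a}. \<Sum>w\<in>spanning N i. weight w) * exp ?b"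
    using Suc.IH b exp_ge_add_one_self[of ?b] by (intro mult_mono) auto
  finally show ?case by (simp add: exp_add[symmetric] add.commute)
qed

text \<open>Bridges of different widths are different walks, and each has between 1 and
  \<open>N\<close> steps, so the sum over widths can be regrouped by length.\<close>

lemma spanning_sum_le:
  "(\<Sum>i\<in>{1..a}. \<Sum>w\<in>spanning N i. weight w) \<le> (\<Sum>n\<in>{1..N}. real (card (bridges n)) * x ^ n)"
proof -
  have "(\<Sum>i\<in>{1..a}. \<Sum>w\<in>spanning N i. weight w) = (\<Sum>w\<in>(\<Union>i\<in>{1..a}. spanning N i). weight w)"
    by (rule sum.UNION_disjoint[symmetric]) (simp_all add: finite_spanning, auto simp: spanning_def)
  also have "\<dots> \<le> (\<Sum>w\<in>(\<Union>n\<in>{1..N}. bridges n). weight w)"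
  proof (rule sum_mono2)
    show "(\<Union>i\<in>{1..a}. spanning N i) \<subseteq> (\<Union>n\<in>{1..N}. bridges n)"
    proof
      fix w assume "w \<in> (\<Union>i\<in>{1..a}. spanning N i)"
      then obtain i where w: "w \<in> spanning N i" by blast
      then have "tl w \<noteq> []" "length w \<le> Suc N" by (auto simp: spanning_def)
      then have "length w - 1 \<in> {1..N}" by (cases w) (auto simp: Suc_le_eq)
      moreover have "w \<in> bridges (length w - 1)"
        using w by (auto simp: spanning_def bridges_def saws_UNIV_iff)
      ultimately show "w \<in> (\<Union>n\<in>{1..N}. bridges n)" by blast
    qed
  qed (auto simp: finite_bridges weight_nonneg)
  also have "\<dots> = (\<Sum>n\<in>{1..N}. \<Sum>w\<in>bridges n. weight w)"
    by (rule sum.UNION_disjoint) (simp_all add: finite_bridges, auto simp: bridges_def)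
  also have "\<dots> = (\<Sum>n\<in>{1..N}. real (card (bridges n)) * x ^ n)"
  proof (rule sum.cong[OF refl])
    fix n
    have "(\<Sum>w\<in>bridges n. weight w) = (\<Sum>w\<in>bridges n. x ^ n)"
      by (intro sum.cong) (auto simp: weight_def bridges_def)
    then show "(\<Sum>w\<in>bridges n. weight w) = real (card (bridges n)) * x ^ n" by simp
  qed
  finally show ?thesis .
qed

section \<open>Arbitrary walks as pairs of half-space walks\<close>

lemma walk_displacement_fst:
  "successively nbr \<beta> \<Longrightarrow> i < length \<beta> \<Longrightarrow> \<bar>fst (\<beta> ! i) - fst (\<beta> ! 0)\<bar> \<le> int i"
proof (induction i)
  case (Suc i)
  have "nbr (\<beta> ! i) (\<beta> ! Suc i)" using Suc.prems by (simp add: successively_conv_nth)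
  then have "\<bar>fst (\<beta> ! Suc i) - fst (\<beta> ! i)\<bar> \<le> 1" by (auto simp: nbr_def)
  moreover have "\<bar>fst (\<beta> ! i) - fst (\<beta> ! 0)\<bar> \<le> int i" using Suc by simp
  ultimately show ?case by simp
qed simp

lemma half_space_intro:
  assumes "w \<in> saws UNIV" "length w \<le> Suc N" "\<And>p. p \<in> set (tl w) \<Longrightarrow> 0 < fst p"
  shows "w \<in> half_space N N"
proof -
  have "fst p \<le> int N" if p: "p \<in> set (tl w)" for p
  proof -
    have ws: "w \<noteq> []" "hd w = (0, 0)" "successively nbr w" using assms(1) by (auto simp: saws_UNIV_iff)
    then have "p \<in> set w" using p by (metis list.set_sel(2))
    then obtain i where i: "i < length w" "p = w ! i" by (metis in_set_conv_nth)
    then show ?thesis using walk_displacement_fst[OF ws(3) i(1)] ws assms(2) by (simp add: hd_conv_nth)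
  qed
  then show ?thesis using assms by (simp add: half_space_def)
qed

text \<open>Rebuilds a walk from its two pieces. The endpoint of \<open>h\<close> records where the
  cut lies, so the pair determines the walk; this gives the injectivity in
  \<open>saws_sum_le\<close>.\<close>

definition join :: "site list \<Rightarrow> site list \<Rightarrow> site list" where
  "join h k = rev (map (shift (- fst (last h), - snd (last h))) (tl h)) @
     map (shift (1 - fst (last h), - snd (last h))) (tl k)"

text \<open>
  A walk is cut at its last leftmost site. The piece before that site is reversed and preceded by
  one more step to the right, which turns it into a half-space walk.
\<close>

lemma saw_join:
  assumes w: "w \<in> saws UNIV" "length w \<le> Suc N"
  shows "\<exists>h\<in>half_space (Suc N) (Suc N). \<exists>k\<in>half_space (Suc N) (Suc N).
    w = join h k \<and> x * weight w = weight h * weight k"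
proof -
  have ws: "w \<noteq> []" "hd w = (0, 0)" "distinct w" "successively nbr w"
    using w(1) by (auto simp: saws_UNIV_iff)
  define m where "m = Min (fst ` set w)"
  have m: "m \<in> fst ` set w" "\<And>p. p \<in> set w \<Longrightarrow> m \<le> fst p"
    using ws(1) unfolding m_def by (auto intro: Min_in)
  then have "\<exists>p\<in>set w. fst p = m" by force
  then obtain ys q zs where split: "w = ys @ q # zs" "fst q = m" "\<forall>z\<in>set zs. fst z \<noteq> m"
    by (rule split_list_last_propE)
  define u where "u = ys @ [q]"
  have wu: "w = u @ zs" by (simp add: u_def split(1))
  have ru: "rev u = q # rev ys" by (simp add: u_def)
  \<comment> \<open>The cut is moved to (1, 0), which leaves the origin for the added step. This
    step is the factor \<open>x\<close> in front of \<open>weight w\<close>.\<close>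
  define \<phi> where "\<phi> = shift (1 - fst q, - snd q)"
  define \<psi> where "\<psi> = shift (- fst q, - snd q)"
  define h where "h = (0, 0) # map \<phi> (rev u)"
  define k where "k = (0, 0) # map \<psi> zs"
  have ndist: "nbr a b \<longleftrightarrow> nbr b a" for a b by (rule nbr_commute)
  have "successively nbr u" using ws(4) by (simp add: wu successively_append_iff)
  then have sru: "successively nbr (rev u)"
    unfolding successively_rev using ndist by (simp add: successively_conv_nth)
  have hs: "h \<in> saws UNIV"
  proof -
    have "successively nbr (map \<phi> (rev u))" using sru by (simp add: \<phi>_def successively_map_isometry[OF isometry_shift])
    moreover have "hd (map \<phi> (rev u)) = (1, 0)" by (simp add: ru \<phi>_def shift_def)
    ultimately have "successively nbr h"
      using ru by (simp add: h_def successively_Cons nbr_def)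
    moreover have "distinct (map \<phi> (rev u))"
      using ws(3) inj_on_subset[OF isometry_inj[OF isometry_shift] subset_UNIV]
      by (simp add: wu \<phi>_def distinct_map)
    moreover have "(0, 0) \<notin> set (map \<phi> (rev u))"
    proof
      assume "(0, 0) \<in> set (map \<phi> (rev u))"
      then obtain p where "p \<in> set u" "\<phi> p = (0, 0)" by auto
      then show False using m(2)[of p] split(2) by (auto simp: wu \<phi>_def shift_def)
    qed
    ultimately show ?thesis by (simp add: saws_UNIV_iff h_def)
  qed
  have hh: "h \<in> half_space (Suc N) (Suc N)"
  proof (rule half_space_intro[OF hs])
    show "length h \<le> Suc (Suc N)" using w(2) by (simp add: h_def wu)
    fix p assume "p \<in> set (tl h)"
    then obtain p' where "p' \<in> set u" "p = \<phi> p'" by (auto simp: h_def)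
    then show "0 < fst p" using m(2)[of p'] split(2) by (auto simp: wu \<phi>_def shift_def)
  qed
  have "successively nbr (q # zs)" "distinct (q # zs)" using ws split(1) by (auto simp: successively_append_iff)
  then have ks: "k \<in> saws UNIV"
    unfolding k_def by (rule segment_in_saws) (simp_all add: \<psi>_def isometry_shift, simp add: shift_def)
  have kk: "k \<in> half_space (Suc N) (Suc N)"
  proof (rule half_space_intro[OF ks])
    show "length k \<le> Suc (Suc N)" using w(2) by (simp add: k_def wu)
    fix p assume "p \<in> set (tl k)"
    then obtain p' where "p' \<in> set zs" "p = \<psi> p'" by (auto simp: k_def)
    then show "0 < fst p" using m(2)[of p'] split by (force simp: wu \<psi>_def shift_def)
  qed
  have une: "u \<noteq> []" by (simp add: u_def)
  have hdu: "hd u = (0, 0)" using ws(2) une by (simp add: wu)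
  have "last h = \<phi> (0, 0)"
    using une hdu by (simp add: h_def last_map last_rev)
  then have lh: "fst (last h) = 1 - fst q" "snd (last h) = - snd q" by (simp_all add: \<phi>_def shift_def)
  have inv1: "shift (- fst (last h), - snd (last h)) \<circ> \<phi> = id"
    unfolding lh by (auto simp: \<phi>_def shift_def fun_eq_iff)
  have inv2: "shift (1 - fst (last h), - snd (last h)) \<circ> \<psi> = id"
    unfolding lh by (auto simp: \<psi>_def shift_def fun_eq_iff)
  have "w = join h k"
    unfolding join_def by (simp add: h_def[THEN arg_cong[where f = tl]] k_def[THEN arg_cong[where f = tl]]
        inv1 inv2 wu)
  moreover have "x * weight w = weight h * weight k"
    using une by (simp add: weight_def h_def k_def wu power_add[symmetric] flip: power_Suc)
  ultimately show ?thesis using hh kk by blast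
qed

text \<open>Walks are coded injectively by pairs of half-space walks; the bound \<open>Suc N\<close>
  on the bridge lengths comes from the added step.\<close>

lemma saws_sum_le:
  "x * (\<Sum>w\<in>{w \<in> saws UNIV. length w \<le> Suc N}. weight w) \<le>
    exp (\<Sum>n\<in>{1..Suc N}. real (card (bridges n)) * x ^ n) ^ 2"
proof -
  let ?S = "{w \<in> saws UNIV. length w \<le> Suc N}"
  let ?H = "half_space (Suc N) (Suc N)"
  have "\<forall>w\<in>?S. \<exists>z. z \<in> ?H \<times> ?H \<and> w = join (fst z) (snd z) \<and> x * weight w = weight (fst z) * weight (snd z)"
  proof
    fix w assume wS: "w \<in> ?S"
    have "w \<in> saws UNIV" "length w \<le> Suc N" using wS by auto
    from saw_join[OF this] obtain h k where hk: "h \<in> ?H" "k \<in> ?H" "w = join h k"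
      "x * weight w = weight h * weight k" by blast
    show "\<exists>z. z \<in> ?H \<times> ?H \<and> w = join (fst z) (snd z) \<and> x * weight w = weight (fst z) * weight (snd z)"
      using hk by (intro exI[of _ "(h, k)"]) (simp only: fst_conv snd_conv mem_Times_iff simp_thms)
  qed
  from bchoice[OF this] obtain hk where hk_all:
    "\<forall>w\<in>?S. hk w \<in> ?H \<times> ?H \<and> w = join (fst (hk w)) (snd (hk w)) \<and> x * weight w = weight (fst (hk w)) * weight (snd (hk w))"
    by blast
  then have hk: "hk w \<in> ?H \<times> ?H" and join_hk: "join (fst (hk w)) (snd (hk w)) = w"
    and weight_hk: "x * weight w = weight (fst (hk w)) * weight (snd (hk w))" if wS: "w \<in> ?S" for w
    using bspec[OF hk_all wS] by metis+
  have inj: "inj_on hk ?S" by (rule inj_on_inverseI[where g = "\<lambda>z. join (fst z) (snd z)"]) (rule join_hk)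
  have "x * (\<Sum>w\<in>?S. weight w) = (\<Sum>w\<in>?S. weight (fst (hk w)) * weight (snd (hk w)))"
    unfolding sum_distrib_left by (rule sum.cong[OF refl weight_hk])
  also have "\<dots> = (\<Sum>z\<in>hk ` ?S. weight (fst z) * weight (snd z))"
    by (simp add: sum.reindex[OF inj])
  also have "\<dots> \<le> (\<Sum>z\<in>?H \<times> ?H. weight (fst z) * weight (snd z))"
  proof (rule sum_mono2)
    show "hk ` ?S \<subseteq> ?H \<times> ?H" using hk by (rule image_subsetI)
  qed (simp_all add: weight_nonneg finite_half_space)
  also have "\<dots> = (\<Sum>w\<in>?H. weight w) * (\<Sum>w\<in>?H. weight w)"
    by (simp add: sum_product sum.cartesian_product case_prod_beta)
  also have "\<dots> \<le> exp (\<Sum>n\<in>{1..Suc N}. real (card (bridges n)) * x ^ n) * exp (\<Sum>n\<in>{1..Suc N}. real (card (bridges n)) * x ^ n)"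
  proof -
    have le: "(\<Sum>w\<in>?H. weight w) \<le> exp (\<Sum>n\<in>{1..Suc N}. real (card (bridges n)) * x ^ n)"
      by (rule order_trans[OF half_space_sum_le]) (simp only: exp_le_cancel_iff spanning_sum_le)
    show ?thesis using le weight_nonneg by (intro mult_mono) (auto intro: sum_nonneg)
  qed
  finally show ?thesis by (simp add: power2_eq_square)
qed

end

text \<open>Otherwise the bridge series at a transient parameter x strictly between the critical
  value and \<lambda> is dominated by a geometric series of ratio x/\<lambda>. By the decomposition
  the series of all walks is then bounded, although each of its terms from length 1 on is at least
  \<delta>. The walks in \<open>G\<close> are among those in the plane, so plane bridges serve both
  cases.\<close>

theorem many_bridges:
  assumes G: "G \<in> {UNIV, half_plane}" and lam: "ennreal lam > lambda_c G"
  shows "\<exists>n\<ge>1. 4 \<le> real (card (bridges n)) * lam ^ n"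
proof (rule ccontr)
  assume no: "\<not> ?thesis"
  obtain y where y: "lambda_c G < y" "y < ennreal lam" using dense[OF lam] by blast
  then obtain x where xy: "y = ennreal x" "0 \<le> x" by (cases y) auto
  have xc: "lambda_c G < ennreal x" using y xy by simp
  have x: "x > 0" and tr: "RW_transient G x" using RW_transient_if_gt_lambda_c[OF xc] by auto
  have xl: "x < lam" using y(2) xy by (simp add: ennreal_less_iff)
  obtain \<delta> where \<delta>: "\<delta> > 0" "\<And>N. N \<ge> 1 \<Longrightarrow> \<delta> \<le> real (card {w \<in> saws G. length w = Suc N}) * x ^ N"
  proof (rule transient_growth[OF x G tr])
    fix \<delta> assume "\<delta> > 0" "\<And>N. N \<ge> 1 \<Longrightarrow> \<delta> \<le> real (card {w \<in> saws G. length w = Suc N}) * x ^ N"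
    then show thesis by (rule that)
  qed
  define q where "q = x / lam"
  have q: "0 < q" "q < 1" using x xl by (auto simp: q_def)
  have few: "real (card (bridges n)) * x ^ n \<le> 4 * q ^ n" if "n \<ge> 1" for n
  proof -
    have "real (card (bridges n)) * lam ^ n < 4" using no that by (meson not_le)
    then have "(real (card (bridges n)) * lam ^ n) * q ^ n \<le> 4 * q ^ n" using q by (intro mult_right_mono) auto
    moreover have "lam ^ n * q ^ n = x ^ n" using x xl by (simp add: power_mult_distrib[symmetric] q_def)
    ultimately show ?thesis by (simp add: mult.assoc)
  qed
  define B where "B = 4 * (1 / (1 - q))"
  have sumB: "(\<Sum>n\<in>{1..N}. real (card (bridges n)) * x ^ n) \<le> B" for N
  proof -
    have "(\<Sum>n\<in>{1..N}. real (card (bridges n)) * x ^ n) \<le> (\<Sum>n\<in>{1..N}. 4 * q ^ n)"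
      using few by (intro sum_mono) auto
    also have "\<dots> \<le> 4 * (\<Sum>n<Suc N. q ^ n)"
      unfolding sum_distrib_left[symmetric] using q by (intro mult_left_mono sum_mono2) auto
    also have "(\<Sum>n<Suc N. q ^ n) \<le> 1 / (1 - q)"
      using q by (subst sum_gp_strict) (auto intro!: divide_right_mono)
    finally show ?thesis by (simp add: B_def)
  qed
  have "real N * (x * \<delta>) \<le> exp B ^ 2" for N
  proof -
    have fin: "finite {w \<in> saws UNIV. length w \<le> Suc N}" by (rule finite_saws_length)
    have GU: "{w \<in> saws G. length w = Suc n} \<subseteq> {w \<in> saws UNIV. length w = Suc n}" for n by (auto simp: saws_def)
    have cn: "\<delta> \<le> (\<Sum>w\<in>{w \<in> saws UNIV. length w = Suc n}. weight x w)" if "n \<ge> 1" for n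
    proof -
      have f: "finite {w \<in> saws UNIV. length w = Suc n}"
        by (rule finite_subset[OF _ finite_saws_length[of UNIV "Suc n"]]) auto
      have "\<delta> \<le> real (card {w \<in> saws G. length w = Suc n}) * x ^ n" by (rule \<delta>(2)[OF that])
      also have "\<dots> \<le> real (card {w \<in> saws UNIV. length w = Suc n}) * x ^ n"
        using card_mono[OF f GU] x by (intro mult_right_mono) auto
      also have "\<dots> = (\<Sum>w\<in>{w \<in> saws UNIV. length w = Suc n}. x ^ n)" by simp
      also have "\<dots> = (\<Sum>w\<in>{w \<in> saws UNIV. length w = Suc n}. weight x w)"
        by (intro sum.cong) (auto simp: weight_def[OF x])
      finally show ?thesis .
    qed
    have "real N * \<delta> = (\<Sum>n\<in>{1..N}. \<delta>)" by simp
    also have "\<dots> \<le> (\<Sum>n\<in>{1..N}. \<Sum>w\<in>{w \<in> saws UNIV. length w = Suc n}. weight x w)"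
      using cn by (intro sum_mono) auto
    also have "\<dots> = (\<Sum>w\<in>(\<Union>n\<in>{1..N}. {w \<in> saws UNIV. length w = Suc n}). weight x w)"
      by (rule sum.UNION_disjoint[symmetric]) (auto intro: finite_subset[OF _ finite_saws_length[of UNIV]])
    also have "\<dots> \<le> (\<Sum>w\<in>{w \<in> saws UNIV. length w \<le> Suc N}. weight x w)"
      using fin weight_nonneg[OF x] by (intro sum_mono2) auto
    finally have "x * (real N * \<delta>) \<le> x * (\<Sum>w\<in>{w \<in> saws UNIV. length w \<le> Suc N}. weight x w)"
      using x by (intro mult_left_mono) auto
    also have "\<dots> \<le> exp (\<Sum>n\<in>{1..Suc N}. real (card (bridges n)) * x ^ n) ^ 2"
      by (rule saws_sum_le[OF x])
    also have "\<dots> \<le> exp B ^ 2" using sumB[of "Suc N"] by (intro power_mono) simp_all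
    finally show ?thesis by (simp add: mult_ac)
  qed
  moreover have "x * \<delta> > 0" using x \<delta>(1) by simp
  ultimately show False
    using reals_Archimedean3[of "x * \<delta>"] by (metis not_less)
qed

section \<open>A planar separation lemma\<close>

text \<open>
  The number of vertical edges of a path \<open>P\<close> that cross the half-line to the left of the point
  \<open>(x, y + 1/2)\<close>. Its parity tells on which side of \<open>P\<close> the site \<open>(x, y)\<close> lies.
\<close>

definition crossings :: "site list \<Rightarrow> site \<Rightarrow> nat" where
  "crossings P s = card {i. Suc i < length P \<and> fst (P ! i) = fst (P ! Suc i) \<and> fst (P ! i) < fst s \<and>
     (snd (P ! i) = snd s \<and> snd (P ! Suc i) = snd s + 1 \<or> snd (P ! i) = snd s + 1 \<and> snd (P ! Suc i) = snd s)}"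

lemma finite_crossings: "finite {i. Suc i < length P \<and> Q i}"
  by (rule finite_subset[of _ "{..<length P}"]) auto

lemma even_card_changes:
  fixes g :: "nat \<Rightarrow> bool"
  shows "even (card {i. i < n \<and> g i \<noteq> g (Suc i)}) \<longleftrightarrow> g 0 = g n"
proof (induction n)
  case (Suc n)
  have "{i. i < Suc n \<and> g i \<noteq> g (Suc i)} = {i. i < n \<and> g i \<noteq> g (Suc i)} \<union> (if g n \<noteq> g (Suc n) then {n} else {})"
    by (auto simp: less_Suc_eq)
  then show ?case using Suc.IH by (auto simp: card_insert_if)
qed simp

lemma successively_nbr_nth:
  "successively nbr P \<Longrightarrow> Suc i < length P \<Longrightarrow> nbr (P ! i) (P ! Suc i)"
  by (simp add: successively_conv_nth)

text \<open>An edge counted only for \<open>x + 1\<close> would lie in column \<open>x\<close> and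
  have \<open>(x, y)\<close> as an end.\<close>

lemma crossings_horizontal:
  assumes "successively nbr P" "(x, y) \<notin> set P"
  shows "crossings P (x, y) = crossings P (x + 1, y)"
proof -
  have "fst (P ! i) \<noteq> x" if "Suc i < length P" "fst (P ! i) = fst (P ! Suc i)"
    "snd (P ! i) = y \<and> snd (P ! Suc i) = y + 1 \<or> snd (P ! i) = y + 1 \<and> snd (P ! Suc i) = y" for i
  proof
    assume "fst (P ! i) = x"
    then have "P ! i = (x, y) \<or> P ! Suc i = (x, y)" using that by (auto simp: prod_eq_iff)
    then show False using assms(2) that(1) by (metis Suc_lessD nth_mem)
  qed
  then have "{i. Suc i < length P \<and> fst (P ! i) = fst (P ! Suc i) \<and> fst (P ! i) < x \<and>
       (snd (P ! i) = y \<and> snd (P ! Suc i) = y + 1 \<or> snd (P ! i) = y + 1 \<and> snd (P ! Suc i) = y)} =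
     {i. Suc i < length P \<and> fst (P ! i) = fst (P ! Suc i) \<and> fst (P ! i) < x + 1 \<and>
       (snd (P ! i) = y \<and> snd (P ! Suc i) = y + 1 \<or> snd (P ! i) = y + 1 \<and> snd (P ! Suc i) = y)}"
    by (intro Collect_cong) (metis zless_add1_eq)
  then show ?thesis by (simp add: crossings_def)
qed

lemma crossing_edge_iff:
  fixes a b c d x y :: int
  assumes "\<bar>a - c\<bar> + \<bar>b - d\<bar> = 1" "\<not> (a = x \<and> b = y + 1)" "\<not> (c = x \<and> d = y + 1)"
  shows "(b = y + 1 \<and> a < x) \<noteq> (d = y + 1 \<and> c < x) \<longleftrightarrow>
    (a = c \<and> a < x \<and> (b = y \<and> d = y + 1 \<or> b = y + 1 \<and> d = y)) \<or>
    (a = c \<and> a < x \<and> (b = y + 1 \<and> d = y + 2 \<or> b = y + 2 \<and> d = y + 1))"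
proof -
  consider "c = a + 1" "d = b" | "c = a - 1" "d = b" | "c = a" "d = b + 1" | "c = a" "d = b - 1"
    using assms(1) by (smt (verit))
  then show ?thesis
  proof cases
    case 1
    then show ?thesis using assms(2,3) by (cases "b = y + 1") auto
  next
    case 2
    then show ?thesis using assms(2,3) by (cases "b = y + 1") auto
  next
    case 3
    then show ?thesis by auto
  next
    case 4
    then show ?thesis by auto
  qed
qed

text \<open>Consider the sites of \<open>P\<close> in row \<open>y + 1\<close> to the left of
  \<open>x\<close>. The path enters or leaves this set exactly through the vertical edges counted
  for the two rows, since a horizontal exit would pass through \<open>(x, y + 1)\<close>. Both ends
  of \<open>P\<close> lie outside the set, so the total is even.\<close>

lemma crossings_vertical:
  assumes P: "successively nbr P" "P \<noteq> []" "(x, y + 1) \<notin> set P"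
    and ends: "snd (hd P) \<noteq> y + 1" "snd (last P) \<noteq> y + 1"
  shows "even (crossings P (x, y)) \<longleftrightarrow> even (crossings P (x, y + 1))"
proof -
  define g where "g i \<longleftrightarrow> snd (P ! i) = y + 1 \<and> fst (P ! i) < x" for i
  define n where "n = length P - 1"
  let ?A = "{i. Suc i < length P \<and> fst (P ! i) = fst (P ! Suc i) \<and> fst (P ! i) < x \<and>
     (snd (P ! i) = y \<and> snd (P ! Suc i) = y + 1 \<or> snd (P ! i) = y + 1 \<and> snd (P ! Suc i) = y)}"
  let ?B = "{i. Suc i < length P \<and> fst (P ! i) = fst (P ! Suc i) \<and> fst (P ! i) < x \<and>
     (snd (P ! i) = y + 1 \<and> snd (P ! Suc i) = y + 2 \<or> snd (P ! i) = y + 2 \<and> snd (P ! Suc i) = y + 1)}"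
  have eq: "{i. i < n \<and> g i \<noteq> g (Suc i)} = ?A \<union> ?B"
  proof (intro set_eqI)
    fix i
    show "i \<in> {i. i < n \<and> g i \<noteq> g (Suc i)} \<longleftrightarrow> i \<in> ?A \<union> ?B"
    proof (cases "Suc i < length P")
      case True
      have nb: "nbr (P ! i) (P ! Suc i)" by (rule successively_nbr_nth[OF P(1) True])
      have "P ! i \<noteq> (x, y + 1)" "P ! Suc i \<noteq> (x, y + 1)"
        using P(3) True by (metis Suc_lessD nth_mem)+
      then have "\<not> (fst (P ! i) = x \<and> snd (P ! i) = y + 1)" "\<not> (fst (P ! Suc i) = x \<and> snd (P ! Suc i) = y + 1)"
        by (auto simp: prod_eq_iff)
      from crossing_edge_iff[OF nb[unfolded nbr_def] this] have "g i \<noteq> g (Suc i) \<longleftrightarrow> i \<in> ?A \<union> ?B"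
        using True unfolding g_def by simp
      then show ?thesis using True by (auto simp: n_def)
    qed (auto simp: n_def)
  qed
  have "\<not> g 0" "\<not> g n"
    using ends P(2) by (auto simp: g_def hd_conv_nth last_conv_nth n_def)
  then have "even (card (?A \<union> ?B))"
    using even_card_changes[of n g] unfolding eq by simp
  moreover have "card (?A \<union> ?B) = card ?A + card ?B"
    by (rule card_Un_disjoint) (auto intro: finite_crossings)
  moreover have "crossings P (x, y) = card ?A" "crossings P (x, y + 1) = card ?B"
    by (simp_all add: crossings_def add.assoc)
  ultimately show ?thesis by simp
qed

text \<open>A path in the complement of \<open>P\<close> keeps its side as long as it avoids the
  rows in which \<open>P\<close> begins and ends; the height bounds ensure this.\<close>

lemma crossings_path:
  assumes P: "successively nbr P" "P \<noteq> []"
    and t: "\<And>i. i \<le> n \<Longrightarrow> t i \<notin> set P \<and> snd (t i) > snd (hd P) \<and> snd (t i) < snd (last P)"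
    and nb: "\<And>i. i < n \<Longrightarrow> nbr (t i) (t (Suc i))"
  shows "even (crossings P (t 0)) \<longleftrightarrow> even (crossings P (t n))"
proof -
  have step: "even (crossings P p) \<longleftrightarrow> even (crossings P q)"
    if "nbr p q" "p \<notin> set P" "q \<notin> set P" "snd p > snd (hd P)" "snd q > snd (hd P)"
      "snd p < snd (last P)" "snd q < snd (last P)" for p q
  proof -
    obtain x y where p: "p = (x, y)" by (cases p)
    from that(1) consider "q = (x + 1, y)" | "q = (x - 1, y)" | "q = (x, y + 1)" | "q = (x, y - 1)"
      unfolding p nbr_iff by auto
    then show ?thesis
    proof cases
      case 1
      then show ?thesis using crossings_horizontal[OF P(1)] that p by simp
    next
      case 2
      then show ?thesis using crossings_horizontal[OF P(1), of "x - 1" y] that p by simp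
    next
      case 3
      then show ?thesis using crossings_vertical[OF P, of x y] that p by simp
    next
      case 4
      then show ?thesis using crossings_vertical[OF P, of x "y - 1"] that p by simp
    qed
  qed
  have "m \<le> n \<Longrightarrow> even (crossings P (t 0)) \<longleftrightarrow> even (crossings P (t m))" for m
  proof (induction m)
    case (Suc m)
    then show ?case using step[OF nb[of m]] t[of m] t[of "Suc m"] by simp
  qed simp
  then show ?thesis by simp
qed

lemma crossings_left:
  assumes "\<And>p. p \<in> set P \<Longrightarrow> snd p = y \<Longrightarrow> x < fst p"
  shows "crossings P (x, y) = 0"
proof -
  have "\<not> (Suc i < length P \<and> fst (P ! i) = fst (P ! Suc i) \<and> fst (P ! i) < x \<and>
     (snd (P ! i) = y \<and> snd (P ! Suc i) = y + 1 \<or> snd (P ! i) = y + 1 \<and> snd (P ! Suc i) = y))" for i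
  proof
    assume a: "Suc i < length P \<and> fst (P ! i) = fst (P ! Suc i) \<and> fst (P ! i) < x \<and>
     (snd (P ! i) = y \<and> snd (P ! Suc i) = y + 1 \<or> snd (P ! i) = y + 1 \<and> snd (P ! Suc i) = y)"
    then have "P ! i \<in> set P" "P ! Suc i \<in> set P" by auto
    then show False using assms a by (metis less_imp_not_less)
  qed
  then have "{i. Suc i < length P \<and> fst (P ! i) = fst (P ! Suc i) \<and> fst (P ! i) < x \<and>
     (snd (P ! i) = y \<and> snd (P ! Suc i) = y + 1 \<or> snd (P ! i) = y + 1 \<and> snd (P ! Suc i) = y)} = {}"
    by blast
  then show ?thesis unfolding crossings_def fst_conv snd_conv by (simp only: card.empty)
qed

text \<open>The path passes between rows at most \<open>y\<close> and rows above \<open>y\<close> an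
  odd number of times, and each of these edges has an end in row \<open>y\<close>, hence lies to the
  left of \<open>x\<close>.\<close>

lemma crossings_right:
  assumes P: "successively nbr P" "P \<noteq> []"
    and right: "\<And>p. p \<in> set P \<Longrightarrow> snd p = y \<Longrightarrow> fst p < x"
    and ends: "snd (hd P) \<le> y" "snd (last P) > y"
  shows "odd (crossings P (x, y))"
proof -
  define g where "g i \<longleftrightarrow> snd (P ! i) \<le> y" for i
  define n where "n = length P - 1"
  have "{i. i < n \<and> g i \<noteq> g (Suc i)} = {i. Suc i < length P \<and> fst (P ! i) = fst (P ! Suc i) \<and> fst (P ! i) < x \<and>
     (snd (P ! i) = y \<and> snd (P ! Suc i) = y + 1 \<or> snd (P ! i) = y + 1 \<and> snd (P ! Suc i) = y)}" (is "_ = ?A")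
  proof (intro set_eqI)
    fix i
    show "i \<in> {i. i < n \<and> g i \<noteq> g (Suc i)} \<longleftrightarrow> i \<in> ?A"
    proof (cases "Suc i < length P")
      case True
      have nb: "nbr (P ! i) (P ! Suc i)" by (rule successively_nbr_nth[OF P(1) True])
      have "P ! i \<in> set P" "P ! Suc i \<in> set P" using True by auto
      from right[OF this(1)] right[OF this(2)] have "g i \<noteq> g (Suc i) \<longleftrightarrow> i \<in> ?A"
        using nb True unfolding g_def
        by (cases "P ! i"; cases "P ! Suc i") (auto simp: nbr_iff)
      then show ?thesis using True by (auto simp: n_def)
    qed (auto simp: n_def)
  qed
  moreover have "g 0" "\<not> g n"
    using ends P(2) by (auto simp: g_def hd_conv_nth last_conv_nth n_def)
  ultimately show ?thesis
    using even_card_changes[of n g] by (simp add: crossings_def)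
qed

text \<open>The path is required to be simple because a self-avoiding walk is to follow it.\<close>

definition connected_in :: "site set \<Rightarrow> site \<Rightarrow> site \<Rightarrow> bool" where
  "connected_in C p q \<longleftrightarrow> (\<exists>P. P \<noteq> [] \<and> hd P = p \<and> last P = q \<and> distinct P \<and> successively nbr P \<and> set P \<subseteq> C)"

text \<open>
  Two sites of \<open>\<omega>\<close>, on the left and on the right of \<open>C\<close> in a high row, are joined by a piece of
  \<open>\<omega>\<close>; it cannot pass below \<open>C\<close>, where \<open>\<omega>\<close> does not return, nor above it, since \<open>C\<close> is unbounded.
\<close>

theorem no_enclosed_component:
  fixes \<omega> :: "nat \<Rightarrow> site" and C :: "site set"
  assumes \<omega>: "\<And>k. nbr (\<omega> k) (\<omega> (Suc k))"
    and up: "\<And>M. finite {k. snd (\<omega> k) \<le> M}"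
    and C\<omega>: "\<And>k. \<omega> k \<notin> C"
    and p: "p \<in> C" and conn: "\<And>q. q \<in> C \<Longrightarrow> connected_in C p q"
    and rows: "\<And>b. finite {q \<in> C. snd q = b}"
    and left: "\<And>q. q \<in> C \<Longrightarrow> \<exists>k. snd (\<omega> k) = snd q \<and> fst (\<omega> k) < fst q"
    and right: "\<And>q. q \<in> C \<Longrightarrow> \<exists>k. snd (\<omega> k) = snd q \<and> fst q < fst (\<omega> k)"
    and inf: "infinite C"
  shows False
proof -
  have "\<exists>m. \<forall>k. m \<le> snd (\<omega> k)"
  proof -
    have "finite ((\<lambda>k. snd (\<omega> k)) ` {k. snd (\<omega> k) \<le> 0})" using up by blast
    then obtain m where "\<forall>y\<in>(\<lambda>k. snd (\<omega> k)) ` {k. snd (\<omega> k) \<le> 0}. m \<le> y"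
      using Min_le by blast
    then have "min m 0 \<le> snd (\<omega> k)" for k by (cases "snd (\<omega> k) \<le> 0") auto
    then show ?thesis by blast
  qed
  then obtain m where m: "\<And>k. m \<le> snd (\<omega> k)" by blast
  have low: "m \<le> snd q" if "q \<in> C" for q using left[OF that] m by metis
  have high: "\<exists>q\<in>C. snd q > b" for b
  proof (rule ccontr)
    assume "\<not> ?thesis"
    then have "C = (\<Union>y\<in>{m..b}. {q \<in> C. snd q = y})" using low by (auto simp: not_less)
    moreover have "finite \<dots>" using rows by blast
    ultimately show False using inf by simp
  qed
  \<comment> \<open>From time \<open>K\<close> on, \<omega> stays above the row of
    \<open>p\<close>.\<close>
  define K where "K = Max (insert 0 (Suc ` {k. snd (\<omega> k) \<le> snd p}))"
  have K: "snd (\<omega> k) > snd p" if "k \<ge> K" for k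
  proof (rule ccontr)
    assume "\<not> ?thesis"
    then have "Suc k \<le> K" unfolding K_def using up by (intro Max_ge) auto
    then show False using that by simp
  qed
  \<comment> \<open>A row above \<open>p\<close> and above everything before time \<open>K\<close>,
    so that the visits of \<omega> to it belong to the part that stays above
    \<open>p\<close>.\<close>
  define b where "b = Max (insert (snd p) ((\<lambda>k. snd (\<omega> k)) ` {..K})) + 1"
  have b: "snd p < b" "\<And>k. k < K \<Longrightarrow> snd (\<omega> k) < b"
  proof -
    have "snd p \<le> b - 1" unfolding b_def by simp
    then show "snd p < b" by simp
    fix k assume "k < K"
    then have "snd (\<omega> k) \<le> Max (insert (snd p) ((\<lambda>k. snd (\<omega> k)) ` {..K}))"
      by (intro Max_ge) auto
    then show "snd (\<omega> k) < b" unfolding b_def by simp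
  qed
  have crossrow: "\<exists>r\<in>set Q. snd r = b" if "Q \<noteq> []" "successively nbr Q" "snd (hd Q) \<le> b" "snd (last Q) \<ge> b" for Q
    using that
  proof (induction Q rule: list_nonempty_induct)
    case (cons x xs)
    show ?case
    proof (cases "snd x = b")
      case False
      have "nbr x (hd xs)" using cons by (cases xs) auto
      then have "snd (hd xs) \<le> b" using False cons.prems by (auto simp: nbr_def)
      moreover have "successively nbr xs" using cons by (cases xs) auto
      ultimately show ?thesis using cons by auto
    qed auto
  qed auto
  let ?R = "{q \<in> C. snd q = b}"
  obtain q0 where q0: "q0 \<in> C" "snd q0 > b" using high by blast
  obtain Q where Q: "Q \<noteq> []" "hd Q = p" "last Q = q0" "successively nbr Q" "set Q \<subseteq> C"
    using conn[OF q0(1)] unfolding connected_in_def by blast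
  \<comment> \<open>A path in \<open>C\<close> from \<open>p\<close> to a site above row
    \<open>b\<close> has to meet this row, so \<open>C\<close> has a leftmost and a rightmost site
    in it.\<close>
  have R: "?R \<noteq> {}" "finite ?R" using crossrow[OF Q(1,4)] Q b(1) q0 rows by auto
  obtain l where l: "l \<in> ?R" "\<And>q. q \<in> ?R \<Longrightarrow> fst l \<le> fst q"
    using arg_min_if_finite[OF R(2,1), of fst] by (meson not_less)
  obtain r where r: "r \<in> ?R" "\<And>q. q \<in> ?R \<Longrightarrow> fst q \<le> fst r"
    using arg_min_if_finite[OF R(2,1), of "\<lambda>q. - fst q"] by (meson neg_less_iff_less not_less)
  obtain i where i: "snd (\<omega> i) = b" "fst (\<omega> i) < fst l" using left l(1) by fastforce
  obtain j where j: "snd (\<omega> j) = b" "fst r < fst (\<omega> j)" using right r(1) by fastforce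
  have ij: "K \<le> i" "K \<le> j" using b(2) i j by (metis not_le order_less_irrefl)+
  \<comment> \<open>\<open>P\<close> will end above \<open>H\<close>, so the piece of \<omega>
    between times \<open>i\<close> and \<open>j\<close> stays strictly between the rows of the two
    ends of \<open>P\<close>.\<close>
  define H where "H = Max ((\<lambda>k. snd (\<omega> k)) ` {..max i j}) + 1"
  have H: "snd (\<omega> k) < H" if "k \<le> max i j" for k
  proof -
    have "snd (\<omega> k) \<le> H - 1" unfolding H_def using that by (simp add: Max_ge)
    then show ?thesis by simp
  qed
  obtain q1 where q1: "q1 \<in> C" "snd q1 > H" using high by blast
  obtain P where P: "P \<noteq> []" "hd P = p" "last P = q1" "successively nbr P" "set P \<subseteq> C"
    using conn[OF q1(1)] unfolding connected_in_def by blast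
  have "crossings P (fst (\<omega> i), b) = 0"
  proof (rule crossings_left)
    fix q assume "q \<in> set P" "snd q = b"
    then show "fst (\<omega> i) < fst q" using P(5) l(2)[of q] i(2) by auto
  qed
  then have ei: "even (crossings P (\<omega> i))" using i(1) by (metis dvd_0_right prod.collapse)
  have "odd (crossings P (fst (\<omega> j), b))"
  proof (rule crossings_right[OF P(4,1)])
    fix q assume "q \<in> set P" "snd q = b"
    then show "fst q < fst (\<omega> j)" using P(5) r(2)[of q] j(2) by fastforce
  next
    show "snd (hd P) \<le> b" using P(2) b(1) by simp
    show "b < snd (last P)" using P(3) q1(2) H[of i] i(1) by simp
  qed
  then have oj: "odd (crossings P (\<omega> j))" using j(1) by (metis prod.collapse)
  have away: "\<omega> k \<notin> set P \<and> snd (\<omega> k) > snd (hd P) \<and> snd (\<omega> k) < snd (last P)" if "K \<le> k" "k \<le> max i j" for k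
    using C\<omega> P K[OF that(1)] H[OF that(2)] q1(2) by auto
  have same: "even (crossings P (\<omega> u)) \<longleftrightarrow> even (crossings P (\<omega> v))" if "K \<le> u" "u \<le> v" "v \<le> max i j" for u v
  proof -
    have "even (crossings P (\<omega> (u + 0))) \<longleftrightarrow> even (crossings P (\<omega> (u + (v - u))))"
      by (rule crossings_path[OF P(4,1), where t = "\<lambda>k. \<omega> (u + k)"])
         (use that away \<omega> in auto)
    then show ?thesis using that by simp
  qed
  show False
    using same[of i j] same[of j i] ij ei oj by (cases "i \<le> j") auto
qed

section \<open>Strip records\<close>

definition line_exits :: "site set \<Rightarrow> real \<Rightarrow> ennreal \<Rightarrow> site list set" where
  "line_exits G lam c = {b \<in> saws G. b \<in> line \<and> c \<le> esc G lam b}"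

text \<open>Earlier sites are compared only within the strip; outside it the walk may have gone
  farther.\<close>

definition strip_records :: "site set \<Rightarrow> nat \<Rightarrow> site list set" where
  "strip_records G M = {v \<in> saws G. \<bar>snd (last v)\<bar> \<le> int M \<and>
     (\<forall>p\<in>set (butlast v). \<bar>snd p\<bar> \<le> int M \<longrightarrow> \<bar>fst p\<bar> < \<bar>fst (last v)\<bar>)}"

lemma mem_G_iff: "G \<in> {UNIV, half_plane} \<Longrightarrow> p \<in> G \<longleftrightarrow> G = UNIV \<or> 0 \<le> snd p"
  by (auto simp: half_plane_iff)

lemma set_butlast_last: "v \<noteq> [] \<Longrightarrow> set v = insert (last v) (set (butlast v))"
  by (induction v rule: rev_induct) auto

lemma right_strip_record_hits:
  assumes G: "G \<in> {UNIV, half_plane}" and lam: "lam > 0" and n: "n \<ge> 1"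
    and many: "4 \<le> real (card (bridges n)) * lam ^ n" and M: "M \<ge> 4 * n"
    and v: "v \<in> strip_records G M" and x0: "fst (last v) \<ge> 0"
  shows "ennreal (min_step lam) ^ Suc M \<le> emeasure (RWs G lam v)
    {X. \<exists>k. X k \<in> line_exits G lam (ennreal (min_step lam) ^ Suc (2 * n) * ennreal (escape_bound lam n))}"
proof -
  define x y where "x = fst (last v)" and "y = snd (last v)"
  have vs: "v \<in> saws G" and yM: "\<bar>y\<bar> \<le> int M" using v by (auto simp: strip_records_def y_def)
  have vne: "v \<noteq> []" by (rule saws_not_Nil[OF vs])
  have lv: "last v = (x, y)" by (simp add: x_def y_def)
  have vfresh: "fst p \<le> x" if "p \<in> set v" "\<bar>snd p\<bar> \<le> int M" for p
  proof -
    have "p = last v \<or> p \<in> set (butlast v)" using that(1) set_butlast_last[OF vne] by blast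
    then show ?thesis using v that(2) x0 by (auto simp: strip_records_def x_def)
  qed
  have yG: "G = UNIV \<or> 0 \<le> y"
  proof -
    have "last v \<in> G" using vs last_in_saw[OF vs] by (auto simp: saws_def)
    then show ?thesis by (simp add: mem_G_iff[OF G] y_def)
  qed
  \<comment> \<open>The direction towards the line; the case of a negative height arises only in the
    plane.\<close>
  define d :: site where "d = (0, if 0 \<le> y then -1 else 1)"
  define v1 where "v1 = v @ run (last v) (1, 0) 1"
  have lv1: "last v1 = (x + 1, y)" by (simp add: v1_def run_def lv)
  have sv1: "set v1 = insert (x + 1, y) (set v)" by (auto simp: v1_def run_def lv)
  have v1: "v1 \<in> saws G"
    unfolding v1_def
  proof (rule run_in_saws[OF vs])
    fix j :: int assume "1 \<le> j" "j \<le> int 1"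
    then have "j = 1" by simp
    moreover have "(x + 1, y) \<notin> set v" using vfresh[of "(x + 1, y)"] yM by auto
    ultimately show "(fst (last v) + j * fst (1, 0), snd (last v) + j * snd (1, 0)) \<in> G - set v"
      using yG mem_G_iff[OF G, of "(x + 1, y)"] by (simp add: lv)
  qed simp
  define v2 where "v2 = v1 @ run (last v1) d (nat \<bar>y\<bar>)"
  have v1ne: "v1 \<noteq> []" by (simp add: v1_def vne)
  have column: "(x + 1, y + j * snd d) \<in> G - set v1" if "1 \<le> j" "j \<le> \<bar>y\<bar>" for j
  proof -
    have yj: "\<bar>y + j * snd d\<bar> \<le> \<bar>y\<bar>" "0 \<le> y \<Longrightarrow> 0 \<le> y + j * snd d" "y + j * snd d \<noteq> y"
      using that by (auto simp: d_def)
    have "(x + 1, y + j * snd d) \<notin> set v" using vfresh[of "(x + 1, y + j * snd d)"] yj(1) yM by auto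
    then show ?thesis using yj yG mem_G_iff[OF G, of "(x + 1, y + j * snd d)"] by (auto simp: sv1)
  qed
  have v2: "v2 \<in> saws G"
    unfolding v2_def
  proof (rule run_in_saws[OF v1])
    show "\<bar>fst d\<bar> + \<bar>snd d\<bar> = 1" by (simp add: d_def)
    fix j :: int assume "1 \<le> j" "j \<le> int (nat \<bar>y\<bar>)"
    then show "(fst (last v1) + j * fst d, snd (last v1) + j * snd d) \<in> G - set v1"
      using column[of j] by (simp add: lv1) (simp add: d_def)
  qed
  have "last v2 = last (last v1 # run (last v1) d (nat \<bar>y\<bar>))"
    using v1ne by (simp add: v2_def last_append)
  then have lv2: "last v2 = (x + 1, 0)" unfolding last_run lv1 by (simp add: d_def)
  have sv2: "fst p \<le> x + 1" if "p \<in> set v2" "\<bar>snd p\<bar> \<le> int M" for p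
    using that vfresh[of p] by (auto simp: v2_def sv1 set_run lv1 d_def split: if_splits)
  \<comment> \<open>The ascent takes place in column \<open>x + 2\<close>, since the run to the line
    may occupy column \<open>x + 1\<close> above the line.\<close>
  define v3 where "v3 = v2 @ run (last v2) (1, 0) 1"
  have lv3: "last v3 = (x + 2, 0)" by (simp add: v3_def run_def lv2)
  have sv3: "set v3 = insert (x + 2, 0) (set v2)" by (auto simp: v3_def run_def lv2)
  have v3: "v3 \<in> saws G"
    unfolding v3_def
  proof (rule run_in_saws[OF v2])
    fix j :: int assume "1 \<le> j" "j \<le> int 1"
    then have "j = 1" by simp
    moreover have "(x + 2, 0) \<notin> set v2" using sv2[of "(x + 2, 0)"] by auto
    ultimately show "(fst (last v2) + j * fst (1, 0), snd (last v2) + j * snd (1, 0)) \<in> G - set v2"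
      using mem_G_iff[OF G, of "(x + 2, 0)"] by (simp add: lv2 add.commute)
  qed simp
  define b where "b = v3 @ run (last v3) (0, 1) (2 * n)"
  have b: "b \<in> saws G"
    unfolding b_def
  proof (rule run_in_saws[OF v3])
    fix j :: int assume j: "1 \<le> j" "j \<le> int (2 * n)"
    have "(x + 2, j) \<notin> set v3" using sv2[of "(x + 2, j)"] j M by (auto simp: sv3)
    then show "(fst (last v3) + j * fst (0, 1), snd (last v3) + j * snd (0, 1)) \<in> G - set v3"
      using mem_G_iff[OF G, of "(x + 2, j)"] j by (simp add: lv3)
  qed simp
  have v3ne: "v3 \<noteq> []" by (simp add: v3_def v2_def v1ne)
  have "last b = last (last v3 # run (last v3) (0, 1) (2 * n))"
    using v3ne by (simp add: b_def last_append)
  then have lb: "last b = (x + 2, 2 * int n)" unfolding last_run lv3 by simp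
  interpret corridor G lam n b
  proof
    have "length b \<noteq> length root" using vne by (simp add: b_def v3_def v2_def v1_def root_def)
    then show "b \<noteq> root" by metis
    show "snd (last b) = 2 * int n" by (simp add: lb)
    fix p assume p: "p \<in> set b" "fst (last b) < fst p"
    then have "x + 2 < fst p" by (simp add: lb)
    then have "p \<in> set v2" using p(1) by (auto simp: b_def sv3 set_run lv3)
    then show "\<not> (0 \<le> snd p \<and> snd p \<le> 4 * int n)" using sv2[of p] p(2) M by (auto simp: lb)
  qed (fact G lam n many b)+
  have v2ne: "v2 \<noteq> []" by (simp add: v2_def v1ne)
  have bv2: "b = v2 @ (run (last v2) (1, 0) 1 @ run (last v3) (0, 1) (2 * n))" by (simp add: b_def v3_def)
  have "ennreal (min_step lam) ^ Suc (2 * n) * ennreal (escape_bound lam n) \<le> ennreal (min_step lam) ^ Suc (2 * n) * esc G lam b"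
    by (intro mult_left_mono corridor_escape) simp
  also have "\<dots> \<le> esc G lam v2"
    using esc_extension[OF lam G _ v2ne, of "run (last v2) (1, 0) 1 @ run (last v3) (0, 1) (2 * n)"] b
    unfolding bv2[symmetric] by simp
  finally have ex: "v2 \<in> line_exits G lam (ennreal (min_step lam) ^ Suc (2 * n) * ennreal (escape_bound lam n))"
    using v2 by (simp add: line_exits_def line_def lv2)
  define zs where "zs = run (last v) (1, 0) 1 @ run (last v1) d (nat \<bar>y\<bar>)"
  have v2v: "v @ zs = v2" by (simp add: zs_def v2_def v1_def)
  have "length zs \<le> Suc M" using yM by (simp add: zs_def)
  then show ?thesis
    using hit_extension_ge[OF lam G _ vne, where zs = zs] v2 ex unfolding v2v by blast
qed

lemma map_reflect_line_exits:
  assumes "G \<in> {UNIV, half_plane}" "lam > 0"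
  shows "map reflect ` line_exits G lam c \<subseteq> line_exits G lam c"
proof
  fix u assume "u \<in> map reflect ` line_exits G lam c"
  then obtain v where v: "u = map reflect v" "v \<in> saws G" "v \<in> line" "c \<le> esc G lam v"
    by (auto simp: line_exits_def)
  have "u \<in> line" using v saws_not_Nil[OF v(2)] by (simp add: line_def last_map reflect_def)
  moreover have "c \<le> esc G lam u" using v(4) esc_reflect[OF assms v(2)] unfolding v(1) by (rule order_trans)
  ultimately show "u \<in> line_exits G lam c"
    using map_reflect_saws[OF assms(1) v(2)] v(1) by (simp add: line_exits_def)
qed

lemma strip_record_hits:
  assumes G: "G \<in> {UNIV, half_plane}" and lam: "lam > 0" and n: "n \<ge> 1"
    and many: "4 \<le> real (card (bridges n)) * lam ^ n" and M: "M \<ge> 4 * n"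
    and v: "v \<in> strip_records G M"
  shows "ennreal (min_step lam) ^ Suc M \<le> emeasure (RWs G lam v)
    {X. \<exists>k. X k \<in> line_exits G lam (ennreal (min_step lam) ^ Suc (2 * n) * ennreal (escape_bound lam n))}"
proof (cases "fst (last v) \<ge> 0")
  case True
  then show ?thesis by (rule right_strip_record_hits[OF assms])
next
  case False
  let ?E = "line_exits G lam (ennreal (min_step lam) ^ Suc (2 * n) * ennreal (escape_bound lam n))"
  have vs: "v \<in> saws G" using v by (simp add: strip_records_def)
  have vne: "v \<noteq> []" by (rule saws_not_Nil[OF vs])
  have rs: "map reflect v \<in> saws G" by (rule map_reflect_saws[OF G vs])
  have "map reflect v \<in> strip_records G M"
    using v rs vne by (auto simp: strip_records_def last_map map_butlast[symmetric] reflect_def)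
  moreover have "fst (last (map reflect v)) \<ge> 0" using False vne by (simp add: last_map reflect_def)
  ultimately have "ennreal (min_step lam) ^ Suc M \<le> emeasure (RWs G lam (map reflect v)) {X. \<exists>k. X k \<in> ?E}"
    by (rule right_strip_record_hits[OF G lam n many M])
  also have "\<dots> \<le> emeasure (RWs G lam (map reflect (map reflect v))) {X. \<exists>k. X k \<in> ?E}"
    by (rule hit_reflect[OF G lam rs map_reflect_line_exits[OF G lam]])
  finally show ?thesis by (simp only: map_reflect_map_reflect)
qed

section \<open>Excursions from the line\<close>

text \<open>Only the endpoint counts: outside \<open>near w\<close> no possible next site belongs to
  \<open>w\<close>.\<close>

definition near :: "site list \<Rightarrow> site list set" where
  "near w = {u. \<exists>p\<in>set w. nbr (last u) p}"

definition off_line :: "site set \<Rightarrow> site list \<Rightarrow> site list set" where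
  "off_line G w = {v \<in> saws G. \<exists>\<sigma>. v = w @ \<sigma> \<and> \<sigma> \<noteq> [] \<and> (\<forall>p\<in>set \<sigma>. snd p \<noteq> 0)}"

text \<open>The height changes by at most 1 per step, so it cannot change sign without
  vanishing.\<close>

lemma off_line_sign:
  assumes "successively nbr (q # \<sigma>)" "snd q = 0" "\<sigma> \<noteq> []" "\<forall>p\<in>set \<sigma>. snd p \<noteq> 0"
  shows "\<exists>s\<in>{1, -1}. hd \<sigma> = (fst q, s) \<and> (\<forall>p\<in>set \<sigma>. 0 < s * snd p)"
proof -
  have "nbr q (hd \<sigma>)" using assms(1,3) by (cases \<sigma>) auto
  moreover have "snd (hd \<sigma>) \<noteq> 0" using assms(3,4) by simp
  ultimately obtain s where s: "s \<in> {1, -1}" "hd \<sigma> = (fst q, s)"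
    using assms(2) by (cases "hd \<sigma>") (auto simp: nbr_iff)
  have "0 < s * snd (\<sigma> ! i)" if "i < length \<sigma>" for i
    using that
  proof (induction i)
    case 0
    then show ?case using s assms(3) by (auto simp: hd_conv_nth[symmetric])
  next
    case (Suc i)
    have "successively nbr \<sigma>" using assms(1) by (cases \<sigma>) auto
    then have "nbr (\<sigma> ! i) (\<sigma> ! Suc i)" using Suc.prems by (simp add: successively_conv_nth)
    then have "\<bar>snd (\<sigma> ! i) - snd (\<sigma> ! Suc i)\<bar> \<le> 1" by (auto simp: nbr_def)
    moreover have "snd (\<sigma> ! Suc i) \<noteq> 0" using assms(4) Suc.prems by simp
    moreover have "0 < s * snd (\<sigma> ! i)" using Suc by simp
    ultimately show ?case using s(1) by auto
  qed
  then have "\<forall>p\<in>set \<sigma>. 0 < s * snd p" by (metis in_set_conv_nth)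
  then show ?thesis using s by blast
qed

text \<open>Carries the half-plane to the side \<open>s\<close> of the line, the origin going to the
  site of the line in the column of \<open>q\<close>.\<close>

definition plant :: "site \<Rightarrow> int \<Rightarrow> site \<Rightarrow> site" where
  "plant q s p = (fst q + fst p, s * snd p)"

lemma isometry_plant:
  assumes "s \<in> {1, -1}"
  shows "isometry (plant q s)"
  unfolding isometry_def
proof (intro conjI allI)
  have ss: "s * (s * a) = a" for a :: int using assms by auto
  show "bij (plant q s)"
    by (rule o_bij[of "\<lambda>p. (fst p - fst q, s * snd p)"]) (auto simp: plant_def fun_eq_iff ss)
  have "\<bar>s * a - s * c\<bar> = \<bar>a - c\<bar>" for a c :: int using assms by auto
  then show "nbr (plant q s p) (plant q s r) \<longleftrightarrow> nbr p r" for p r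
    by (simp add: plant_def nbr_def)
qed

text \<open>
  As long as the walk does not touch the neighbourhood of \<open>w\<close>, its continuation beyond the line
  does not feel the sites of \<open>w\<close>, so that it behaves like a walk in an empty half-plane.
\<close>

lemma off_line_returns:
  assumes G: "G \<in> {UNIV, half_plane}" and lam: "lam > 0" and w: "w \<in> saws G" "w \<in> line"
    and v: "v \<in> off_line G w"
  shows "emeasure (RWs G lam v) {X. \<exists>n. X n \<in> line \<union> near w} = 1"
proof -
  obtain \<sigma> where \<sigma>: "v = w @ \<sigma>" "\<sigma> \<noteq> []" "\<forall>p\<in>set \<sigma>. snd p \<noteq> 0" and vs: "v \<in> saws G"
    using v unfolding off_line_def by blast
  have wne: "w \<noteq> []" by (rule saws_not_Nil[OF w(1)])
  define q where "q = last w"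
  have q0: "snd q = 0" using w(2) by (simp add: line_def q_def)
  have sw: "successively nbr (w @ \<sigma>)" using vs \<sigma>(1) by (simp add: saws_def)
  then have sq: "successively nbr (q # \<sigma>)"
    using wne \<sigma>(2) by (auto simp: successively_append_iff successively_Cons q_def)
  have dq: "distinct (q # \<sigma>)" using vs \<sigma>(1) last_in_set[OF wne] by (auto simp: saws_def q_def)
  obtain s where s: "s \<in> {1, -1}" "hd \<sigma> = (fst q, s)" "\<forall>p\<in>set \<sigma>. 0 < s * snd p"
    using off_line_sign[OF sq q0 \<sigma>(2,3)] by blast
  have ss: "s * s = 1" "s * (s * a) = a" for a using s(1) by auto
  let ?\<psi> = "plant q s"
  have iso: "isometry ?\<psi>" by (rule isometry_plant[OF s(1)])
  \<comment> \<open>The last site of \<open>w\<close> is dropped because the origin of \<tau> takes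
    its place.\<close>
  let ?\<phi> = "\<lambda>\<tau>. butlast w @ map ?\<psi> \<tau>"
  define pull where "pull p = (fst p - fst q, s * snd p)" for p :: site
  have pb: "?\<psi> (pull p) = p" for p by (simp add: plant_def pull_def ss)
  have \<psi>0: "?\<psi> (0, 0) = q" using q0 by (simp add: plant_def prod_eq_iff)
  define \<tau> where "\<tau> = (0, 0) # map pull \<sigma>"
  have \<psi>\<tau>: "map ?\<psi> \<tau> = q # \<sigma>" by (simp add: \<tau>_def \<psi>0 o_def pb)
  have \<phi>\<tau>: "?\<phi> \<tau> = v" unfolding \<psi>\<tau> \<sigma>(1) using wne by (simp add: q_def)
  have hd\<sigma>: "pull (hd \<sigma>) = (0, 1)" using s(2) ss by (simp add: pull_def)
  define zs where "zs = map pull (tl \<sigma>)"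
  have \<tau>zs: "\<tau> = (0, 0) # (0, 1) # zs" using \<sigma>(2) hd\<sigma> by (cases \<sigma>) (auto simp: \<tau>_def zs_def)
  have "successively nbr (map ?\<psi> \<tau>)" "distinct (map ?\<psi> \<tau>)" unfolding \<psi>\<tau> by (fact sq dq)+
  then have "successively nbr \<tau>" "distinct \<tau>"
    by (simp_all only: successively_map_isometry[OF iso] distinct_map)
  moreover have "set \<tau> \<subseteq> half_plane"
  proof
    fix p assume "p \<in> set \<tau>"
    then have "p = (0, 0) \<or> (\<exists>r\<in>set \<sigma>. p = pull r)" by (auto simp: \<tau>_def)
    then show "p \<in> half_plane" using s(3) by (auto simp: half_plane_iff pull_def less_imp_le)
  qed
  ultimately have \<tau>s: "\<tau> \<in> saws half_plane" by (simp add: saws_def \<tau>_def)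
  have zoff: "\<forall>p\<in>set zs. snd p \<noteq> 0"
  proof
    fix p assume "p \<in> set zs"
    then obtain r where "r \<in> set \<sigma>" "p = pull r" using \<sigma>(2) by (auto simp: zs_def dest: list.set_sel(2))
    then show "snd p \<noteq> 0" using s(3) by (auto simp: pull_def)
  qed
  have ev: "path_event (\<lambda>X. \<exists>n. X n \<in> line)" by (intro path_event_intros)
  have "emeasure (RWs half_plane lam \<tau>) {X. \<not> (\<exists>n. X n \<in> line)} = 0"
    using half_plane_hits_line_from[OF lam \<tau>s[unfolded \<tau>zs] zoff] by (simp add: \<tau>zs)
  then have one: "1 \<le> emeasure (RWs half_plane lam \<tau>) {X. \<exists>n. X n \<in> line}"
    unfolding emeasure_markov_compl[OF ev] by (simp add: ennreal_minus_eq_0)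
  \<comment> \<open>The half-plane walk is stopped on the line or when its image comes next to
    \<open>w\<close>; \<open>D\<close> records that up to then its image is a walk in
    \<open>G\<close>.\<close>
  define A where "A = {\<tau>. \<tau> \<noteq> [] \<and> (snd (last \<tau>) = 0 \<or> ?\<phi> \<tau> \<in> near w)}"
  define D where "D = {\<tau> \<in> saws half_plane. \<tau> \<notin> A \<and> ?\<phi> \<tau> \<in> saws G}"
  \<comment> \<open>A continuation below the line exists only in the plane.\<close>
  have sG: "s = 1 \<or> G = UNIV"
  proof -
    have "hd \<sigma> \<in> G" using vs \<sigma>(1,2) by (auto simp: saws_def)
    then show ?thesis using s(1,2) mem_G_iff[OF G, of "hd \<sigma>"] by auto
  qed
  have fits: "?\<psi> z \<in> G \<and> ?\<psi> z \<notin> set w \<and> z \<in> half_plane" if \<tau>': "\<tau>' \<in> saws half_plane" "\<tau>' \<notin> A" and z: "nbr (last \<tau>') z" for \<tau>' z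
  proof -
    have ne: "\<tau>' \<noteq> []" by (rule saws_not_Nil[OF \<tau>'(1)])
    then have "snd (last \<tau>') \<noteq> 0" "?\<phi> \<tau>' \<notin> near w" using \<tau>'(2) by (auto simp: A_def)
    moreover have "0 \<le> snd (last \<tau>')" by (rule last_saws_half_plane[OF \<tau>'(1)])
    ultimately have zh: "0 \<le> snd z" using z by (auto simp: nbr_def)
    have "nbr (last (?\<phi> \<tau>')) (?\<psi> z)"
      using z ne isometry_nbr[OF iso] by (simp add: last_map)
    then have "?\<psi> z \<notin> set w" using \<open>?\<phi> \<tau>' \<notin> near w\<close> by (auto simp: near_def)
    moreover have "?\<psi> z \<in> G" using sG zh mem_G_iff[OF G, of "?\<psi> z"] by (auto simp: plant_def)
    ultimately show ?thesis using zh by (simp add: half_plane_iff)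
  qed
  have wsub: "set (butlast w) \<subseteq> set w" by (auto dest: in_set_butlastD)
  have "1 \<le> emeasure (RWs half_plane lam \<tau>) {X. reaches A D X}"
  proof (rule order_trans[OF one], rule emeasure_mono_AE)
    show "{X. reaches A D X} \<in> sets (RWs half_plane lam \<tau>)"
      by (intro path_event_markov_set path_event_reaches)
    have H: "half_plane \<in> {UNIV, half_plane}" by simp
    show "AE X in RWs half_plane lam \<tau>. X \<in> {X. \<exists>n. X n \<in> line} \<longrightarrow> X \<in> {X. reaches A D X}"
      using AE_RW_tree_steps[OF lam H \<tau>s]
    proof eventually_elim
      case (elim X)
      show ?case
      proof
        assume "X \<in> {X. \<exists>n. X n \<in> line}"
        then obtain n where "X n \<in> line" by blast
        then have ex: "\<exists>n. X n \<in> A" using elim saws_not_Nil by (auto simp: A_def line_def)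
        define m where "m = (LEAST n. X n \<in> A)"
        have m: "X m \<in> A" unfolding m_def using ex by (rule LeastI_ex)
        have lt: "X i \<notin> A" if "i < m" for i using that not_less_Least unfolding m_def by blast
        \<comment> \<open>The image stays self-avoiding: before the stopping time a new site cannot
          lie in \<open>w\<close>, and within the half-plane walk the isometry is injective.\<close>
        have "?\<phi> (X i) \<in> saws G" if "i < m" for i
          using that
        proof (induction i)
          case 0
          then show ?case using elim \<phi>\<tau> vs by simp
        next
          case (Suc i)
          have IH: "?\<phi> (X i) \<in> saws G" using Suc by simp
          have Xi: "X i \<in> saws half_plane" "X i \<notin> A" using elim lt[of i] Suc.prems by auto
          have ne: "X i \<noteq> []" by (rule saws_not_Nil[OF Xi(1)])
          have "tree_step half_plane (X i) (X (Suc i))" using elim by blast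
          then show ?case
            unfolding tree_step_def
          proof (elim disjE conjE)
            assume "X (Suc i) \<in> children half_plane (X i)"
            then obtain z where z: "X (Suc i) = X i @ [z]" "nbr (last (X i)) z" "z \<notin> set (X i)"
              unfolding children_eq[OF Xi(1)] by blast
            note f = fits[OF Xi z(2)]
            have "?\<psi> z \<notin> set (map ?\<psi> (X i))" using z(3) isometry_inj[OF iso] by (auto dest: injD)
            then have "?\<psi> z \<notin> set (?\<phi> (X i))" using f wsub by auto
            moreover have "nbr (last (?\<phi> (X i))) (?\<psi> z)" using z(2) ne isometry_nbr[OF iso] by (simp add: last_map)
            ultimately have "?\<phi> (X i) @ [?\<psi> z] \<in> saws G"
              using IH f ne by (subst saws_snoc) auto
            then show ?thesis by (simp add: z(1))
          next
            assume p: "X i \<noteq> root" "X (Suc i) = parent (X i)"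
            have "X (Suc i) \<noteq> []" using elim saws_not_Nil by blast
            then have "?\<phi> (X (Suc i)) \<noteq> []" by simp
            moreover have "?\<phi> (X i) = ?\<phi> (X (Suc i)) @ [?\<psi> (last (X i))]"
              using p(2) saws_snoc_parent[OF Xi(1)] by (metis append.assoc list.simps(8,9) map_append)
            ultimately show ?thesis using IH saws_appendD by metis
          qed
        qed
        then have "X i \<in> D" if "i < m" for i using that lt elim by (simp add: D_def)
        then show "X \<in> {X. reaches A D X}" using m unfolding reaches_def by blast
      qed
    qed
  qed
  also have "\<dots> \<le> emeasure (RWs G lam (?\<phi> \<tau>)) {X. reaches (line \<union> near w) UNIV X}"
  proof (rule emeasure_reaches_transfer)
    show "?\<phi> ` A \<subseteq> line \<union> near w" by (auto simp: A_def line_def last_map plant_def)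
    show "?\<phi> ` D \<subseteq> UNIV" by simp
    fix \<tau>' assume "\<tau>' \<in> D"
    then have \<tau>': "\<tau>' \<in> saws half_plane" "\<tau>' \<notin> A" "?\<phi> \<tau>' \<in> saws G" by (auto simp: D_def)
    have ne: "\<tau>' \<noteq> []" by (rule saws_not_Nil[OF \<tau>'(1)])
    have l0: "snd (last \<tau>') \<noteq> 0" using \<tau>'(2) ne by (simp add: A_def)
    show "RW_step G lam (?\<phi> \<tau>') = map_pmf ?\<phi> (RW_step half_plane lam \<tau>')"
    proof (rule RW_step_embedding[OF lam iso \<tau>'(1) _ \<tau>'(3)])
      show "\<tau>' \<noteq> root" using l0 by (auto simp: root_def)
      have "snd (last (?\<phi> \<tau>')) \<noteq> 0" using l0 s(1) ne by (auto simp: last_map plant_def)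
      then show "?\<phi> \<tau>' \<noteq> root" by (auto simp: root_def)
      fix z assume "nbr (last \<tau>') z"
      from fits[OF \<tau>'(1,2) this] show "z \<in> half_plane \<longleftrightarrow> ?\<psi> z \<in> G \<and> ?\<psi> z \<notin> set (butlast w)"
        using wsub by blast
    qed
  qed
  also have "\<dots> \<le> emeasure (RWs G lam v) {X. \<exists>n. X n \<in> line \<union> near w}"
    unfolding \<phi>\<tau> by (rule reaches_le_hit)
  finally show ?thesis by (intro antisym emeasure_markov_le_1)
qed

lemma AE_off_line_returns:
  assumes G: "G \<in> {UNIV, half_plane}" and lam: "lam > 0" and w: "w \<in> saws G" "w \<in> line"
  shows "AE X in RWs G lam root. \<forall>n. X n \<in> off_line G w \<longrightarrow> (\<exists>m\<ge>n. X m \<in> line \<union> near w)"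
proof -
  define J where "J X \<longleftrightarrow> X 0 \<in> off_line G w \<and> (\<forall>n. X n \<notin> line \<union> near w)" for X :: "nat \<Rightarrow> site list"
  have J: "path_event J" unfolding J_def by (intro path_event_intros)
  have ev: "path_event (\<lambda>X. \<exists>n. X n \<in> line \<union> near w)" by (intro path_event_intros)
  have "emeasure (RWs G lam t) {X. J X} = 0" for t
  proof (cases "t \<in> off_line G w")
    case True
    have "emeasure (RWs G lam t) {X. J X} \<le> emeasure (RWs G lam t) {X. \<not> (\<exists>n. X n \<in> line \<union> near w)}"
      by (rule emeasure_markov_mono[OF _ path_event_not[OF ev]]) (simp add: J_def)
    also have "\<dots> = 0"
      unfolding emeasure_markov_compl[OF ev] off_line_returns[OF G lam w True] by simp
    finally show ?thesis by simp
  next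
    case False
    have "emeasure (RWs G lam t) {X. J X} = emeasure (RWs G lam t) {X. False}"
      by (rule emeasure_markov_cong_start[OF J path_event_const]) (use False in \<open>simp add: J_def\<close>)
    then show ?thesis by simp
  qed
  from AE_markov_shift[OF J this] show ?thesis
  proof eventually_elim
    case (elim X)
    show ?case
    proof (intro allI impI)
      fix n assume "X n \<in> off_line G w"
      then obtain m where "X (m + n) \<in> line \<union> near w" using elim unfolding J_def by auto
      then show "\<exists>m\<ge>n. X m \<in> line \<union> near w" by (intro exI[of _ "m + n"]) simp
    qed
  qed
qed

section \<open>Following a free path\<close>

definition entries :: "site set \<Rightarrow> site list \<Rightarrow> nat \<Rightarrow> site list set" where
  "entries G P i = {v \<in> saws G. last v = P ! i \<and> set v \<inter> set (drop (Suc i) P) = {}}"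

text \<open>The rest of \<open>P\<close> is followed with probability at least
  \<open>min_step lam ^ length P\<close>, whatever walk has led to the entry.\<close>

lemma AE_follow_path:
  assumes G: "G \<in> {UNIV, half_plane}" and lam: "lam > 0"
    and P: "successively nbr P" "distinct P" "set P \<subseteq> G" "i < length P"
  shows "AE X in RWs G lam root. infinite {n. X n \<in> entries G P i} \<longrightarrow> infinite {n. X n \<in> {u. last u = last P}}"
proof (rule AE_markov_recurrent_target)
  show "0 < ennreal (min_step lam) ^ length P" by (rule min_step_power_pos[OF lam])
  fix v assume "v \<in> entries G P i"
  then have v: "v \<in> saws G" "last v = P ! i" "set v \<inter> set (drop (Suc i) P) = {}" by (auto simp: entries_def)
  have d: "drop i P = P ! i # drop (Suc i) P" by (rule Cons_nth_drop_Suc[symmetric, OF P(4)])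
  have "successively nbr (drop i P)"
    using P(1) by (metis append_take_drop_id successively_append_iff)
  then have "successively nbr (last v # drop (Suc i) P)" using d v(2) by simp
  then have ext: "v @ drop (Suc i) P \<in> saws G"
    using v P by (intro saws_append) (auto dest: in_set_dropD)
  have "last (v @ drop (Suc i) P) = last P"
  proof (cases "drop (Suc i) P = []")
    case True
    then have "Suc i = length P" using P(4) by simp
    moreover have "P \<noteq> []" using P(4) by auto
    ultimately have "last P = P ! i" by (metis last_conv_nth diff_Suc_1)
    then show ?thesis using True v(2) by simp
  qed (simp add: last_drop)
  then show "ennreal (min_step lam) ^ length P \<le> emeasure (RWs G lam v) {X. \<exists>n. X n \<in> {u. last u = last P}}"
    using ext saws_not_Nil[OF v(1)] by (intro hit_extension_ge[OF lam G]) auto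
qed

section \<open>Excursions of a transient trajectory\<close>

lemma connected_in_refl: "p \<in> C \<Longrightarrow> connected_in C p p"
  unfolding connected_in_def by (rule exI[of _ "[p]"]) simp

text \<open>If the path already contains \<open>r\<close>, it is cut there, which keeps it simple;
  otherwise \<open>r\<close> is appended.\<close>

lemma connected_in_step:
  assumes "connected_in C p q" "nbr q r" "r \<in> C"
  shows "connected_in C p r"
proof -
  obtain P where P: "P \<noteq> []" "hd P = p" "last P = q" "distinct P" "successively nbr P" "set P \<subseteq> C"
    using assms(1) unfolding connected_in_def by blast
  show ?thesis
  proof (cases "r \<in> set P")
    case True
    then obtain a b where "P = a @ r # b" by (meson split_list)
    then show ?thesis
      unfolding connected_in_def using P
      by (intro exI[of _ "a @ [r]"]) (auto simp: successively_append_iff hd_append split: if_splits)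
  next
    case False
    then show ?thesis
      unfolding connected_in_def using P assms(2,3)
      by (intro exI[of _ "P @ [r]"]) (auto simp: successively_append_iff)
  qed
qed

text \<open>The initial pieces of the path join \<open>p\<close> to each of its sites, so the path
  lies in the component.\<close>

lemma connected_in_component:
  assumes "connected_in F p q"
  shows "connected_in {r. connected_in F p r} p q"
proof -
  obtain P where P: "P \<noteq> []" "hd P = p" "last P = q" "distinct P" "successively nbr P" "set P \<subseteq> F"
    using assms unfolding connected_in_def by blast
  have "connected_in F p r" if r: "r \<in> set P" for r
  proof -
    obtain a b where "P = a @ r # b" using r by (meson split_list)
    then show ?thesis
      unfolding connected_in_def using P
      by (intro exI[of _ "a @ [r]"]) (auto simp: successively_append_iff hd_append split: if_splits)
  qed
  then have "set P \<subseteq> {r. connected_in F p r}" by blast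
  then show ?thesis unfolding connected_in_def using P by blast
qed

lemma connected_in_mem: "connected_in F p q \<Longrightarrow> q \<in> F"
  unfolding connected_in_def by (metis last_in_set subsetD)

text \<open>If \<omega> tends downwards, the flip reduces the claim to the upward case.\<close>

lemma no_enclosed_component_sign:
  fixes \<omega> :: "nat \<Rightarrow> site" and C :: "site set"
  assumes s: "s \<in> {1, -1 :: int}" and \<omega>: "\<And>k. nbr (\<omega> k) (\<omega> (Suc k))"
    and up: "\<And>M. finite {k. s * snd (\<omega> k) \<le> M}"
    and C\<omega>: "\<And>k. \<omega> k \<notin> C"
    and p: "p \<in> C" and conn: "\<And>q. q \<in> C \<Longrightarrow> connected_in C p q"
    and rows: "\<And>b. finite {q \<in> C. snd q = b}"
    and left: "\<And>q. q \<in> C \<Longrightarrow> \<exists>k. snd (\<omega> k) = snd q \<and> fst (\<omega> k) < fst q"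
    and right: "\<And>q. q \<in> C \<Longrightarrow> \<exists>k. snd (\<omega> k) = snd q \<and> fst q < fst (\<omega> k)"
    and inf: "infinite C"
  shows False
proof (cases "s = 1")
  case True
  show ?thesis
    by (rule no_enclosed_component[OF \<omega> _ C\<omega> p conn rows left right inf]) (use up True in simp)
next
  case False
  then have s: "s = -1" using s by simp
  have ff: "flip (flip q) = q" for q by (simp add: flip_def)
  have mem: "q \<in> flip ` C \<longleftrightarrow> flip q \<in> C" for q by (metis ff image_iff)
  show ?thesis
  proof (rule no_enclosed_component[where \<omega> = "\<lambda>k. flip (\<omega> k)" and C = "flip ` C" and p = "flip p"])
    show "nbr (flip (\<omega> k)) (flip (\<omega> (Suc k)))" for k
      using \<omega> isometry_nbr[OF isometry_flip] by simp
    show "finite {k. snd (flip (\<omega> k)) \<le> M}" for M using up[of M] s by (simp add: flip_def)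
    show "flip (\<omega> k) \<notin> flip ` C" for k using C\<omega> by (simp add: mem ff)
    show "flip p \<in> flip ` C" using p by simp
    show "connected_in (flip ` C) (flip p) q" if "q \<in> flip ` C" for q
    proof -
      have "flip q \<in> C" using that mem by simp
      then obtain P where P: "P \<noteq> []" "hd P = p" "last P = flip q" "distinct P" "successively nbr P" "set P \<subseteq> C"
        using conn unfolding connected_in_def by blast
      have "distinct (map flip P)"
        using P(4) inj_on_subset[OF isometry_inj[OF isometry_flip] subset_UNIV] by (simp add: distinct_map)
      then show ?thesis
        unfolding connected_in_def using P
        by (intro exI[of _ "map flip P"])
           (auto simp: hd_map last_map ff successively_map_isometry[OF isometry_flip])
    qed
    show "finite {q \<in> flip ` C. snd q = b}" for b
    proof -
      have "{q \<in> flip ` C. snd q = b} \<subseteq> flip ` {q \<in> C. snd q = - b}" by (auto simp: flip_def)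
      then show ?thesis using rows finite_subset by blast
    qed
    show "\<exists>k. snd (flip (\<omega> k)) = snd q \<and> fst (flip (\<omega> k)) < fst q" if "q \<in> flip ` C" for q
    proof -
      have fq: "flip q \<in> C" using that mem by simp
      obtain k where "snd (\<omega> k) = - snd q" "fst (\<omega> k) < fst q" using left[OF fq] by (auto simp: flip_def)
      then show ?thesis by (intro exI[of _ k]) (simp add: flip_def)
    qed
    show "\<exists>k. snd (flip (\<omega> k)) = snd q \<and> fst q < fst (flip (\<omega> k))" if "q \<in> flip ` C" for q
    proof -
      have fq: "flip q \<in> C" using that mem by simp
      obtain k where "snd (\<omega> k) = - snd q" "fst q < fst (\<omega> k)" using right[OF fq] by (auto simp: flip_def)
      then show ?thesis by (intro exI[of _ k]) (simp add: flip_def)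
    qed
    have "inj_on flip C" using isometry_inj[OF isometry_flip] inj_on_subset by blast
    then show "infinite (flip ` C)" using inf finite_imageD by blast
  qed
qed

text \<open>
  All assumptions but \<open>few\<close> hold almost surely, where \<open>E\<close> is the set of vertices on the line from
  which the walk escapes with a probability that is bounded below.
\<close>

locale excursion =
  fixes G :: "site set" and X :: "nat \<Rightarrow> site list" and E :: "site list set" and M0 :: nat
  assumes G: "G \<in> {UNIV, half_plane}" and X: "tree_path G X" and fin: "finite_visits X"
    and records: "\<And>M. M \<ge> M0 \<Longrightarrow> infinite {n. X n \<in> strip_records G M} \<Longrightarrow> infinite {n. X n \<in> E}"
    and follow: "\<And>P i. successively nbr P \<Longrightarrow> distinct P \<Longrightarrow> set P \<subseteq> G \<Longrightarrow> i < length P \<Longrightarrow>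
      infinite {n. X n \<in> entries G P i} \<Longrightarrow> infinite {n. X n \<in> {u. last u = last P}}"
    and returns: "\<And>w n. w \<in> saws G \<Longrightarrow> w \<in> line \<Longrightarrow> X n \<in> off_line G w \<Longrightarrow> \<exists>m\<ge>n. X m \<in> line \<union> near w"
    and few: "finite {n. X n \<in> E}"
begin

text \<open>The first site of a walk in the strip beyond a given distance is the end of a strip
  record, and by \<open>records\<close> and \<open>few\<close> there are only finitely many times at
  such records.\<close>

lemma strip_bounded: "\<exists>R. \<forall>n. \<bar>snd (last (X n))\<bar> \<le> int M \<longrightarrow> \<bar>fst (last (X n))\<bar> \<le> R"
proof -
  let ?M = "max M M0"
  have "finite {n. X n \<in> strip_records G ?M}" using records[of ?M] few by auto
  then have "finite ((\<lambda>n. \<bar>fst (last (X n))\<bar>) ` {n. X n \<in> strip_records G ?M})" by simp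
  then obtain N where N: "\<And>n. X n \<in> strip_records G ?M \<Longrightarrow> \<bar>fst (last (X n))\<bar> \<le> N"
    by (metis (no_types, lifting) Max_ge image_eqI mem_Collect_eq)
  have "\<bar>fst (last (X n))\<bar> \<le> N" if h: "\<bar>snd (last (X n))\<bar> \<le> int M" for n
  proof (rule ccontr)
    assume "\<not> ?thesis"
    then have bad: "\<bar>snd (last (X n))\<bar> \<le> int ?M \<and> \<bar>fst (last (X n))\<bar> \<ge> N + 1" using h by simp
    have l: "last (X n) \<in> set (X n)" by (rule last_in_saw[OF tree_path_saws[OF X]])
    let ?P = "\<lambda>r. \<bar>snd r\<bar> \<le> int ?M \<and> \<bar>fst r\<bar> \<ge> N + 1"
    obtain m where m: "?P (last (X m))" "\<forall>r\<in>set (butlast (X m)). \<not> ?P r"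
      using tree_path_site_visited[OF X l, of ?P] bad by blast
    have "X m \<in> strip_records G ?M"
      using m tree_path_saws[OF X, of m] unfolding strip_records_def by fastforce
    then show False using N[of m] m(1) by simp
  qed
  then show ?thesis by blast
qed

end

locale excursion_ray = excursion +
  fixes \<omega> :: "nat \<Rightarrow> site"
  assumes ray: "\<And>k. \<exists>n0. \<forall>n\<ge>n0. k < length (X n) \<and> prefix (map \<omega> [0..<k]) (X n)"
begin

lemma ray_prefix: "\<exists>n. prefix (map \<omega> [0..<k]) (X n)"
  using ray[of k] by blast

lemma ray_saws: "k \<ge> 1 \<Longrightarrow> map \<omega> [0..<k] \<in> saws G"
  using ray_prefix[of k] saws_prefix[OF tree_path_saws[OF X]] by fastforce

lemma ray_visited: "k \<ge> 1 \<Longrightarrow> \<exists>n. X n = map \<omega> [0..<k]"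
  using ray_prefix[of k] tree_path_prefix_visited[OF X] by fastforce

lemma ray_inj: "\<omega> i = \<omega> j \<Longrightarrow> i = j"
proof -
  assume e: "\<omega> i = \<omega> j"
  have "distinct (map \<omega> [0..<Suc (max i j)])"
    using ray_saws[of "Suc (max i j)"] by (simp add: saws_def del: upt_Suc)
  then have "inj_on \<omega> {0..<Suc (max i j)}" by (simp only: distinct_map set_upt)
  then show "i = j" using e by (rule inj_onD) auto
qed

lemma ray_nbr: "nbr (\<omega> k) (\<omega> (Suc k))"
proof -
  have "successively nbr (map \<omega> [0..<Suc (Suc k)])"
    using ray_saws[of "Suc (Suc k)"] by (simp add: saws_def del: upt_Suc)
  then have "nbr (map \<omega> [0..<Suc (Suc k)] ! k) (map \<omega> [0..<Suc (Suc k)] ! Suc k)"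
    by (rule successively_nbr_nth) simp
  then show ?thesis by (simp del: upt_Suc)
qed

lemma ray_0: "\<omega> 0 = (0, 0)"
  using ray_saws[of 1] by (simp add: saws_def)

lemma ray_site_visited: "\<exists>n. last (X n) = \<omega> k"
proof -
  obtain n where "X n = map \<omega> [0..<Suc k]" using ray_visited[of "Suc k"] by auto
  then show ?thesis by (intro exI[of _ n]) simp
qed

lemma ray_strip_finite: "finite {k. \<bar>snd (\<omega> k)\<bar> \<le> int M}"
proof -
  obtain R where R: "\<And>n. \<bar>snd (last (X n))\<bar> \<le> int M \<Longrightarrow> \<bar>fst (last (X n))\<bar> \<le> R"
    using strip_bounded by blast
  have "\<omega> ` {k. \<bar>snd (\<omega> k)\<bar> \<le> int M} \<subseteq> {-R..R} \<times> {-int M..int M}"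
  proof
    fix q assume "q \<in> \<omega> ` {k. \<bar>snd (\<omega> k)\<bar> \<le> int M}"
    then obtain k where k: "q = \<omega> k" "\<bar>snd (\<omega> k)\<bar> \<le> int M" by blast
    obtain n where "last (X n) = \<omega> k" using ray_site_visited by blast
    then have "\<bar>fst (\<omega> k)\<bar> \<le> R" using R[of n] k by simp
    then show "q \<in> {-R..R} \<times> {-int M..int M}" using k by (auto simp: mem_Times_iff)
  qed
  then have "finite (\<omega> ` {k. \<bar>snd (\<omega> k)\<bar> \<le> int M})" by (rule finite_subset) simp
  then show ?thesis by (rule finite_imageD) (auto intro!: inj_onI ray_inj)
qed

text \<open>Each strip contains finitely many sites of \<omega>. So \<omega> leaves the line for
  good and, as its height changes by at most 1 per step, it stays on one side.\<close>

lemma ray_sign: "\<exists>s\<in>{1, -1 :: int}. \<forall>M. finite {k. s * snd (\<omega> k) \<le> M}"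
proof -
  have "finite {k. \<bar>snd (\<omega> k)\<bar> \<le> int 0}" by (rule ray_strip_finite)
  then obtain K where K: "\<And>k. \<bar>snd (\<omega> k)\<bar> \<le> int 0 \<Longrightarrow> k < K"
    using finite_nat_iff_bounded by auto
  then have nz: "snd (\<omega> k) \<noteq> 0" if "k \<ge> K" for k using K[of k] that by fastforce
  define s where "s = sgn (snd (\<omega> K))"
  have s: "s \<in> {1, -1}" using nz[of K] by (auto simp: s_def sgn_if)
  have pos: "0 < s * snd (\<omega> k)" if "k \<ge> K" for k
    using that
  proof (induction k rule: dec_induct)
    case base
    then show ?case using nz[of K] by (simp add: s_def sgn_if)
  next
    case (step k)
    have "\<bar>snd (\<omega> k) - snd (\<omega> (Suc k))\<bar> \<le> 1" using ray_nbr[of k] by (auto simp: nbr_def)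
    moreover have "snd (\<omega> (Suc k)) \<noteq> 0" using nz step.hyps by simp
    ultimately show ?case using step.IH s by auto
  qed
  have "finite {k. s * snd (\<omega> k) \<le> M}" for M
  proof (rule finite_subset)
    show "finite ({..<K} \<union> {k. \<bar>snd (\<omega> k)\<bar> \<le> int (nat M)})" using ray_strip_finite[of "nat M"] by simp
    show "{k. s * snd (\<omega> k) \<le> M} \<subseteq> {..<K} \<union> {k. \<bar>snd (\<omega> k)\<bar> \<le> int (nat M)}"
    proof
      fix k assume k: "k \<in> {k. s * snd (\<omega> k) \<le> M}"
      show "k \<in> {..<K} \<union> {k. \<bar>snd (\<omega> k)\<bar> \<le> int (nat M)}"
      proof (cases "k < K")
        case False
        then have "0 < s * snd (\<omega> k)" using pos by simp
        then show ?thesis using k s by auto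
      qed simp
    qed
  qed
  then show ?thesis using s by blast
qed

lemma eventually_ray_vertex:
  assumes "infinite S" shows "\<exists>n\<in>S. k < length (X n) \<and> prefix (map \<omega> [0..<k]) (X n)"
proof -
  obtain n0 where n0: "\<forall>n\<ge>n0. k < length (X n) \<and> prefix (map \<omega> [0..<k]) (X n)" using ray by blast
  obtain n where "n \<in> S" "n \<ge> n0" using assms unfolding infinite_nat_iff_unbounded_le by blast
  then show ?thesis using n0 by blast
qed

text \<open>Late walks contain \<open>\<omega> j\<close> among their first sites and go on beyond
  it, so by self-avoidance they cannot end there.\<close>

lemma visited_off_ray:
  assumes "infinite {n. last (X n) = p}"
  shows "p \<noteq> \<omega> j"
proof
  assume p: "p = \<omega> j"
  obtain n where n: "last (X n) = p" "Suc j < length (X n)" "prefix (map \<omega> [0..<Suc j]) (X n)"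
    using eventually_ray_vertex[OF assms, of "Suc j"] by auto
  obtain zs where zs: "X n = map \<omega> [0..<Suc j] @ zs" using n(3) unfolding prefix_def by blast
  have "zs \<noteq> []" using n(2) zs by auto
  then have "last (X n) \<in> set zs" using zs by simp
  moreover have "distinct (X n)" using tree_path_saws[OF X, of n] by (simp add: saws_def)
  moreover have "\<omega> j \<in> set (map \<omega> [0..<Suc j])" by auto
  ultimately show False using n(1) p zs by auto
qed

text \<open>Let \<open>P\<close> join \<open>p\<close> to \<open>q\<close> off the ray. A late walk
  ending at \<open>p\<close> meets \<open>P\<close>; cut at its first site on \<open>P\<close> it is
  an entry, and a long one, because its initial part belongs to the ray. So there are infinitely
  many entries, infinitely many of them with the same index \<open>i\<close>, and
  \<open>follow\<close> leads on to \<open>q\<close>.\<close>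

lemma component_visited:
  assumes p: "infinite {n. last (X n) = p}" and q: "connected_in (G - range \<omega>) p q"
  shows "\<exists>n. last (X n) = q"
proof -
  obtain P where P: "P \<noteq> []" "hd P = p" "last P = q" "distinct P" "successively nbr P" "set P \<subseteq> G - range \<omega>"
    using q unfolding connected_in_def by blast
  let ?V = "\<Union>i<length P. {n. X n \<in> entries G P i}"
  have long: "\<exists>m\<in>?V. k < length (X m)" for k
  proof -
    obtain n where n: "last (X n) = p" "k < length (X n)" "prefix (map \<omega> [0..<k]) (X n)"
      using eventually_ray_vertex[OF p, of k] by auto
    have "last (X n) \<in> set (X n)" by (rule last_in_saw[OF tree_path_saws[OF X]])
    moreover have "p \<in> set P" using P(1,2) by auto
    ultimately obtain m where m: "prefix (X m) (X n)" "last (X m) \<in> set P" "\<forall>r\<in>set (butlast (X m)). r \<notin> set P"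
      using tree_path_site_visited[OF X, of "last (X n)" n "\<lambda>r. r \<in> set P"] n(1) by auto
    obtain i where i: "i < length P" "last (X m) = P ! i" using m(2) by (metis in_set_conv_nth)
    have ms: "X m \<in> saws G" by (rule tree_path_saws[OF X])
    have "P ! i \<notin> set (drop (Suc i) P)"
      using P(4) Cons_nth_drop_Suc[OF i(1)] by (metis distinct.simps(2) distinct_drop)
    then have "set (X m) \<inter> set (drop (Suc i) P) = {}"
      using m(3) i(2) set_butlast_last[OF saws_not_Nil[OF ms]] by (auto dest: in_set_dropD)
    then have "X m \<in> entries G P i" using ms i(2) by (simp add: entries_def)
    moreover have "k < length (X m)"
    proof (rule ccontr)
      assume "\<not> k < length (X m)"
      then have "prefix (X m) (map \<omega> [0..<k])"
        using m(1) n(3) prefix_length_prefix by fastforce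
      then have "last (X m) \<in> range \<omega>"
        using last_in_saw[OF ms] set_mono_prefix by fastforce
      then show False using m(2) P(6) by blast
    qed
    ultimately show ?thesis using i(1) by blast
  qed
  have "infinite ?V"
  proof
    assume "finite ?V"
    then have "finite ((\<lambda>m. length (X m)) ` ?V)" by blast
    then have "length (X m) \<le> Max ((\<lambda>m. length (X m)) ` ?V)" if "m \<in> ?V" for m
      using that by (intro Max_ge) auto
    then show False using long[of "Max ((\<lambda>m. length (X m)) ` ?V)"] by fastforce
  qed
  then obtain i where "i < length P" "infinite {n. X n \<in> entries G P i}" by blast
  then have "infinite {n. X n \<in> {u. last u = last P}}"
    using P by (intro follow[of P i]) auto
  then have "{n. X n \<in> {u. last u = last P}} \<noteq> {}" by (metis finite.emptyI)
  then show ?thesis using P(3) by auto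
qed

theorem site_visits_finite: "finite {n. last (X n) = p}"
proof (rule ccontr)
  assume inf: "infinite {n. last (X n) = p}"
  define F where "F = G - range \<omega>"
  define C where "C = {q. connected_in F p q}"
  have visG: "last (X n) \<in> G" for n
    using last_in_saw[OF tree_path_saws[OF X]] tree_path_saws[OF X, of n] by (auto simp: saws_def)
  obtain n where "last (X n) = p" using inf not_finite_existsD by blast
  then have pF: "p \<in> F" using visG[of n] visited_off_ray[OF inf] by (auto simp: F_def)
  have pC: "p \<in> C" unfolding C_def using connected_in_refl[OF pF] by simp
  have CF: "q \<in> F" if "q \<in> C" for q using that connected_in_mem unfolding C_def by blast
  have step: "r \<in> C" if "q \<in> C" "nbr q r" "r \<in> F" for q r
    using that connected_in_step unfolding C_def by blast
  have vis: "\<exists>n. last (X n) = q" if "q \<in> C" for q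
    using component_visited[OF inf] that unfolding C_def F_def by blast
  have rows: "finite {q \<in> C. snd q = b}" for b
  proof -
    obtain R where R: "\<And>n. \<bar>snd (last (X n))\<bar> \<le> int (nat \<bar>b\<bar>) \<Longrightarrow> \<bar>fst (last (X n))\<bar> \<le> R"
      using strip_bounded by blast
    have "{q \<in> C. snd q = b} \<subseteq> {-R..R} \<times> {b}"
    proof
      fix q assume q: "q \<in> {q \<in> C. snd q = b}"
      then obtain n where "last (X n) = q" using vis by blast
      then have "\<bar>fst q\<bar> \<le> R" using R[of n] q by auto
      then show "q \<in> {-R..R} \<times> {b}" using q by (cases q) auto
    qed
    then show ?thesis by (rule finite_subset) simp
  qed
  \<comment> \<open>Otherwise a whole horizontal half-line from \<open>q\<close> is free of the ray
    and belongs to \<open>C\<close>, although \<open>C\<close> has finitely many sites in each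
    row.\<close>
  have blocked: "\<exists>k. snd (\<omega> k) = snd q \<and> 0 < d * (fst (\<omega> k) - fst q)" if q: "q \<in> C" and d: "d \<in> {1, -1 :: int}" for q d
  proof (rule ccontr)
    assume no: "\<not> ?thesis"
    have qG: "q \<in> G" using CF[OF q] by (simp add: F_def)
    have free: "(fst q + d * (int t + 1), snd q) \<in> F" for t :: nat
    proof -
      have "(fst q + d * (int t + 1), snd q) \<in> G" using qG mem_G_iff[OF G] by auto
      moreover have "\<omega> k \<noteq> (fst q + d * (int t + 1), snd q)" for k
      proof
        assume k: "\<omega> k = (fst q + d * (int t + 1), snd q)"
        then have "d * (fst (\<omega> k) - fst q) = int t + 1" using d by auto
        then show False using no k by (metis add.commute less_add_same_cancel1 of_nat_0_le_iff snd_conv zle_add1_eq_le zless_add1_eq zless_iff_Suc_zadd le_less_trans zero_less_one linorder_not_le)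
      qed
      ultimately show ?thesis unfolding F_def by (metis DiffI imageE rangeE)
    qed
    have "(fst q + d * int t, snd q) \<in> C" for t :: nat
    proof (induction t)
      case (Suc t)
      show ?case
      proof (rule step[OF Suc])
        show "nbr (fst q + d * int t, snd q) (fst q + d * int (Suc t), snd q)"
          using d by (auto simp: nbr_def)
        show "(fst q + d * int (Suc t), snd q) \<in> F" using free[of t] by (simp add: add.commute)
      qed
    qed (use q in simp)
    then have "range (\<lambda>t::nat. (fst q + d * int t, snd q)) \<subseteq> {r \<in> C. snd r = snd q}" by auto
    moreover have "inj (\<lambda>t::nat. (fst q + d * int t, snd q))" using d by (auto simp: inj_def)
    then have "infinite (range (\<lambda>t::nat. (fst q + d * int t, snd q)))" by (rule range_inj_infinite)
    ultimately show False using rows finite_subset by blast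
  qed
  \<comment> \<open>If \<open>C\<close> is finite, a late walk ending at \<open>p\<close> follows
    the ray beyond every ray site in or next to \<open>C\<close>. On the rest of this walk, the site
    before the first one in \<open>C\<close> is not on the ray: later ray sites are not next to
    \<open>C\<close>, and earlier ones are already used. So this site belongs to \<open>C\<close>, a
    contradiction.\<close>
  have infC: "infinite C"
  proof
    assume finC: "finite C"
    define S where "S = C \<union> (\<Union>q\<in>C. {r. nbr q r})"
    have "finite {r. nbr q r}" for q
      by (rule finite_subset[of _ "{(fst q + 1, snd q), (fst q - 1, snd q), (fst q, snd q + 1), (fst q, snd q - 1)}"]) (auto simp: nbr_iff)
    then have "finite S" unfolding S_def using finC by simp
    then have "finite {k. \<omega> k \<in> S}"
      using finite_vimageI[of S \<omega>] ray_inj by (simp add: vimage_def inj_def)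
    then obtain k0 where k0: "\<And>k. \<omega> k \<in> S \<Longrightarrow> k < k0" using finite_nat_iff_bounded by auto
    obtain n where n: "last (X n) = p" "Suc k0 < length (X n)" "prefix (map \<omega> [0..<Suc k0]) (X n)"
      using eventually_ray_vertex[OF inf, of "Suc k0"] by auto
    obtain zs where zs: "X n = map \<omega> [0..<Suc k0] @ zs" using n(3) unfolding prefix_def by blast
    have zne: "zs \<noteq> []" using n(2) zs by auto
    have Xs: "X n \<in> saws G" by (rule tree_path_saws[OF X])
    have dis: "distinct (X n)" "successively nbr (X n)" "set (X n) \<subseteq> G" using Xs by (auto simp: saws_def)
    have X0: "X n = map \<omega> [0..<k0] @ (\<omega> k0 # zs)" using zs by simp
    then have suc: "successively nbr (\<omega> k0 # zs)" using dis(2) by (metis successively_append_iff)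
    have "last zs \<in> C" using n(1) zs zne pC by simp
    then have "\<exists>x\<in>set zs. x \<in> C" using zne last_in_set by blast
    then obtain ys q ys' where split: "zs = ys @ q # ys'" "q \<in> C" "\<forall>y\<in>set ys. y \<notin> C"
      by (rule split_list_first_propE)
    have lnb: "nbr (last (\<omega> k0 # ys)) q" using suc split(1) by (cases ys rule: rev_cases) (auto simp: successively_append_iff successively_Cons)
    then have lS: "last (\<omega> k0 # ys) \<in> S" using split(2) nbr_commute unfolding S_def by blast
    have "ys \<noteq> []" using lS k0[of k0] by auto
    then have ly: "last ys \<in> set ys" "nbr (last ys) q" "last ys \<in> S" using lnb lS by auto
    have "last ys \<in> set zs" using ly(1) split(1) by simp
    then have "last ys \<in> G" using dis(3) zs by auto
    moreover have "last ys \<noteq> \<omega> k" for k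
    proof
      assume e: "last ys = \<omega> k"
      then have "k < k0" using ly(3) k0 by simp
      then have "\<omega> k \<in> set (map \<omega> [0..<Suc k0])" by auto
      then show False using dis(1) \<open>last ys \<in> set zs\<close> e zs by auto
    qed
    ultimately have "last ys \<in> F" unfolding F_def by blast
    then have "last ys \<in> C" using step[OF split(2)] ly(2) nbr_commute by blast
    then show False using split(3) ly(1) by blast
  qed
  obtain s where s: "s \<in> {1, -1 :: int}" "\<And>M. finite {k. s * snd (\<omega> k) \<le> M}" using ray_sign by blast
  show False
  proof (rule no_enclosed_component_sign[OF s(1) ray_nbr s(2) _ pC _ rows _ _ infC])
    show "\<omega> k \<notin> C" for k using CF[of "\<omega> k"] by (auto simp: F_def)
    show "connected_in C p q" if "q \<in> C" for q
      using that connected_in_component unfolding C_def by blast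
    show "\<exists>k. snd (\<omega> k) = snd q \<and> fst (\<omega> k) < fst q" if "q \<in> C" for q
      using blocked[OF that, of "-1"] by auto
    show "\<exists>k. snd (\<omega> k) = snd q \<and> fst q < fst (\<omega> k)" if "q \<in> C" for q
      using blocked[OF that, of 1] by auto
  qed
qed

lemma site_set_visits_finite: "finite A \<Longrightarrow> finite {n. last (X n) \<in> A}"
proof -
  assume "finite A"
  moreover have "{n. last (X n) \<in> A} = (\<Union>p\<in>A. {n. last (X n) = p})" by blast
  ultimately show ?thesis using site_visits_finite by simp
qed

text \<open>The visited sites on the line, and those next to a given walk, form a finite set, so the
  trajectory is there only finitely often. A ray vertex beyond the last line site of the ray that is
  visited after these times contradicts \<open>returns\<close>.\<close>

theorem contradiction: False
proof -
  obtain R where R: "\<And>n. \<bar>snd (last (X n))\<bar> \<le> int 0 \<Longrightarrow> \<bar>fst (last (X n))\<bar> \<le> R"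
    using strip_bounded by blast
  have "{n. X n \<in> line} \<subseteq> {n. last (X n) \<in> {-R..R} \<times> {0}}"
  proof
    fix n assume "n \<in> {n. X n \<in> line}"
    then have "snd (last (X n)) = 0" by (simp add: line_def)
    moreover from this have "\<bar>fst (last (X n))\<bar> \<le> R" using R[of n] by simp
    ultimately show "n \<in> {n. last (X n) \<in> {-R..R} \<times> {0}}" by (cases "last (X n)") auto
  qed
  then have line: "finite {n. X n \<in> line}"
    using site_set_visits_finite[of "{-R..R} \<times> {0}"] finite_subset by blast
  let ?Z = "{k. snd (\<omega> k) = 0}"
  have Z: "finite ?Z" using ray_strip_finite[of 0] by simp
  have Z0: "0 \<in> ?Z" using ray_0 by simp
  define j where "j = Max ?Z"
  have j: "snd (\<omega> j) = 0" using Max_in[OF Z] Z0 unfolding j_def by blast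
  have after: "snd (\<omega> k) \<noteq> 0" if "k > j" for k
    using Max_ge[OF Z, of k] that unfolding j_def by auto
  define w where "w = map \<omega> [0..<Suc j]"
  have w: "w \<in> saws G" unfolding w_def by (rule ray_saws) simp
  have wl: "w \<in> line" using j by (simp add: w_def line_def)
  have "finite {n. X n \<in> near w}"
  proof -
    have "finite {r. nbr r q}" for q
      by (rule finite_subset[of _ "{(fst q + 1, snd q), (fst q - 1, snd q), (fst q, snd q + 1), (fst q, snd q - 1)}"])
         (auto simp: nbr_commute[of _ q] nbr_iff)
    then have "finite {n. last (X n) \<in> (\<Union>q\<in>set w. {r. nbr r q})}"
      by (intro site_set_visits_finite) auto
    moreover have "{n. X n \<in> near w} = {n. last (X n) \<in> (\<Union>q\<in>set w. {r. nbr r q})}" by (auto simp: near_def)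
    ultimately show ?thesis by simp
  qed
  then have "finite {n. X n \<in> line \<union> near w}"
    using line by (simp add: Collect_disj_eq)
  then obtain n0 where n0: "\<And>n. X n \<in> line \<union> near w \<Longrightarrow> n < n0"
    using finite_nat_iff_bounded by auto
  \<comment> \<open>Longer than every walk up to time \<open>n0\<close>, so that this ray vertex is
    visited after \<open>n0\<close>.\<close>
  define k where "k = Max (insert (Suc (Suc j)) ((\<lambda>n. Suc (length (X n))) ` {..n0}))"
  have k: "k \<ge> Suc (Suc j)" unfolding k_def by simp
  have kn: "length (X n) < k" if "n \<le> n0" for n
  proof -
    have "Suc (length (X n)) \<le> k" unfolding k_def using that by (intro Max_ge) auto
    then show ?thesis by simp
  qed
  obtain n where n: "X n = map \<omega> [0..<k]" using ray_visited[of k] k by auto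
  have "n > n0" using kn[of n] n by (metis diff_zero le_less_linear length_map length_upt less_irrefl)
  have split: "[0..<k] = [0..<Suc j] @ [Suc j..<k]"
    using upt_add_eq_append[of 0 "Suc j" "k - Suc j"] k by (simp del: upt_Suc)
  have "X n \<in> off_line G w"
    unfolding off_line_def
  proof (intro CollectI conjI exI[of _ "map \<omega> [Suc j..<k]"])
    show "X n \<in> saws G" by (rule tree_path_saws[OF X])
    show "X n = w @ map \<omega> [Suc j..<k]" unfolding n w_def by (simp only: split map_append)
    show "map \<omega> [Suc j..<k] \<noteq> []" using k by simp
    show "\<forall>p\<in>set (map \<omega> [Suc j..<k]). snd p \<noteq> 0" using after by auto
  qed
  from returns[OF w wl this] obtain m where "m \<ge> n" "X m \<in> line \<union> near w" by blast
  then show False using n0[of m] \<open>n > n0\<close> by simp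
qed

end

section \<open>The limit walk\<close>

text \<open>There are countably many choices of \<open>M\<close>, of \<open>P\<close> and
  \<open>i\<close>, and of \<open>w\<close>, so almost every trajectory satisfies all hypotheses of
  \<open>excursion\<close> except \<open>few\<close> at once.\<close>

lemma AE_line_exits:
  assumes G: "G \<in> {UNIV, half_plane}" and lam: "lam > 0" and tr: "RW_transient G lam"
    and n: "n \<ge> 1" and many: "4 \<le> real (card (bridges n)) * lam ^ n"
    and c: "c = ennreal (min_step lam) ^ Suc (2 * n) * ennreal (escape_bound lam n)"
  shows "AE X in RWs G lam root. infinite {k. X k \<in> line_exits G lam c}"
proof -
  have rec: "AE X in RWs G lam root. \<forall>M. M \<ge> 4 * n \<longrightarrow>
      infinite {k. X k \<in> strip_records G M} \<longrightarrow> infinite {k. X k \<in> line_exits G lam c}"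
    unfolding AE_all_countable
  proof
    fix M
    show "AE X in RWs G lam root. M \<ge> 4 * n \<longrightarrow>
      infinite {k. X k \<in> strip_records G M} \<longrightarrow> infinite {k. X k \<in> line_exits G lam c}"
    proof (cases "M \<ge> 4 * n")
      case True
      have "AE X in RWs G lam root. infinite {k. X k \<in> strip_records G M} \<longrightarrow> infinite {k. X k \<in> line_exits G lam c}"
        unfolding c
        by (rule AE_markov_recurrent_target[OF strip_record_hits[OF G lam n many True] min_step_power_pos[OF lam]])
      then show ?thesis by simp
    qed simp
  qed
  have fol: "AE X in RWs G lam root. \<forall>P i. successively nbr P \<longrightarrow> distinct P \<longrightarrow> set P \<subseteq> G \<longrightarrow> i < length P \<longrightarrow>
      infinite {n. X n \<in> entries G P i} \<longrightarrow> infinite {n. X n \<in> {u. last u = last P}}"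
    unfolding AE_all_countable
  proof (intro allI)
    fix P i
    show "AE X in RWs G lam root. successively nbr P \<longrightarrow> distinct P \<longrightarrow> set P \<subseteq> G \<longrightarrow> i < length P \<longrightarrow>
      infinite {n. X n \<in> entries G P i} \<longrightarrow> infinite {n. X n \<in> {u. last u = last P}}"
    proof (cases "successively nbr P \<and> distinct P \<and> set P \<subseteq> G \<and> i < length P")
      case True
      then have "AE X in RWs G lam root. infinite {n. X n \<in> entries G P i} \<longrightarrow> infinite {n. X n \<in> {u. last u = last P}}"
        by (intro AE_follow_path[OF G lam]) auto
      then show ?thesis by eventually_elim simp
    qed auto
  qed
  have ret: "AE X in RWs G lam root. \<forall>w. w \<in> saws G \<longrightarrow> w \<in> line \<longrightarrow>
      (\<forall>n. X n \<in> off_line G w \<longrightarrow> (\<exists>m\<ge>n. X m \<in> line \<union> near w))"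
    unfolding AE_all_countable
  proof
    fix w
    show "AE X in RWs G lam root. w \<in> saws G \<longrightarrow> w \<in> line \<longrightarrow>
      (\<forall>n. X n \<in> off_line G w \<longrightarrow> (\<exists>m\<ge>n. X m \<in> line \<union> near w))"
    proof (cases "w \<in> saws G \<and> w \<in> line")
      case True
      then have "AE X in RWs G lam root. \<forall>n. X n \<in> off_line G w \<longrightarrow> (\<exists>m\<ge>n. X m \<in> line \<union> near w)"
        by (intro AE_off_line_returns[OF G lam]) auto
      then show ?thesis by eventually_elim simp
    qed auto
  qed
  show ?thesis
    using AE_tree_path[OF lam G] AE_finite_visits[OF lam G tr] rec fol ret
  proof eventually_elim
    case (elim X)
    show ?case
    proof
      assume few: "finite {k. X k \<in> line_exits G lam c}"
      interpret excursion G X "line_exits G lam c" "4 * n"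
        by unfold_locales (use G elim few in blast)+
      obtain \<omega> where "\<And>k. \<exists>n0. \<forall>n\<ge>n0. k < length (X n) \<and> prefix (map \<omega> [0..<k]) (X n)"
        using tree_path_ray[OF X fin] by metis
      then interpret excursion_ray G X "line_exits G lam c" "4 * n" \<omega>
        by unfold_locales
      show False by (rule contradiction)
    qed
  qed
qed

text \<open>A vertex whose parent is never visited again is a vertex of the limit walk, at an index
  one less than its number of sites. Finite visits turn infinitely many such times into infinitely
  many vertices.\<close>

lemma limit_walk_on_line:
  assumes X: "tree_path G X" and fin: "finite_visits X"
    and inf: "infinite {n. X n \<in> line_exits G lam c \<and> (\<forall>m\<ge>n. X m \<noteq> parent (X n))}"
  shows "infinite {k. snd (last (limit_walk G X k)) = 0}"
proof
  let ?S = "{n. X n \<in> line_exits G lam c \<and> (\<forall>m\<ge>n. X m \<noteq> parent (X n))}"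
  let ?K = "{k. snd (last (limit_walk G X k)) = 0}"
  assume K: "finite ?K"
  have lw: "limit_walk G X (length (X n) - 1) = X n" if n: "n \<in> ?S" for n
  proof (rule limit_walk_eqI)
    show s: "X n \<in> saws G" by (rule tree_path_saws[OF X])
    show "length (X n) = Suc (length (X n) - 1)" using saws_not_Nil[OF s] by simp
    fix m assume "m > n"
    have nr: "\<forall>m\<ge>n. X m \<noteq> parent (X n)" using n by simp
    have "prefix (X n) (X m)" by (rule tree_path_stay[OF X _ nr]) (use \<open>m > n\<close> in simp_all)
    then show "X m \<in> subtree G (X n)" using tree_path_saws[OF X, of m] by (auto simp: subtree_def prefix_def)
  qed
  have "{n. X n \<in> limit_walk G X ` ?K} \<supseteq> ?S"
  proof
    fix n assume n: "n \<in> ?S"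
    then have "snd (last (X n)) = 0" by (simp add: line_exits_def line_def)
    then have "length (X n) - 1 \<in> ?K" using lw[OF n] by simp
    then show "n \<in> {n. X n \<in> limit_walk G X ` ?K}" using lw[OF n] by (metis image_eqI mem_Collect_eq)
  qed
  moreover have "finite {n. X n \<in> limit_walk G X ` ?K}"
    by (rule finite_visits_finite_set[OF fin]) (use K in simp)
  ultimately show False using inf finite_subset by blast
qed

lemma ennreal_le_minus_swap:
  fixes a c :: ennreal
  assumes "a \<le> 1" "c \<le> 1 - a"
  shows "a \<le> 1 - c"
proof -
  have "c \<le> 1" by (rule order_trans[OF assms(2)]) (simp add: diff_le_self_ennreal)
  then show ?thesis
    using assms by (cases a; cases c) (auto simp: ennreal_1[symmetric] ennreal_minus ennreal_le_iff2 top_unique simp del: ennreal_1)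
qed

theorem theorem2:
  fixes G :: "site set" and lam :: real
  assumes "G \<in> {UNIV, half_plane}"
    and "ennreal lam > lambda_c G"
  shows "AE \<omega> in limit_law G lam. infinite {k. \<omega> k \<in> UNIV \<times> {0}}"
proof -
  note G = assms(1)
  have lam: "lam > 0" and tr: "RW_transient G lam" using RW_transient_if_gt_lambda_c[OF assms(2)] by auto
  obtain n where n: "n \<ge> 1" "4 \<le> real (card (bridges n)) * lam ^ n"
    using many_bridges[OF assms] by blast
  define c where "c = ennreal (min_step lam) ^ Suc (2 * n) * ennreal (escape_bound lam n)"
  have c: "c > 0"
    unfolding c_def using min_step_power_pos[OF lam, of "Suc (2 * n)"] escape_bound_pos[of n lam] n(1)
    by (simp add: ennreal_zero_less_mult_iff)
  have noret: "emeasure (RWs G lam b) {X. \<exists>n. X n = parent b} \<le> 1 - c" if "b \<in> line_exits G lam c" for b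
  proof -
    have "c \<le> 1 - emeasure (RWs G lam b) {X. \<exists>n. X n = parent b}"
      using that by (simp add: line_exits_def esc_eq)
    then show ?thesis by (rule ennreal_le_minus_swap[OF emeasure_markov_le_1])
  qed
  have c1: "1 - c < 1" using c
    by (cases c) (auto simp: ennreal_1[symmetric] ennreal_minus simp del: ennreal_1 intro!: ennreal_lessI)
  have nr: "AE X in RWs G lam root. infinite {n. X n \<in> line_exits G lam c} \<longrightarrow>
      infinite {n. X n \<in> line_exits G lam c \<and> (\<forall>m\<ge>n. X m \<noteq> parent (X n))}"
    by (rule AE_markov_no_return[OF noret c1])
  have "AE X in RWs G lam root. infinite {k. snd (last (limit_walk G X k)) = 0}"
    using AE_line_exits[OF G lam tr n c_def] nr AE_tree_path[OF lam G] AE_finite_visits[OF lam G tr]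
  proof eventually_elim
    case (elim X)
    show ?case by (rule limit_walk_on_line[OF elim(3,4)]) (use elim in blast)
  qed
  then have main: "AE X in RW G lam. infinite {k. last (limit_walk G X k) \<in> UNIV \<times> {0}}"
    unfolding RW_def by eventually_elim (simp add: mem_Times_iff)
  \<comment> \<open>Measurability of the event on site sequences allows the almost sure statement to
    pass to the image law.\<close>
  have "{\<omega> \<in> space path_space. infinite {k. \<omega> k \<in> UNIV \<times> {0 :: int}}} \<in> sets (path_space :: (nat \<Rightarrow> site) measure)"
    using path_event_infinite[of "UNIV \<times> {0}"] by (simp add: path_event_def)
  then show ?thesis
    unfolding limit_law_def
    by (subst AE_distr_iff[OF measurable_limit_walk]) (use main in simp_all)
qed

end
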